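(* Let $A$, $\Lambda$, $E$, $r_N$, $\mathcal{V}$, $\mathcal{V}_h$, $R_h(z)$, $S_N^h$, $E_h$, the form $a$, the operators $A_E$, $A_{E_h}$, and $\Lambda_h=\Sigma(A_{E_h})$ be as in the context. In addition to Assumptions 1, 2, 3 and 4 stated in the context, suppose $\|u\|_{\mathcal{V}}=\||A|^{1/2}u\|_{\mathcal{H}}$ (for all $u\in\mathcal{V}$). Then there are positive constants $C_0$ and $h_0$ such that for all $h<h_0$, we have $\operatorname{gap}_{\mathcal{V}}(E,E_h)<1$ and $$\operatorname{dist}(\Lambda,\Lambda_h)\le(\Lambda_h^{\max})^2\operatorname{gap}_{\mathcal{V}}(E,E_h)^2+C_0\,\|A_E\|\,\operatorname{gap}_{\mathcal{H}}(E,E_h)^2,$$ where $\Lambda_h^{\max}=\sup_{0\ne e_h\in E_h}\||A|^{1/2}e_h\|_{\mathcal{H}}/\|e_h\|_{\mathcal{H}}$ satisfies $$(\Lambda_h^{\max})^2\le\left(\frac{1}{1-\operatorname{gap}_{\mathcal{V}}(E,E_h)}\right)^2\|A_E\|.$$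
   Context: Setting. $A:\operatorname{dom}(A)\subseteq\mathcal{H}\to\mathcal{H}$ is a linear, closed, selfadjoint (not necessarily bounded) operator in a complex Hilbert space $\mathcal{H}$, with spectrum $\Sigma(A)\subset\mathbb{R}$ and resolvent $R(z)=(z-A)^{-1}$. $\Lambda\subset\Sigma(A)$ is a finite collection of eigenvalues of finite multiplicity; $E$ is the span of all eigenvectors associated with elements of $\Lambda$; $m=\dim E$, assumed to satisfy $1\le m<\infty$; $\lambda_1,\ldots,\lambda_m$ are the elements of $\Lambda$ counted with multiplicity. Filter. $r_N(\xi)=w_N+\sum_{k=0}^{N-1}w_k(z_k-\xi)^{-1}$ with $w_k,z_k\in\mathbb{C}$, $W=\sum_{k=0}^N|w_k|$, and $S_N=r_N(A)=w_N+\sum_{k=0}^{N-1}w_kR(z_k)$ (the scalar $w_N$ means $w_N$ times the identity). For $y\in\mathbb{R}$, $\gamma,\delta>0$ let $I_\gamma^y=\{x\in\mathbb{R}:|x-y|\le\gamma\}$, $O_{\delta,\gamma}^y=\{x\in\mathbb{R}:|x-y|\ge(1+\delta)\gamma\}$, and $\hat\kappa=\sup_{x\in O_{\delta,\gamma}^y}|r_N(x)|\,/\,\inf_{x\in I_\gamma^y}|r_N(x)|$. Assumption 1. There are $y\in\mathbb{R}$, $\delta>0$, $\gamma>0$ such that $\Lambda\subset I_\gamma^y$ and $\Sigma(A)\setminus\Lambda\subset O_{\delta,\gamma}^y$; and $r_N$ is a rational function of the form $r_N(\xi)=w_N+\sum_{k=0}^{N-1}w_k(z_k-\xi)^{-1}$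 with $z_k\notin\overline{\Sigma(A)}$, $W<\infty$, $\hat\kappa<1$. Assumption 2. There is a Hilbert space $\mathcal{V}\subseteq\mathcal{H}$ such that $E\subseteq\mathcal{V}$, there is $C_{\mathcal{V}}>0$ with $\|u\|_{\mathcal{H}}\le C_{\mathcal{V}}\|u\|_{\mathcal{V}}$ for all $u\in\mathcal{V}$, and $\mathcal{V}$ is an invariant subspace of $R(z)$ for $z$ in the resolvent set of $A$. Discretization. For each value of a parameter $h>0$ (tending to $0$), $\mathcal{V}_h$ is a finite-dimensional subspace of $\mathcal{V}$ and $R_h(z):\mathcal{H}\to\mathcal{V}_h$ is a finite-rank approximation of $R(z)$; $S_N^h=w_N+\sum_{k=0}^{N-1}w_kR_h(z_k)$. Assumption 3. The operators $R_h(z_k)$ and $R(z_k)$ are bounded in $\mathcal{V}$ and $\lim_{h\to0}\|R_h(z_k)-R(z_k)\|_{\mathcal{V}}=0$ for all $k=0,\ldots,N-1$ (operator norm on $\mathcal{V}$). $S_N$ and $S_N^h$ are viewed as bounded operators on $\mathcal{V}$. Let $\mu_i=r_N(\lambda_i)$ and $\mu_*=\sup\{|\mu|:\mu\in\Sigma(S_N)\setminus\{\mu_1,\ldots,\mu_m\}\}$; Assumption 1 gives $\mu_*<|\mu_i|$ and $\mu_i\neq0$ for $i=1,\ldots,m$. Fix a simple rectifiable closed curve $\Theta$ in $\mathbb{C}$ that encloses $\{\mu_1,\ldots,\mu_m\}$, lies strictly outside the circle of radius $\mu_*$ centered at $0$, and encloses no other element of $\Sigma(S_N)$ (nor $0$).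 For sufficiently small $h$, $\Theta$ lies in the resolvent set of $S_N^h$ and encloses exactly $m$ eigenvalues (with multiplicity) of $S_N^h$; for such $h$ define $P_h=\frac{1}{2\pi i}\oint_\Theta(z-S_N^h)^{-1}\,dz$ and $E_h=\operatorname{ran}P_h$ (so $\dim E_h=m$, and $E_h\subset\mathcal{V}_h$). Form and Ritz values. Let $A=U_A|A|=|A|U_A$ be the polar decomposition of $A$ ($U_A$ selfadjoint and partially isometric, $|A|$ selfadjoint positive semidefinite). The form associated to $A$ is $a(x,y)=(U_A|A|^{1/2}x,|A|^{1/2}y)_{\mathcal{H}}$ for $x,y\in\operatorname{dom}(a)=\operatorname{dom}(|A|^{1/2})$. For a finite-dimensional subspace $F\subset\operatorname{dom}(a)$, $A_F:F\to F$ is defined by $(A_Fx,y)_{\mathcal{H}}=a(x,y)$ for all $x,y\in F$; $\Sigma(A_F)$ is its spectrum. $\Lambda_h=\Sigma(A_{E_h})$. $\|A_E\|$ is the operator norm of $A_E$ on $(E,\|\cdot\|_{\mathcal{H}})$. Assumption 4. $\mathcal{V}_h\subset\operatorname{dom}(a)$. Gap. For $\mathcal{X}\in\{\mathcal{H},\mathcal{V}\}$ and subspaces $M,L$ of $\mathcal{X}$, $\operatorname{gap}_{\mathcal{X}}(M,L)=\max\big[\sup_{x\in M,\|x\|_{\mathcal{X}}=1}\operatorname{dist}_{\mathcal{X}}(x,L),\ \sup_{x\in L,\|x\|_{\mathcal{X}}=1}\operatorname{dist}_{\mathcal{X}}(x,M)\big]$, where $\operatorname{dist}_{\mathcal{X}}(x,L)=\inf_{l\in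 L}\|x-l\|_{\mathcal{X}}$. Hausdorff distance. For $\Upsilon_1,\Upsilon_2\subset\mathbb{R}$, $\operatorname{dist}(\Upsilon_1,\Upsilon_2)=\max\big[\sup_{\mu_1\in\Upsilon_1}\operatorname{dist}(\mu_1,\Upsilon_2),\ \sup_{\mu_2\in\Upsilon_2}\operatorname{dist}(\mu_2,\Upsilon_1)\big]$ with $\operatorname{dist}(\mu,\Upsilon)=\inf_{\nu\in\Upsilon}|\mu-\nu|$. *)

theory Defs
  imports "HOL-Analysis.Analysis"
begin

section \<open>Complex Hilbert spaces\<close>

text \<open>The inner product is linear in its first argument. The topology and the real scalar
  multiplication are those of \<^class>\<open>real_normed_vector\<close>, so that the library notions of limit,
  closure, \<^const>\<open>bounded_linear\<close> and \<^const>\<open>onorm\<close> apply.\<close>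

class complex_inner = real_normed_vector +
  fixes scaleC :: "complex \<Rightarrow> 'a \<Rightarrow> 'a" (infixr "*\<^sub>C" 75)
    and cinner :: "'a \<Rightarrow> 'a \<Rightarrow> complex"
  assumes scaleC_add_right: "c *\<^sub>C (x + y) = c *\<^sub>C x + c *\<^sub>C y"
    and scaleC_add_left: "(c + d) *\<^sub>C x = c *\<^sub>C x + d *\<^sub>C x"
    and scaleC_scaleC: "c *\<^sub>C (d *\<^sub>C x) = (c * d) *\<^sub>C x"
    and scaleC_one: "1 *\<^sub>C x = x"
    and scaleR_scaleC: "r *\<^sub>R x = complex_of_real r *\<^sub>C x"
    and cinner_commute: "cinner x y = cnj (cinner y x)"
    and cinner_add_left: "cinner (x + y) u = cinner x u + cinner y u"
    and cinner_scaleC_left: "cinner (c *\<^sub>C x) y = c * cinner x y"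
    and cinner_self_norm: "cinner x x = complex_of_real ((norm x)\<^sup>2)"

class chilbert_space = complex_inner + complete_space

global_interpretation complex_vector: vector_space "scaleC :: complex \<Rightarrow> 'a \<Rightarrow> 'a :: complex_inner"
  defines csubspace = complex_vector.subspace
    and cspan = complex_vector.span
    and cdim = complex_vector.dim
  by unfold_locales (simp_all add: scaleC_add_right scaleC_add_left scaleC_scaleC scaleC_one)

abbreviation clinear :: "('a::complex_inner \<Rightarrow> 'b::complex_inner) \<Rightarrow> bool" where
  "clinear \<equiv> Vector_Spaces.linear scaleC scaleC"

definition fin_dim :: "'a::complex_inner set \<Rightarrow> bool" where
  "fin_dim F \<longleftrightarrow> (\<exists>B. finite B \<and> cspan B = F)"


section \<open>Possibly unbounded operators\<close>

text \<open>An operator is given by its domain \<open>D\<close> and a function \<open>T\<close> whose values outside \<open>D\<close> are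
  irrelevant. The sets \<open>res_set X D T\<close> and \<open>spectrum X D T\<close> refer to \<open>T\<close> as an operator
  in the subspace \<open>X\<close>.\<close>

definition linear_op :: "'a::complex_inner set \<Rightarrow> ('a \<Rightarrow> 'a) \<Rightarrow> bool" where
  "linear_op D T \<longleftrightarrow> csubspace D \<and>
     (\<forall>x\<in>D. \<forall>y\<in>D. T (x + y) = T x + T y) \<and> (\<forall>c. \<forall>x\<in>D. T (c *\<^sub>C x) = c *\<^sub>C T x)"

definition closed_op :: "'a::complex_inner set \<Rightarrow> ('a \<Rightarrow> 'a) \<Rightarrow> bool" where
  "closed_op D T \<longleftrightarrow> closed ((\<lambda>x. (x, T x)) ` D)"

text \<open>The right-hand side of the equation for \<open>D\<close> is the domain of the adjoint.\<close>

definition selfadjoint_op :: "'a::complex_inner set \<Rightarrow> ('a \<Rightarrow> 'a) \<Rightarrow> bool" where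
  "selfadjoint_op D T \<longleftrightarrow> linear_op D T \<and> closure D = UNIV \<and>
     D = {y. \<exists>v. \<forall>x\<in>D. cinner (T x) y = cinner x v} \<and>
     (\<forall>x\<in>D. \<forall>y\<in>D. cinner (T x) y = cinner x (T y))"

definition positive_op :: "'a::complex_inner set \<Rightarrow> ('a \<Rightarrow> 'a) \<Rightarrow> bool" where
  "positive_op D T \<longleftrightarrow> (\<forall>x\<in>D. 0 \<le> Re (cinner (T x) x))"

definition res_set :: "'a::complex_inner set \<Rightarrow> 'a set \<Rightarrow> ('a \<Rightarrow> 'a) \<Rightarrow> complex set" where
  "res_set X D T = {z. bij_betw (\<lambda>x. z *\<^sub>C x - T x) D X \<and>
     (\<exists>K. \<forall>x\<in>D. norm x \<le> K * norm (z *\<^sub>C x - T x))}"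

definition spectrum :: "'a::complex_inner set \<Rightarrow> 'a set \<Rightarrow> ('a \<Rightarrow> 'a) \<Rightarrow> complex set" where
  "spectrum X D T = - res_set X D T"

definition resolvent :: "'a::complex_inner set \<Rightarrow> ('a \<Rightarrow> 'a) \<Rightarrow> complex \<Rightarrow> 'a \<Rightarrow> 'a" where
  "resolvent D T z = inv_into D (\<lambda>x. z *\<^sub>C x - T x)"

definition eigenspace :: "'a::complex_inner set \<Rightarrow> ('a \<Rightarrow> 'a) \<Rightarrow> complex \<Rightarrow> 'a set" where
  "eigenspace D T l = {x \<in> D. T x = l *\<^sub>C x}"

definition partial_isometry :: "('a::complex_inner \<Rightarrow> 'a) \<Rightarrow> bool" where
  "partial_isometry U \<longleftrightarrow> clinear U \<and> bounded_linear U \<and>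
     (\<forall>x. (\<forall>y. U y = 0 \<longrightarrow> cinner x y = 0) \<longrightarrow> norm (U x) = norm x)"

text \<open>\<open>A = U |A| = |A| U\<close>, with \<open>P\<close> (of domain \<open>DP\<close>) in the role of \<open>|A|\<close>; the products carry
  their natural domains. Equality of the kernels of \<open>U\<close> and \<open>|A|\<close> belongs to the polar
  decomposition and makes both factors unique.\<close>

definition polar_decomposition ::
  "'a::complex_inner set \<Rightarrow> ('a \<Rightarrow> 'a) \<Rightarrow> ('a \<Rightarrow> 'a) \<Rightarrow> 'a set \<Rightarrow> ('a \<Rightarrow> 'a) \<Rightarrow> bool" where
  "polar_decomposition D A U DP P \<longleftrightarrow>
     selfadjoint_op UNIV U \<and> partial_isometry U \<and>
     selfadjoint_op DP P \<and> positive_op DP P \<and>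
     {x. U x = 0} = {x \<in> DP. P x = 0} \<and>
     DP = D \<and> (\<forall>x\<in>D. A x = U (P x)) \<and>
     {x. U x \<in> DP} = D \<and> (\<forall>x\<in>D. A x = P (U x))"

definition positive_sqrt ::
  "'a::complex_inner set \<Rightarrow> ('a \<Rightarrow> 'a) \<Rightarrow> 'a set \<Rightarrow> ('a \<Rightarrow> 'a) \<Rightarrow> bool" where
  "positive_sqrt DP P DB B \<longleftrightarrow> selfadjoint_op DB B \<and> positive_op DB B \<and>
     {x \<in> DB. B x \<in> DB} = DP \<and> (\<forall>x\<in>DP. P x = B (B x))"


section \<open>The rational filter\<close>

definition rat_filter :: "(nat \<Rightarrow> complex) \<Rightarrow> (nat \<Rightarrow> complex) \<Rightarrow> nat \<Rightarrow> complex \<Rightarrow> complex" where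
  "rat_filter w z N \<xi> = w N + (\<Sum>k<N. w k / (z k - \<xi>))"

text \<open>\<open>Q k\<close> stands for the resolvent at \<open>z k\<close> or for an approximation of it.\<close>

definition filter_op ::
  "(nat \<Rightarrow> complex) \<Rightarrow> nat \<Rightarrow> (nat \<Rightarrow> 'a \<Rightarrow> 'a) \<Rightarrow> 'a::complex_inner \<Rightarrow> 'a" where
  "filter_op w N Q u = w N *\<^sub>C u + (\<Sum>k<N. w k *\<^sub>C Q k u)"

definition I_set :: "real \<Rightarrow> real \<Rightarrow> real set" where
  "I_set y \<gamma> = {x. \<bar>x - y\<bar> \<le> \<gamma>}"

definition O_set :: "real \<Rightarrow> real \<Rightarrow> real \<Rightarrow> real set" where
  "O_set y \<delta> \<gamma> = {x. \<bar>x - y\<bar> \<ge> (1 + \<delta>) * \<gamma>}"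

text \<open>Since \<open>1 / 0 = 0\<close> in HOL, the poles are removed from the two sets. Neither extremum
  changes thereby: both sets have no isolated points, the function is unbounded near a genuine
  pole and continuous at a removable one. A zero infimum (including \<open>0 / 0\<close>) gives \<open>\<infinity>\<close>.\<close>

definition filter_kappa ::
  "(nat \<Rightarrow> complex) \<Rightarrow> (nat \<Rightarrow> complex) \<Rightarrow> nat \<Rightarrow> real \<Rightarrow> real \<Rightarrow> real \<Rightarrow> ennreal" where
  "filter_kappa w z N y \<delta> \<gamma> =
     (let mag = (\<lambda>x. ennreal (cmod (rat_filter w z N (complex_of_real x))));
          poles = {x. \<exists>k<N. complex_of_real x = z k};
          s = (SUP x \<in> O_set y \<delta> \<gamma> - poles. mag x);
          i = (INF x \<in> I_set y \<gamma> - poles. mag x)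
      in if i = 0 then \<infinity> else s / i)"

text \<open>An operator on \<open>H\<close> leaving invariant the range of the injection \<open>\<iota> : V \<rightarrow> H\<close>, viewed as an
  operator on \<open>V\<close>.\<close>

definition on_subspace :: "('v \<Rightarrow> 'h) \<Rightarrow> ('h \<Rightarrow> 'h) \<Rightarrow> 'v \<Rightarrow> 'v" where
  "on_subspace \<iota> T u = inv \<iota> (T (\<iota> u))"

text \<open>The element \<open>0\<close> is inserted only to give the empty supremum the value \<open>0\<close>.\<close>

definition mu_star :: "complex set \<Rightarrow> complex set \<Rightarrow> real" where
  "mu_star Spec M = Sup (insert 0 (cmod ` (Spec - M)))"


section \<open>Contour integrals along rectifiable curves\<close>

definition rectifiable_path :: "(real \<Rightarrow> complex) \<Rightarrow> bool" where
  "rectifiable_path g \<longleftrightarrow> path g \<and>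
     (\<exists>L. \<forall>d. d division_of {0..1} \<longrightarrow> (\<Sum>K\<in>d. cmod (g (Sup K) - g (Inf K))) \<le> L)"

text \<open>Limit of Riemann--Stieltjes sums as the mesh tends to \<open>0\<close>.\<close>

definition has_curve_integral ::
  "(complex \<Rightarrow> 'a::complex_inner) \<Rightarrow> 'a \<Rightarrow> (real \<Rightarrow> complex) \<Rightarrow> bool" where
  "has_curve_integral f I g \<longleftrightarrow>
     (\<forall>\<epsilon>>0. \<exists>\<delta>>0. \<forall>p. p tagged_division_of {0..1} \<and> (\<forall>(t, K)\<in>p. diameter K < \<delta>) \<longrightarrow>
        norm ((\<Sum>(t, K)\<in>p. (g (Sup K) - g (Inf K)) *\<^sub>C f (g t)) - I) < \<epsilon>)"

definition curve_integral ::
  "(real \<Rightarrow> complex) \<Rightarrow> (complex \<Rightarrow> 'a::complex_inner) \<Rightarrow> 'a" where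
  "curve_integral g f = (THE I. has_curve_integral f I g)"

text \<open>The integral of the operator-valued resolvent, evaluated at a vector. For a clockwise curve
  this is the negative of the Riesz projection, which has the same range.\<close>

definition riesz_projection ::
  "(real \<Rightarrow> complex) \<Rightarrow> ('a::complex_inner \<Rightarrow> 'a) \<Rightarrow> 'a \<Rightarrow> 'a" where
  "riesz_projection g S u =
     (1 / (2 * of_real pi * \<i>)) *\<^sub>C curve_integral g (\<lambda>\<zeta>. resolvent UNIV S \<zeta> u)"


section \<open>Form, Ritz values, gap and Hausdorff distance\<close>

text \<open>\<open>B\<close> stands for \<open>|A|\<^sup>1\<^sup>/\<^sup>2\<close>.\<close>

definition form_of :: "('a::complex_inner \<Rightarrow> 'a) \<Rightarrow> ('a \<Rightarrow> 'a) \<Rightarrow> 'a \<Rightarrow> 'a \<Rightarrow> complex" where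
  "form_of U B x y = cinner (U (B x)) (B y)"

definition ritz_op :: "('a::complex_inner \<Rightarrow> 'a \<Rightarrow> complex) \<Rightarrow> 'a set \<Rightarrow> 'a \<Rightarrow> 'a" where
  "ritz_op a F x = (THE v. v \<in> F \<and> (\<forall>y\<in>F. cinner v y = a x y))"

definition subspace_onorm :: "'a::complex_inner set \<Rightarrow> ('a \<Rightarrow> 'a) \<Rightarrow> real" where
  "subspace_onorm F T = (SUP x \<in> {x \<in> F. norm x = 1}. norm (T x))"

definition Lambda_max :: "('a::complex_inner \<Rightarrow> 'a) \<Rightarrow> 'a set \<Rightarrow> real" where
  "Lambda_max B F = (SUP e \<in> F - {0}. norm (B e) / norm e)"

text \<open>Meaningful when neither \<open>M\<close> nor \<open>L\<close> is \<open>{0}\<close>.\<close>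

definition gap :: "'a::complex_inner set \<Rightarrow> 'a set \<Rightarrow> real" where
  "gap M L = max (SUP x \<in> {x \<in> M. norm x = 1}. infdist x L)
                 (SUP x \<in> {x \<in> L. norm x = 1}. infdist x M)"

definition hausdorff_dist :: "complex set \<Rightarrow> complex set \<Rightarrow> real" where
  "hausdorff_dist Y1 Y2 = max (SUP \<mu>\<in>Y1. infdist \<mu> Y2) (SUP \<mu>\<in>Y2. infdist \<mu> Y1)"

end

theory Submission
  imports Defs "HOL-Complex_Analysis.Riemann_Mapping"
    "HOL-Computational_Algebra.Fundamental_Theorem_Algebra"
begin

text \<open>
  Write \<open>B = |A|\<^sup>1\<^sup>/\<^sup>2\<close>, so that the norm of \<open>V\<close> is \<open>\<parallel>B u\<parallel>\<close>, and let \<open>Q\<close> be the orthogonal projection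
  onto \<open>E\<close>. Eigenvectors of \<open>A\<close> for \<open>l\<close> are eigenvectors of \<open>B\<close> for the root of \<open>|l|\<close>, and \<open>0\<close> is not in
  \<open>\<Lambda>\<close> because the energy norm is definite. Hence \<open>Q\<close> is the orthogonal projection in \<open>V\<close> as well as in
  \<open>H\<close>, and it splits the form \<open>a\<close>. The proof has two independent parts.

  \<^bold>\<open>The spaces converge.\<close> The Riesz projections of the discretized filters \<open>S\<^sub>h\<close> converge in \<open>V\<close> to \<open>\<sigma> Q\<close>,
  where \<open>\<sigma> = \<plusminus>1\<close> is the orientation of the curve (\<open>riesz_projection_stable\<close>). The operators \<open>S\<^sub>h\<close> are
  \<open>w\<^sub>N\<close> plus an operator of finite rank, so every vector is a sum of generalized eigenvectors
  (\<open>finite_rank_root_span\<close>). On these the resolvent is a finite sum of powers of \<open>(\<zeta> - \<mu>)\<^sup>-\<^sup>1\<close>, whose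
  integrals are winding numbers or \<open>0\<close>. This shows that \<open>P\<^sub>h\<^sup>2 = \<sigma> P\<^sub>h\<close>. It also gives \<open>\<sigma> Q\<close> for the block
  diagonal part of \<open>S\<^sub>h\<close>, whose resolvents are close to those of \<open>S\<^sub>h\<close>. The block diagonal part has its
  remaining eigenvalues outside the curve because \<open>\<zeta> - S\<^sub>N\<close> is bounded below on the complement of
  \<open>E\<close>, uniformly for \<open>\<zeta>\<close> on and inside the curve. For a filtered eigenvalue \<open>\<zeta> = r\<^sub>N(l)\<close> this lower bound
  follows from injectivity, because \<open>S\<^sub>N - w\<^sub>N\<close> is a limit of operators of finite rank
  (\<open>injective_imp_bounded_below\<close>); and \<open>\<zeta> - S\<^sub>N\<close> is injective there because an eigenvector of \<open>S\<^sub>N\<close> in the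
  complement would yield an eigenvalue of \<open>A\<close> outside \<open>\<Lambda>\<close> with filter value \<open>r\<^sub>N(l)\<close>
  (\<open>filter_eigenvector_imp_eigenvector\<close>), against \<open>\<kappa> < 1\<close> (\<open>filter_kappa_separates\<close>). Once \<open>P\<^sub>h\<close> is close
  to \<open>\<sigma> Q\<close>, the gap in \<open>V\<close> between \<open>E\<close> and the range of \<open>P\<^sub>h\<close> is at most the same distance.

  \<^bold>\<open>The Ritz values converge quadratically.\<close> For \<open>u\<close> in \<open>E\<^sub>h\<close> the residual \<open>u - Q u\<close> is bounded by the gap in
  each of the two norms, and \<open>a(u, v) = (A Q u, Q v) + a(u - Q u, v - Q v)\<close>, with the same splitting of the
  inner product. So an eigenvector on either side has on the other side a residual that is quadratic in
  the gaps, and Hermitian operators have an eigenvalue within the residual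
  (\<open>eigenvalue_near_residual\<close>, \<open>ritz_estimate\<close>).
\<close>

section \<open>Complex inner product spaces\<close>

lemma cinner_zero_left [simp]: "cinner 0 x = 0"
  using cinner_scaleC_left[of 0 0 x] by simp

lemma cinner_minus_left [simp]: "cinner (- x) y = - cinner x y"
  using cinner_add_left[of x "- x" y] by (simp add: eq_neg_iff_add_eq_0 add.commute)

lemma cinner_diff_left: "cinner (x - y) u = cinner x u - cinner y u"
  using cinner_add_left[of x "- y" u] by simp

lemma cinner_add_right: "cinner u (x + y) = cinner u x + cinner u y"
  by (metis cinner_add_left cinner_commute complex_cnj_add)

lemma cinner_scaleC_right: "cinner x (c *\<^sub>C y) = cnj c * cinner x y"
  by (metis cinner_commute cinner_scaleC_left complex_cnj_mult)

lemma cinner_zero_right [simp]: "cinner x 0 = 0"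
  by (metis cinner_commute cinner_zero_left complex_cnj_zero)

lemma cinner_minus_right [simp]: "cinner y (- x) = - cinner y x"
  by (metis cinner_commute cinner_minus_left complex_cnj_minus)

lemma cinner_diff_right: "cinner u (x - y) = cinner u x - cinner u y"
  using cinner_add_right[of u x "- y"] by simp

lemma cinner_sum_left: "cinner (sum f S) y = (\<Sum>i\<in>S. cinner (f i) y)"
  by (induction S rule: infinite_finite_induct) (simp_all add: cinner_add_left)

lemma cinner_sum_right: "cinner y (sum f S) = (\<Sum>i\<in>S. cinner y (f i))"
  by (induction S rule: infinite_finite_induct) (simp_all add: cinner_add_right)

lemma norm_eq_Re_cinner: "(norm x)\<^sup>2 = Re (cinner x x)"
  by (simp add: cinner_self_norm)

lemma cinner_self_eq_0 [simp]: "cinner x x = 0 \<longleftrightarrow> x = 0"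
  by (simp add: cinner_self_norm)

lemma cinner_eq_0_commute: "cinner x y = 0 \<longleftrightarrow> cinner y x = 0"
  by (metis cinner_commute complex_cnj_zero)

lemma norm_scaleC: "norm (c *\<^sub>C x) = cmod c * norm x"
proof -
  have "complex_of_real ((norm (c *\<^sub>C x))\<^sup>2) = c * cnj c * cinner x x"
    by (simp only: cinner_self_norm[symmetric] cinner_scaleC_left cinner_scaleC_right mult_ac)
  also have "\<dots> = complex_of_real ((cmod c * norm x)\<^sup>2)"
    by (simp add: cinner_self_norm power_mult_distrib complex_norm_square[symmetric])
  finally have "(norm (c *\<^sub>C x))\<^sup>2 = (cmod c * norm x)\<^sup>2"
    using of_real_eq_iff by blast
  then show ?thesis by simp
qed

lemma norm_add_square: "(norm (x + y))\<^sup>2 = (norm x)\<^sup>2 + (norm y)\<^sup>2 + 2 * Re (cinner x y)"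
proof -
  have "Re (cinner y x) = Re (cinner x y)" by (metis cinner_commute cnj.sel(1))
  then show ?thesis by (simp add: norm_eq_Re_cinner cinner_add_left cinner_add_right)
qed

lemma pythagoras: "cinner x y = 0 \<Longrightarrow> (norm (x + y))\<^sup>2 = (norm x)\<^sup>2 + (norm y)\<^sup>2"
  by (simp add: norm_add_square)

lemma cinner_Cauchy_Schwarz: "cmod (cinner x y) \<le> norm x * norm y"
proof (cases "y = 0")
  case False
  define c where "c = cinner x y / of_real ((norm y)\<^sup>2)"
  have ny: "(norm y)\<^sup>2 \<noteq> 0" using False by simp
  have "cinner (x - c *\<^sub>C y) (c *\<^sub>C y) = 0"
    using False by (simp add: cinner_diff_left cinner_scaleC_left cinner_scaleC_right cinner_self_norm c_def)
  from pythagoras[OF this] have "(norm (c *\<^sub>C y))\<^sup>2 \<le> (norm x)\<^sup>2" by simp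
  then have "cmod c * norm y \<le> norm x"
    by (simp add: norm_scaleC power2_le_iff_abs_le abs_mult)
  moreover have "cmod c * norm y * norm y = cmod (cinner x y)"
    using False by (simp add: c_def norm_divide power2_eq_square norm_mult)
  ultimately show ?thesis by (metis mult_right_mono norm_ge_zero)
qed simp

text \<open>Polarization: the norm determines the real part of the inner product, and replacing \<open>y\<close> by
  \<open>\<i> y\<close> turns the imaginary part into a real one.\<close>

lemma linear_preserves_cinner_if_norm:
  fixes L :: "'a::complex_inner \<Rightarrow> 'b::complex_inner"
  assumes add: "\<And>x y. L (x + y) = L x + L y" and sc: "\<And>c x. L (c *\<^sub>C x) = c *\<^sub>C L x"
    and n: "\<And>x. norm (L x) = norm x"
  shows "cinner (L x) (L y) = cinner x y"
proof -
  have re: "Re (cinner (L x) (L y)) = Re (cinner x y)" for x y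
    using norm_add_square[of x y] norm_add_square[of "L x" "L y"] n[of "x + y"] n[of x] n[of y]
    by (simp add: add)
  have "Im (cinner (L x) (L y)) = Im (cinner x y)"
    using re[of x "\<i> *\<^sub>C y"] by (simp add: sc cinner_scaleC_right)
  with re show ?thesis by (simp add: complex_eq_iff)
qed

lemma bounded_linear_scaleC_left: "bounded_linear (\<lambda>c. c *\<^sub>C x)"
  by (rule bounded_linear_intro[where K = "norm x"])
    (simp_all add: scaleC_add_left norm_scaleC scaleR_scaleC scaleC_scaleC scaleR_conv_of_real)

lemma bounded_linear_scaleC_right: "bounded_linear (\<lambda>x. c *\<^sub>C x)"
  by (rule bounded_linear_intro[where K = "cmod c"])
    (simp_all add: scaleC_add_right norm_scaleC scaleR_scaleC scaleC_scaleC mult.commute)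

lemma bounded_linear_cinner_left: "bounded_linear (\<lambda>x. cinner x y)"
  by (rule bounded_linear_intro[where K = "norm y"])
    (simp_all add: cinner_add_left cinner_scaleC_left cinner_Cauchy_Schwarz scaleR_scaleC scaleR_conv_of_real)

lemma csubspace_iff:
  "csubspace X \<longleftrightarrow> 0 \<in> X \<and> (\<forall>x\<in>X. \<forall>y\<in>X. x + y \<in> X) \<and> (\<forall>c. \<forall>x\<in>X. c *\<^sub>C x \<in> X)"
  by (auto simp: complex_vector.subspace_def)

lemma csubspace_orth: "csubspace {x. \<forall>e\<in>E. cinner x e = 0}"
  by (auto simp: csubspace_iff cinner_add_left cinner_scaleC_left)

lemma cinner_span_eq_0:
  assumes "\<And>e. e \<in> B \<Longrightarrow> cinner x e = 0" "y \<in> cspan B"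
  shows "cinner x y = 0"
  using assms(2)
proof (induction rule: complex_vector.span_induct)
  case base show ?case by (auto simp: csubspace_iff cinner_add_right cinner_scaleC_right)
qed (use assms in auto)

lemma clinear_iff: "clinear f \<longleftrightarrow> (\<forall>x y. f (x + y) = f x + f y) \<and> (\<forall>c x. f (c *\<^sub>C x) = c *\<^sub>C f x)"
  by (auto simp: Vector_Spaces.linear_iff complex_vector.vector_space_axioms)


section \<open>Finite-dimensional subspaces\<close>

text \<open>Finiteness is part of the notion, so that \<open>oproj\<close> below is the orthogonal projection onto
  the span without any convergence question.\<close>

definition orthonormal :: "'a::complex_inner set \<Rightarrow> bool" where
  "orthonormal G \<longleftrightarrow> finite G \<and> (\<forall>e\<in>G. \<forall>f\<in>G. cinner e f = (if e = f then 1 else 0))"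

definition oproj :: "'a::complex_inner set \<Rightarrow> 'a \<Rightarrow> 'a" where
  "oproj G x = (\<Sum>e\<in>G. cinner x e *\<^sub>C e)"

lemma oproj_in_span: "oproj G x \<in> cspan G"
  unfolding oproj_def
  by (intro complex_vector.span_sum complex_vector.span_scale complex_vector.span_base)

lemma oproj_add: "oproj G (x + y) = oproj G x + oproj G y"
  by (simp add: oproj_def cinner_add_left scaleC_add_left sum.distrib)

lemma oproj_scaleC: "oproj G (c *\<^sub>C x) = c *\<^sub>C oproj G x"
  by (simp add: oproj_def cinner_scaleC_left scaleC_scaleC complex_vector.scale_sum_right)

lemma oproj_diff: "oproj G (x - y) = oproj G x - oproj G y"
  by (simp add: oproj_def cinner_diff_left complex_vector.scale_left_diff_distrib sum_subtractf)

lemma oproj_residual_orth: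
  assumes "orthonormal G" "y \<in> cspan G"
  shows "cinner (x - oproj G x) y = 0"
proof (rule cinner_span_eq_0[OF _ assms(2)])
  fix e assume e: "e \<in> G"
  have "cinner (oproj G x) e = (\<Sum>f\<in>G. if f = e then cinner x e else 0)"
    unfolding oproj_def cinner_sum_left cinner_scaleC_left
    using assms e by (intro sum.cong) (auto simp: orthonormal_def)
  also have "\<dots> = cinner x e" using assms e by (simp add: orthonormal_def)
  finally show "cinner (x - oproj G x) e = 0" by (simp add: cinner_diff_left)
qed

lemma oproj_ident:
  assumes "orthonormal G" "x \<in> cspan G"
  shows "oproj G x = x"
proof -
  have "x - oproj G x \<in> cspan G" using assms oproj_in_span complex_vector.span_diff by blast
  from oproj_residual_orth[OF assms(1) this, of x] show ?thesis by simp
qed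

lemma oproj_eq_0:
  assumes "\<And>e. e \<in> cspan G \<Longrightarrow> cinner x e = 0"
  shows "oproj G x = 0"
  unfolding oproj_def using assms by (simp add: complex_vector.span_base)

lemma norm_oproj_square:
  assumes "orthonormal G"
  shows "(norm x)\<^sup>2 = (norm (oproj G x))\<^sup>2 + (norm (x - oproj G x))\<^sup>2"
  using pythagoras[of "x - oproj G x" "oproj G x"] oproj_residual_orth[OF assms oproj_in_span]
  by simp

lemma norm_oproj_le:
  assumes "orthonormal G"
  shows "norm (oproj G x) \<le> norm x" "norm (x - oproj G x) \<le> norm x"
  using norm_oproj_square[OF assms, of x]
  by (metis add_increasing add_increasing2 norm_ge_zero order_refl power2_le_imp_le zero_le_power2)+

lemma oproj_nearest:
  assumes "orthonormal G" "y \<in> cspan G"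
  shows "norm (x - oproj G x) \<le> norm (x - y)"
proof -
  have "oproj G x - y \<in> cspan G" using assms oproj_in_span complex_vector.span_diff by blast
  from pythagoras[OF oproj_residual_orth[OF assms(1) this, of x]]
  have "(norm (x - oproj G x))\<^sup>2 \<le> (norm (x - y))\<^sup>2" by simp
  then show ?thesis by (rule power2_le_imp_le) simp
qed

lemma infdist_cspan:
  assumes "orthonormal G"
  shows "infdist x (cspan G) = norm (x - oproj G x)"
proof (rule antisym)
  show "infdist x (cspan G) \<le> norm (x - oproj G x)"
    by (metis dist_norm infdist_le oproj_in_span)
  show "norm (x - oproj G x) \<le> infdist x (cspan G)"
    unfolding infdist_def using complex_vector.span_zero[of G]
    by (auto intro!: cINF_greatest simp: dist_norm oproj_nearest[OF assms])
qed

lemma orthonormal_norm: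
  assumes "orthonormal G" "e \<in> G"
  shows "norm e = 1"
proof -
  have "cinner e e = 1" using assms by (simp add: orthonormal_def)
  then have "(norm e)\<^sup>2 = 1" by (simp add: norm_eq_Re_cinner)
  then show ?thesis by (metis norm_ge_zero one_power2 power2_eq_imp_eq zero_le_one)
qed

text \<open>Gram--Schmidt, adding one vector of the spanning set at a time.\<close>

lemma orthonormal_basis_exists:
  assumes "finite B"
  shows "\<exists>G. orthonormal G \<and> cspan G = cspan B"
  using assms
proof (induction B rule: finite_induct)
  case empty
  then show ?case by (intro exI[of _ "{}"]) (simp add: orthonormal_def)
next
  case (insert b B)
  then obtain G where G: "orthonormal G" "cspan G = cspan B" by auto
  define r where "r = b - oproj G b"
  have span: "cspan (insert b B) = cspan (insert b G)"
    using G(2) by (simp add: complex_vector.span_insert)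
  show ?case
  proof (cases "r = 0")
    case True
    then have "b \<in> cspan G" using oproj_in_span[of G b] by (simp add: r_def)
    then show ?thesis using G(1) span complex_vector.span_redundant by metis
  next
    case False
    define f where "f = complex_of_real (1 / norm r) *\<^sub>C r"
    have ff: "cinner f f = 1" using False
      by (simp add: f_def cinner_self_norm norm_scaleC norm_divide)
    have fO: "cinner f e = 0" "cinner e f = 0" if "e \<in> G" for e
    proof -
      show "cinner f e = 0" using oproj_residual_orth[OF G(1) complex_vector.span_base[OF that], of b]
        by (simp add: f_def r_def cinner_scaleC_left)
      then show "cinner e f = 0" using cinner_eq_0_commute by blast
    qed
    have "orthonormal (insert f G)"
      using G(1) ff fO by (auto simp: orthonormal_def)
    moreover have "cspan (insert f G) = cspan (insert b G)"
    proof
      have "f \<in> cspan (insert b G)"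
        unfolding f_def r_def
        by (intro complex_vector.span_scale complex_vector.span_diff
            complex_vector.span_mono[THEN subsetD, OF subset_insertI oproj_in_span]
            complex_vector.span_base insertI1)
      then show "cspan (insert f G) \<subseteq> cspan (insert b G)"
        by (intro complex_vector.span_minimal) (auto intro: complex_vector.span_base)
      have "oproj G b \<in> cspan (insert f G)"
        using oproj_in_span complex_vector.span_mono by blast
      moreover have "b = complex_of_real (norm r) *\<^sub>C f + oproj G b"
        using False by (simp add: f_def scaleC_scaleC scaleC_one) (simp add: r_def)
      ultimately have "b \<in> cspan (insert f G)"
        by (metis complex_vector.span_add complex_vector.span_base complex_vector.span_scale insertI1)
      then show "cspan (insert b G) \<subseteq> cspan (insert f G)"
        by (intro complex_vector.span_minimal) (auto intro: complex_vector.span_base)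
    qed
    ultimately show ?thesis using span by metis
  qed
qed

lemma fin_dim_orthonormal_basis:
  assumes "fin_dim X"
  obtains G where "orthonormal G" "cspan G = X"
  using assms orthonormal_basis_exists unfolding fin_dim_def by metis

lemma linear_op_sum:
  assumes "linear_op X f" "\<And>i. i \<in> I \<Longrightarrow> v i \<in> X"
  shows "f (\<Sum>i\<in>I. c i *\<^sub>C v i) = (\<Sum>i\<in>I. c i *\<^sub>C f (v i))"
proof -
  have X: "csubspace X" and add: "\<And>x y. x \<in> X \<Longrightarrow> y \<in> X \<Longrightarrow> f (x + y) = f x + f y"
    and sc: "\<And>c x. x \<in> X \<Longrightarrow> f (c *\<^sub>C x) = c *\<^sub>C f x"
    using assms(1) by (auto simp: linear_op_def)
  have "f 0 = 0" using sc[of 0 0] X by (simp add: csubspace_iff)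
  then show ?thesis
    using assms(2)
  proof (induction I rule: infinite_finite_induct)
    case (insert i I)
    have "(\<Sum>i\<in>I. c i *\<^sub>C v i) \<in> X" "c i *\<^sub>C v i \<in> X"
      using insert X by (auto intro!: complex_vector.subspace_sum complex_vector.subspace_scale)
    then show ?case using insert by (simp add: add sc)
  qed simp_all
qed

lemma linear_op_fin_dim_bounded:
  fixes f :: "'a::complex_inner \<Rightarrow> 'a"
  assumes "fin_dim X" "linear_op X f"
  shows "\<exists>K. \<forall>x\<in>X. norm (f x) \<le> K * norm x"
proof -
  obtain G where G: "orthonormal G" "cspan G = X" using assms(1) by (rule fin_dim_orthonormal_basis)
  have "norm (f x) \<le> (\<Sum>e\<in>G. norm (f e)) * norm x" if "x \<in> X" for x
  proof -
    have "f x = f (oproj G x)" using oproj_ident G that by metis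
    also have "\<dots> = (\<Sum>e\<in>G. cinner x e *\<^sub>C f e)"
      unfolding oproj_def using G(2) by (intro linear_op_sum[OF assms(2)]) (auto intro: complex_vector.span_base)
    also have "norm \<dots> \<le> (\<Sum>e\<in>G. norm x * norm (f e))"
    proof (rule sum_norm_le)
      fix e assume e: "e \<in> G"
      then have "norm e = 1" using G(1) orthonormal_norm by blast
      then have "cmod (cinner x e) \<le> norm x" using cinner_Cauchy_Schwarz[of x e] by simp
      then show "norm (cinner x e *\<^sub>C f e) \<le> norm x * norm (f e)"
        by (simp add: norm_scaleC mult_right_mono)
    qed
    finally show ?thesis by (simp add: sum_distrib_left sum_distrib_right mult.commute)
  qed
  then show ?thesis by blast
qed

text \<open>In orthonormal coordinates, a bounded subset of a finite-dimensional subspace lies in an iterated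
  sum of compact discs.\<close>

lemma compact_combinations:
  fixes G :: "'a::complex_inner set"
  assumes "finite G"
  shows "compact {(\<Sum>e\<in>G. c e *\<^sub>C e) |c. \<forall>e\<in>G. cmod (c e) \<le> r}"
  using assms
proof (induction G rule: finite_induct)
  case empty
  have "{(\<Sum>e\<in>{}. c e *\<^sub>C e) |c. \<forall>e\<in>{}. cmod (c e) \<le> r} = {0::'a}" by auto
  then show ?case by simp
next
  case (insert b G)
  let ?C = "{(\<Sum>e\<in>G. c e *\<^sub>C e) |c. \<forall>e\<in>G. cmod (c e) \<le> r}"
  have cont: "continuous_on S (\<lambda>a. a *\<^sub>C b)" for S
    by (rule linear_continuous_on[OF bounded_linear_scaleC_left])
  have "compact ((\<lambda>a. a *\<^sub>C b) ` cball 0 r)"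
    by (rule compact_continuous_image[OF cont compact_cball])
  from compact_sums[OF this insert.IH]
  have "compact {x + y |x y. x \<in> (\<lambda>a. a *\<^sub>C b) ` cball 0 r \<and> y \<in> ?C}" .
  also have "{x + y |x y. x \<in> (\<lambda>a. a *\<^sub>C b) ` cball 0 r \<and> y \<in> ?C}
     = {(\<Sum>e\<in>insert b G. c e *\<^sub>C e) |c. \<forall>e\<in>insert b G. cmod (c e) \<le> r}" (is "?L = ?R")
  proof
    show "?L \<subseteq> ?R"
    proof clarsimp
      fix a c assume a: "cmod a \<le> r" "\<forall>e\<in>G. cmod (c e) \<le> r"
      have "(\<Sum>e\<in>G. c e *\<^sub>C e) = (\<Sum>e\<in>G. (c(b := a)) e *\<^sub>C e)"
        using insert.hyps by (intro sum.cong) auto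
      then show "\<exists>ca. a *\<^sub>C b + (\<Sum>e\<in>G. c e *\<^sub>C e) = (\<Sum>e\<in>insert b G. ca e *\<^sub>C e) \<and>
          cmod (ca b) \<le> r \<and> (\<forall>e\<in>G. cmod (ca e) \<le> r)"
        using a insert.hyps by (intro exI[of _ "c(b := a)"]) auto
    qed
    show "?R \<subseteq> ?L" using insert.hyps by (force simp: image_iff)
  qed
  finally show ?case .
qed

lemma bounded_seq_in_fin_dim_convergent:
  fixes x :: "nat \<Rightarrow> 'a::complex_inner"
  assumes "fin_dim X" "\<And>n. x n \<in> X" "\<And>n. norm (x n) \<le> r"
  shows "\<exists>l s. strict_mono (s :: nat \<Rightarrow> nat) \<and> (x \<circ> s) \<longlonglongrightarrow> l"
proof -
  obtain G where G: "orthonormal G" "cspan G = X" using assms(1) by (rule fin_dim_orthonormal_basis)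
  let ?C = "{(\<Sum>e\<in>G. c e *\<^sub>C e) |c. \<forall>e\<in>G. cmod (c e) \<le> r}"
  have "x n \<in> ?C" for n
  proof -
    have "x n = oproj G (x n)" using oproj_ident G assms(2) by metis
    moreover have "cmod (cinner (x n) e) \<le> r" if e: "e \<in> G" for e
      using cinner_Cauchy_Schwarz[of "x n" e] assms(3)[of n] orthonormal_norm[OF G(1) e] by simp
    ultimately show ?thesis unfolding oproj_def mem_Collect_eq by (intro exI[of _ "cinner (x n)"] conjI) auto
  qed
  moreover have "compact ?C" using G by (intro compact_combinations) (simp add: orthonormal_def)
  moreover define C where "C = ?C"
  ultimately have "\<forall>n. x n \<in> C" "compact C" by simp_all
  then show ?thesis unfolding compact_def by blast
qed

section \<open>Generalized eigenvectors of algebraic operators\<close>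

definition shift :: "('a::complex_inner \<Rightarrow> 'a) \<Rightarrow> complex \<Rightarrow> 'a \<Rightarrow> 'a" where
  "shift T \<mu> x = T x - \<mu> *\<^sub>C x"

definition gen_eigenvectors :: "'a::complex_inner set \<Rightarrow> ('a \<Rightarrow> 'a) \<Rightarrow> complex \<Rightarrow> 'a set" where
  "gen_eigenvectors X T \<mu> = {x \<in> X. \<exists>n. (shift T \<mu> ^^ n) x = 0}"

definition poly_op :: "('a::complex_inner \<Rightarrow> 'a) \<Rightarrow> complex poly \<Rightarrow> 'a \<Rightarrow> 'a" where
  "poly_op T p x = (\<Sum>i\<le>degree p. coeff p i *\<^sub>C (T ^^ i) x)"

lemma poly_op_eq:
  assumes "degree p \<le> n"
  shows "poly_op T p x = (\<Sum>i\<le>n. coeff p i *\<^sub>C (T ^^ i) x)"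
  unfolding poly_op_def using assms
  by (intro sum.mono_neutral_left) (auto simp: coeff_eq_0)

lemma poly_op_0 [simp]: "poly_op T 0 x = 0"
  by (simp add: poly_op_def)

lemma poly_op_add: "poly_op T (p + q) x = poly_op T p x + poly_op T q x"
  by (simp add: poly_op_eq[where n = "max (degree p) (degree q)"] degree_add_le
      scaleC_add_left sum.distrib)

lemma poly_op_smult: "poly_op T (smult c p) x = c *\<^sub>C poly_op T p x"
  by (simp add: poly_op_eq[where n = "degree p"] degree_smult_le scaleC_scaleC complex_vector.scale_sum_right)

lemma poly_op_diff: "poly_op T (p - q) x = poly_op T p x - poly_op T q x"
  using poly_op_add[of T p "smult (-1) q" x] by (simp only: poly_op_smult) simp

lemma poly_op_sum: "poly_op T (\<Sum>k\<in>S. p k) x = (\<Sum>k\<in>S. poly_op T (p k) x)"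
  by (induction S rule: infinite_finite_induct) (simp_all add: poly_op_add)

text \<open>Only the values of \<open>T\<close> on \<open>X\<close> are constrained. Thus the same facts serve operators on the whole
  space, their restrictions to a complement, and Ritz operators, which are meaningless outside their
  subspace.\<close>

locale invariant_subspace =
  fixes X :: "'a::complex_inner set" and T :: "'a \<Rightarrow> 'a"
  assumes linear: "linear_op X T" and maps: "x \<in> X \<Longrightarrow> T x \<in> X"
begin

lemma subspace: "csubspace X" using linear by (simp add: linear_op_def)

lemma add: "x \<in> X \<Longrightarrow> y \<in> X \<Longrightarrow> T (x + y) = T x + T y"
  and scale: "x \<in> X \<Longrightarrow> T (c *\<^sub>C x) = c *\<^sub>C T x"
  using linear by (auto simp: linear_op_def)

lemma zero: "T 0 = 0"
  using scale[of 0 0] subspace by (simp add: complex_vector.subspace_0)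

lemma in_X: "0 \<in> X" "x \<in> X \<Longrightarrow> y \<in> X \<Longrightarrow> x + y \<in> X" "x \<in> X \<Longrightarrow> c *\<^sub>C x \<in> X"
  "x \<in> X \<Longrightarrow> y \<in> X \<Longrightarrow> x - y \<in> X"
  using subspace
  by (auto simp: complex_vector.subspace_0 complex_vector.subspace_add complex_vector.subspace_scale
      complex_vector.subspace_diff)

lemma diff: "x \<in> X \<Longrightarrow> y \<in> X \<Longrightarrow> T (x - y) = T x - T y"
  using add[of x "(-1) *\<^sub>C y"] scale[of y "-1"] in_X(3)[of y "-1"] by simp

lemma pow_in: "x \<in> X \<Longrightarrow> (T ^^ n) x \<in> X"
  by (induction n) (auto intro: maps)

lemma pow_add: "x \<in> X \<Longrightarrow> y \<in> X \<Longrightarrow> (T ^^ n) (x + y) = (T ^^ n) x + (T ^^ n) y"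
  by (induction n) (auto simp: add pow_in)

lemma pow_scale: "x \<in> X \<Longrightarrow> (T ^^ n) (c *\<^sub>C x) = c *\<^sub>C (T ^^ n) x"
  by (induction n) (auto simp: scale pow_in)

lemma pow_zero: "(T ^^ n) 0 = 0"
  by (induction n) (auto simp: zero)

lemma linear_op_pow: "linear_op X (T ^^ n)"
  using subspace by (auto simp: linear_op_def pow_add pow_scale)

lemma shift_invariant: "invariant_subspace X (shift T \<mu>)"
proof
  show "linear_op X (shift T \<mu>)"
    using subspace
    by (auto simp: linear_op_def shift_def add scale scaleC_add_right scaleC_scaleC
        complex_vector.scale_right_diff_distrib mult.commute)
qed (auto simp: shift_def in_X maps)

lemma poly_op_in: "x \<in> X \<Longrightarrow> poly_op T p x \<in> X"
  unfolding poly_op_def using subspace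
  by (intro complex_vector.subspace_sum in_X pow_in)

lemma poly_op_pCons:
  assumes "x \<in> X" shows "poly_op T (pCons a p) x = a *\<^sub>C x + T (poly_op T p x)"
proof -
  have "poly_op T (pCons a p) x = (\<Sum>i\<le>Suc (degree p). coeff (pCons a p) i *\<^sub>C (T ^^ i) x)"
    by (rule poly_op_eq) (simp add: degree_pCons_le)
  also have "\<dots> = a *\<^sub>C x + (\<Sum>i\<le>degree p. coeff p i *\<^sub>C T ((T ^^ i) x))"
    by (subst sum.atMost_Suc_shift) (simp add: scaleC_one)
  also have "(\<Sum>i\<le>degree p. coeff p i *\<^sub>C T ((T ^^ i) x)) = T (poly_op T p x)"
    unfolding poly_op_def using assms pow_in by (intro linear_op_sum[OF linear, symmetric]) auto
  finally show ?thesis .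
qed

lemma poly_op_mult: "x \<in> X \<Longrightarrow> poly_op T (p * q) x = poly_op T p (poly_op T q x)"
proof (induction p)
  case (pCons a p)
  then show ?case
    by (simp add: mult_pCons_left poly_op_add poly_op_smult poly_op_pCons poly_op_in)
qed simp

lemma poly_op_linear_factor: "x \<in> X \<Longrightarrow> poly_op T [:- \<mu>, 1:] x = shift T \<mu> x"
  by (simp add: poly_op_pCons shift_def zero scaleC_one)

text \<open>On a generalized eigenvector the resolvent is a finite geometric series in the nilpotent
  part.\<close>

lemma resolvent_on_gen_eigenvector:
  assumes x: "x \<in> X" and nil: "(shift T \<mu> ^^ n) x = 0" and z: "z \<noteq> \<mu>"
  defines "y \<equiv> (\<Sum>k<n. (1 / (z - \<mu>) ^ Suc k) *\<^sub>C (shift T \<mu> ^^ k) x)"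
  shows "y \<in> X" "z *\<^sub>C y - T y = x" "(shift T \<mu> ^^ n) y = 0"
proof -
  interpret N: invariant_subspace X "shift T \<mu>" by (rule shift_invariant)
  let ?N = "shift T \<mu>"
  show y: "y \<in> X"
    unfolding y_def using subspace x by (intro complex_vector.subspace_sum in_X N.pow_in)
  have Ny: "?N y = (\<Sum>k<n. (1 / (z - \<mu>) ^ Suc k) *\<^sub>C ?N ((?N ^^ k) x))"
    unfolding y_def using x by (intro linear_op_sum[OF N.linear] N.pow_in)
  have "z *\<^sub>C y - T y = (z - \<mu>) *\<^sub>C y - ?N y"
    by (simp add: shift_def complex_vector.scale_left_diff_distrib)
  also have "\<dots> = (\<Sum>k<n. (1 / (z - \<mu>) ^ k) *\<^sub>C (?N ^^ k) x)
      - (\<Sum>k<n. (1 / (z - \<mu>) ^ Suc k) *\<^sub>C (?N ^^ Suc k) x)"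
    unfolding Ny using z by (simp add: y_def complex_vector.scale_sum_right scaleC_scaleC)
  also have "\<dots> = (1 / (z - \<mu>) ^ 0) *\<^sub>C (?N ^^ 0) x - (1 / (z - \<mu>) ^ n) *\<^sub>C (?N ^^ n) x"
    unfolding sum_subtractf[symmetric] by (rule sum_lessThan_telescope')
  finally show "z *\<^sub>C y - T y = x" using nil by (simp add: scaleC_one)
  have "(?N ^^ n) y = (\<Sum>k<n. (1 / (z - \<mu>) ^ Suc k) *\<^sub>C (?N ^^ n) ((?N ^^ k) x))"
    unfolding y_def using x by (intro linear_op_sum[OF N.linear_op_pow] N.pow_in)
  also have "\<dots> = 0"
  proof (intro sum.neutral ballI)
    fix k
    have "(?N ^^ n) ((?N ^^ k) x) = (?N ^^ k) ((?N ^^ n) x)"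
      by (metis add.commute comp_apply funpow_add)
    then show "(1 / (z - \<mu>) ^ Suc k) *\<^sub>C (?N ^^ n) ((?N ^^ k) x) = 0"
      using nil N.pow_zero by simp
  qed
  finally show "(?N ^^ n) y = 0" .
qed

lemma gen_eigenvector_imp_eigenvector:
  assumes "x \<in> gen_eigenvectors X T \<mu>" "x \<noteq> 0"
  obtains y where "y \<in> X" "y \<noteq> 0" "T y = \<mu> *\<^sub>C y"
proof -
  interpret N: invariant_subspace X "shift T \<mu>" by (rule shift_invariant)
  obtain n where x: "x \<in> X" "(shift T \<mu> ^^ n) x = 0" using assms(1) by (auto simp: gen_eigenvectors_def)
  then have "\<exists>y\<in>X. y \<noteq> 0 \<and> T y = \<mu> *\<^sub>C y"
  proof (induction n)
    case (Suc n)
    show ?case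
    proof (cases "(shift T \<mu> ^^ n) x = 0")
      case False
      then show ?thesis using Suc.prems
        by (intro bexI[of _ "(shift T \<mu> ^^ n) x"]) (auto simp: N.pow_in shift_def[of T \<mu> "(shift T \<mu> ^^ n) x"])
    qed (use Suc in blast)
  qed (use assms in simp)
  then show thesis using that by blast
qed

lemma subspace_gen_eigenvectors: "csubspace (gen_eigenvectors X T \<mu>)"
proof -
  interpret N: invariant_subspace X "shift T \<mu>" by (rule shift_invariant)
  have "(shift T \<mu> ^^ (n + k)) (x + y) = 0"
    if "x \<in> X" "y \<in> X" "(shift T \<mu> ^^ n) x = 0" "(shift T \<mu> ^^ k) y = 0" for x y n k
  proof -
    have "(shift T \<mu> ^^ (n + k)) x = 0" "(shift T \<mu> ^^ (n + k)) y = 0"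
      using that N.pow_zero by (metis add.commute comp_apply funpow_add)+
    then show ?thesis using that by (simp add: N.pow_add)
  qed
  then show ?thesis
    unfolding csubspace_iff gen_eigenvectors_def
    using N.pow_scale N.pow_zero by (auto simp: in_X) (metis complex_vector.scale_zero_right)
qed

abbreviation "root_span \<equiv> cspan (\<Union>\<mu>. gen_eigenvectors X T \<mu>)"

lemma root_span_subset: "root_span \<subseteq> X"
  by (rule complex_vector.span_minimal[OF _ subspace]) (auto simp: gen_eigenvectors_def)

text \<open>\<open>T - \<mu>\<close> is invertible on the generalized eigenvectors that belong to another eigenvalue, by the
  geometric series; so modulo the range of \<open>T - \<mu>\<close> only those that belong to \<open>\<mu>\<close> remain.\<close>

lemma root_span_shift_decomp:
  assumes "v \<in> root_span"
  shows "\<exists>a\<in>root_span. \<exists>b\<in>gen_eigenvectors X T \<mu>. v = shift T \<mu> a + b"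
  using assms
proof (induction rule: complex_vector.span_induct)
  case base
  interpret N: invariant_subspace X "shift T \<mu>" by (rule shift_invariant)
  let ?P = "\<lambda>v. \<exists>a\<in>root_span. \<exists>b\<in>gen_eigenvectors X T \<mu>. v = shift T \<mu> a + b"
  note G = subspace_gen_eigenvectors[of \<mu>]
  have "?P 0"
    using complex_vector.span_zero complex_vector.subspace_0[OF G] N.zero
    by (intro bexI[of _ 0]) auto
  moreover have "?P (x + y)" if xy: "?P x" "?P y" for x y
  proof -
    obtain a b c d where *: "a \<in> root_span" "b \<in> gen_eigenvectors X T \<mu>" "x = shift T \<mu> a + b"
      "c \<in> root_span" "d \<in> gen_eigenvectors X T \<mu>" "y = shift T \<mu> c + d" using xy by blast
    then have "x + y = shift T \<mu> (a + c) + (b + d)"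
      using N.add[OF subsetD[OF root_span_subset] subsetD[OF root_span_subset], of a c]
      by (simp add: algebra_simps)
    then show ?thesis
      using * complex_vector.span_add complex_vector.subspace_add[OF G] by blast
  qed
  moreover have "?P (c *\<^sub>C x)" if x: "?P x" for c x
  proof -
    obtain a b where *: "a \<in> root_span" "b \<in> gen_eigenvectors X T \<mu>" "x = shift T \<mu> a + b"
      using x by blast
    then have "c *\<^sub>C x = shift T \<mu> (c *\<^sub>C a) + c *\<^sub>C b"
      using root_span_subset N.scale[of a c] by (auto simp: scaleC_add_right)
    then show ?thesis
      using * complex_vector.span_scale complex_vector.subspace_scale[OF G] by blast
  qed
  ultimately show ?case by (auto simp: csubspace_iff)
next
  case (step v)
  then obtain \<nu> n where v: "v \<in> X" "(shift T \<nu> ^^ n) v = 0" by (auto simp: gen_eigenvectors_def)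
  show ?case
  proof (cases "\<nu> = \<mu>")
    case True
    interpret N: invariant_subspace X "shift T \<mu>" by (rule shift_invariant)
    show ?thesis using True v complex_vector.span_zero N.zero
      by (intro bexI[of _ 0] bexI[of _ v]) (auto simp: gen_eigenvectors_def)
  next
    case False
    define y where "y = (\<Sum>k<n. (1 / (\<mu> - \<nu>) ^ Suc k) *\<^sub>C (shift T \<nu> ^^ k) v)"
    note y = resolvent_on_gen_eigenvector[OF v False[symmetric], folded y_def]
    have "y \<in> root_span" using y by (intro complex_vector.span_base) (auto simp: gen_eigenvectors_def)
    then have "(-1) *\<^sub>C y \<in> root_span" by (rule complex_vector.span_scale)
    moreover have "v = shift T \<mu> ((-1) *\<^sub>C y) + 0"
      using y scale[of y "-1"] by (simp add: shift_def scaleC_scaleC)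
    ultimately show ?thesis using complex_vector.subspace_0[OF subspace_gen_eigenvectors] by blast
  qed
qed

text \<open>Induction on the degree, splitting off one linear factor of the annihilating polynomial at a
  time: if \<open>(T - \<mu>) u\<close> is a sum of generalized eigenvectors, the summands that do not belong
  to \<open>\<mu>\<close> can be divided by \<open>T - \<mu>\<close>, and what remains of \<open>u\<close> belongs to \<open>\<mu>\<close>.\<close>

lemma annihilated_imp_root_span:
  assumes "u \<in> X" "p \<noteq> 0" "poly_op T p u = 0"
  shows "u \<in> root_span"
  using assms
proof (induction "degree p" arbitrary: p u rule: less_induct)
  case less
  show ?case
  proof (cases "degree p = 0")
    case True
    then obtain c where "p = [:c:]" "c \<noteq> 0" using less.prems by (metis degree_eq_zeroE pCons_0_0)
    then have "u = 0" using less.prems by (simp add: poly_op_pCons zero)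
    then show ?thesis by (simp add: complex_vector.span_zero)
  next
    case False
    then obtain \<mu> where "poly p \<mu> = 0"
      using alg_closed_imp_poly_has_root[of p] by auto
    then obtain q where q: "p = q * [:- \<mu>, 1:]" by (auto simp: poly_eq_0_iff_dvd mult.commute)
    have "q \<noteq> 0" using q less.prems by auto
    then have "degree p = Suc (degree q)" unfolding q by (subst degree_mult_eq) auto
    moreover have "shift T \<mu> u \<in> X" using less.prems by (simp add: shift_def in_X maps)
    moreover have "poly_op T q (shift T \<mu> u) = 0"
      using less.prems unfolding q by (simp only: poly_op_mult poly_op_linear_factor)
    ultimately have "shift T \<mu> u \<in> root_span" using less.hyps[of q] \<open>q \<noteq> 0\<close> by auto
    then obtain a b where ab: "a \<in> root_span" "b \<in> gen_eigenvectors X T \<mu>" "shift T \<mu> u = shift T \<mu> a + b"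
      using root_span_shift_decomp by blast
    interpret N: invariant_subspace X "shift T \<mu>" by (rule shift_invariant)
    have a: "a \<in> X" using ab root_span_subset by blast
    then have "shift T \<mu> (u - a) = b" using ab less.prems N.diff by simp
    moreover obtain n where "(shift T \<mu> ^^ n) b = 0" using ab by (auto simp: gen_eigenvectors_def)
    ultimately have "(shift T \<mu> ^^ Suc n) (u - a) = 0" by (simp add: funpow_Suc_right del: funpow.simps)
    then have "u - a \<in> gen_eigenvectors X T \<mu>"
      using a less.prems in_X unfolding gen_eigenvectors_def by blast
    then have "u - a \<in> root_span" by (intro complex_vector.span_base) auto
    from complex_vector.span_add[OF this ab(1)] show ?thesis by simp
  qed
qed

text \<open>The \<open>card B + 1\<close> vectors \<open>u, T u, T\<^sup>2 u, \<dots>\<close> in the span of \<open>B\<close> are either dependent or not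
  distinct, and each case gives a polynomial.\<close>

lemma annihilating_polynomial:
  assumes B: "finite B" "\<And>i. (T ^^ i) u \<in> cspan B"
  shows "\<exists>p. p \<noteq> 0 \<and> poly_op T p u = 0"
proof -
  define f where "f i = (T ^^ i) u" for i
  let ?I = "{..card B}"
  show ?thesis
  proof (cases "inj_on f ?I")
    case False
    then obtain i j where ij: "f i = f j" "i \<noteq> j" by (auto simp: inj_on_def)
    define p where "p = monom (1::complex) i - monom 1 j"
    have "coeff p i = 1" using ij by (simp add: p_def)
    then have "p \<noteq> 0" by auto
    moreover have "poly_op T (monom 1 k) u = f k" for k
    proof -
      have "poly_op T (monom 1 k) u = (\<Sum>i\<le>k. if i = k then f k else 0)"
        by (subst poly_op_eq[where n = k], simp add: degree_monom_le, intro sum.cong)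
          (auto simp: f_def scaleC_one)
      then show ?thesis by simp
    qed
    then have "poly_op T p u = 0" using ij by (simp add: p_def poly_op_diff)
    ultimately show ?thesis by blast
  next
    case True
    have "complex_vector.dependent (f ` ?I)"
    proof (rule ccontr)
      assume "\<not> complex_vector.dependent (f ` ?I)"
      from complex_vector.independent_span_bound[OF B(1) this]
      have "card (f ` ?I) \<le> card B" using B(2) by (auto simp: f_def)
      then show False using card_image[OF True] by simp
    qed
    then obtain c where c: "\<exists>v\<in>f ` ?I. c v \<noteq> 0" "(\<Sum>v\<in>f ` ?I. c v *\<^sub>C v) = 0"
      by (subst (asm) complex_vector.dependent_finite) auto
    define p where "p = (\<Sum>i\<in>?I. monom (c (f i)) i)"
    have cf: "coeff p i = (if i \<in> ?I then c (f i) else 0)" for i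
      by (simp add: p_def coeff_sum)
    have "p \<noteq> 0" using c(1) cf by (metis coeff_0 imageE)
    moreover have "degree p \<le> card B" by (rule degree_le) (simp add: cf)
    then have "poly_op T p u = (\<Sum>i\<in>?I. c (f i) *\<^sub>C f i)"
      by (simp add: poly_op_eq cf f_def)
    then have "poly_op T p u = 0" using c(2) by (simp add: sum.reindex[OF True])
    ultimately show ?thesis by blast
  qed
qed

text \<open>An operator \<open>w + finite rank\<close> is algebraic on every vector: \<open>T - w\<close> moves \<open>u\<close> into \<open>Y\<close>, and
  all powers of \<open>T\<close> keep it there. This is what turns contour integrals of the resolvents of the
  discretized operators into finite computations.\<close>

lemma finite_rank_root_span:
  assumes Y: "csubspace Y" "fin_dim Y" and u: "u \<in> X"
    and fr: "\<And>x. x \<in> X \<Longrightarrow> T x - w *\<^sub>C x \<in> Y"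
  shows "u \<in> root_span"
proof -
  obtain B where B: "finite B" "cspan B = Y" using Y by (auto simp: fin_dim_def)
  let ?v = "shift T w u"
  have v: "?v \<in> X \<and> ?v \<in> Y" using u fr by (simp add: shift_def in_X maps)
  have "(T ^^ i) ?v \<in> X \<and> (T ^^ i) ?v \<in> Y" for i
  proof (induction i)
    case (Suc i)
    let ?x = "(T ^^ i) ?v"
    have "(T ?x - w *\<^sub>C ?x) + w *\<^sub>C ?x \<in> Y"
      using Suc fr Y(1) by (intro complex_vector.subspace_add complex_vector.subspace_scale) auto
    then show ?case using Suc maps by simp
  qed (use v in simp)
  then obtain p where "p \<noteq> 0" "poly_op T p ?v = 0"
    using annihilating_polynomial[OF B(1), of ?v] B(2) by auto
  then have "p * [:- w, 1:] \<noteq> 0" "poly_op T (p * [:- w, 1:]) u = 0"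
    by (auto simp only: poly_op_mult[OF u] poly_op_linear_factor[OF u] mult_eq_0_iff pCons_eq_0_iff one_neq_zero)
  then show ?thesis using annihilated_imp_root_span[OF u] by blast
qed

lemma fin_dim_root_span: "fin_dim X \<Longrightarrow> u \<in> X \<Longrightarrow> u \<in> root_span"
  using finite_rank_root_span[of X u 0] subspace maps by simp

text \<open>On a generalized eigenvector that belongs to \<open>\<mu> \<noteq> z\<close>, the geometric series is a preimage under
  \<open>z - T\<close>; for \<open>\<mu> = z\<close> there is none but \<open>0\<close>.\<close>

lemma non_eigenvalue_surjective:
  assumes ne: "\<And>x. x \<in> X \<Longrightarrow> T x = z *\<^sub>C x \<Longrightarrow> x = 0" and u: "u \<in> root_span"
  shows "\<exists>x\<in>X. z *\<^sub>C x - T x = u"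
  using u
proof (induction rule: complex_vector.span_induct)
  case base
  let ?P = "\<lambda>u. \<exists>x\<in>X. z *\<^sub>C x - T x = u"
  have "?P 0" using in_X(1) zero by (intro bexI[of _ 0]) auto
  moreover have "?P (u + v)" if uv: "?P u" "?P v" for u v
  proof -
    obtain x y where "x \<in> X" "z *\<^sub>C x - T x = u" "y \<in> X" "z *\<^sub>C y - T y = v" using uv by blast
    then show ?thesis by (intro bexI[of _ "x + y"]) (auto simp: in_X add scaleC_add_right)
  qed
  moreover have "?P (c *\<^sub>C u)" if u: "?P u" for c u
  proof -
    obtain x where "x \<in> X" "z *\<^sub>C x - T x = u" using u by blast
    then show ?thesis
      by (intro bexI[of _ "c *\<^sub>C x"])
        (auto simp: in_X scale complex_vector.scale_right_diff_distrib scaleC_scaleC mult.commute)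
  qed
  ultimately show ?case by (auto simp: csubspace_iff)
next
  case (step u)
  then obtain \<mu> n where u: "u \<in> gen_eigenvectors X T \<mu>" "u \<in> X" "(shift T \<mu> ^^ n) u = 0"
    by (auto simp: gen_eigenvectors_def)
  show ?case
  proof (cases "\<mu> = z")
    case True
    then have "u = 0" using gen_eigenvector_imp_eigenvector[OF u(1)] ne by metis
    then show ?thesis using in_X(1) zero by (intro bexI[of _ 0]) auto
  next
    case False
    then show ?thesis using resolvent_on_gen_eigenvector(1,2)[OF u(2,3), of z] by blast
  qed
qed

lemma fin_dim_non_eigenvalue_res_set:
  assumes fd: "fin_dim X" and ne: "\<And>x. x \<in> X \<Longrightarrow> T x = z *\<^sub>C x \<Longrightarrow> x = 0"
  shows "z \<in> res_set X X T"
proof -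
  let ?f = "\<lambda>x. z *\<^sub>C x - T x"
  have inj: "inj_on ?f X"
  proof (rule inj_onI)
    fix x y assume xy: "x \<in> X" "y \<in> X" "?f x = ?f y"
    then have "T (x - y) = z *\<^sub>C (x - y)"
      by (simp add: diff complex_vector.scale_right_diff_distrib algebra_simps)
    then show "x = y" using ne[of "x - y"] xy in_X(4) by simp
  qed
  have "?f ` X = X"
  proof
    show "?f ` X \<subseteq> X" using in_X maps by auto
    show "X \<subseteq> ?f ` X"
    proof
      fix u assume "u \<in> X"
      then have "\<exists>x\<in>X. ?f x = u"
        by (intro non_eigenvalue_surjective ne fin_dim_root_span fd)
      then show "u \<in> ?f ` X" by blast
    qed
  qed
  with inj have bij: "bij_betw ?f X X" by (simp add: bij_betw_def)
  define g where "g = inv_into X ?f"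
  have g: "g u \<in> X" "?f (g u) = u" if "u \<in> X" for u
    using that bij inv_into_into[of u ?f X] f_inv_into_f[of u ?f X] by (auto simp: g_def bij_betw_def)
  have gf: "g (?f x) = x" if "x \<in> X" for x
    using inv_into_f_f[OF inj that] by (simp add: g_def)
  have "linear_op X g"
    unfolding linear_op_def
  proof (intro conjI ballI allI subspace)
    fix u v assume uv: "u \<in> X" "v \<in> X"
    have "?f (g u + g v) = ?f (g u) + ?f (g v)"
      using g(1)[OF uv(1)] g(1)[OF uv(2)] by (simp add: add scaleC_add_right)
    then have "?f (g u + g v) = u + v" using g uv by simp
    then show "g (u + v) = g u + g v" using gf[of "g u + g v"] g uv in_X by simp
  next
    fix c u assume u: "u \<in> X"
    have "?f (c *\<^sub>C g u) = c *\<^sub>C ?f (g u)"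
      using g(1)[OF u] by (simp add: scale complex_vector.scale_right_diff_distrib scaleC_scaleC mult.commute)
    then have "?f (c *\<^sub>C g u) = c *\<^sub>C u" using g u by simp
    then show "g (c *\<^sub>C u) = c *\<^sub>C g u" using gf[of "c *\<^sub>C g u"] g u in_X by simp
  qed
  then obtain K where K: "\<forall>u\<in>X. norm (g u) \<le> K * norm u" using linear_op_fin_dim_bounded[OF fd] by blast
  have "norm x \<le> K * norm (?f x)" if "x \<in> X" for x
    using bspec[OF K, of "?f x"] gf[OF that] that in_X(3,4) maps by simp
  then show ?thesis using bij by (auto simp: res_set_def)
qed

end

section \<open>Integrals along rectifiable curves\<close>

lemma rectifiable_tagged_bound:
  assumes "rectifiable_path g"
  obtains L where "L > 0"
    "\<And>p. p tagged_division_of {0..1} \<Longrightarrow> (\<Sum>(t, K)\<in>p. cmod (g (Sup K) - g (Inf K))) \<le> L"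
proof -
  obtain L where L: "\<And>d. d division_of {0..1} \<Longrightarrow> (\<Sum>K\<in>d. cmod (g (Sup K) - g (Inf K))) \<le> L"
    using assms by (auto simp: rectifiable_path_def)
  have "(\<Sum>(t, K)\<in>p. cmod (g (Sup K) - g (Inf K))) \<le> \<bar>L\<bar> + 1" if p: "p tagged_division_of {0..1}" for p
  proof -
    define d where "d K = (if K = {} then 0 else cmod (g (Sup K) - g (Inf K)))" for K
    note div = division_of_tagged_division[OF p]
    have eq: "d K = cmod (g (Sup K) - g (Inf K))" if "K \<in> snd ` p" for K
      using that division_ofD(3)[OF div] by (auto simp: d_def)
    have "(\<Sum>(t, K)\<in>p. cmod (g (Sup K) - g (Inf K))) = (\<Sum>(t, K)\<in>p. d K)"
      using eq by (intro sum.cong) force+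
    also have "\<dots> = sum d (snd ` p)"
    proof (rule sum.over_tagged_division_lemma[OF p])
      fix u v :: real assume "box u v = {}"
      then have "v \<le> u" by (simp add: box_real)
      then show "d (cbox u v) = 0" by (cases "u = v") (auto simp: d_def)
    qed
    also have "\<dots> = (\<Sum>K\<in>snd ` p. cmod (g (Sup K) - g (Inf K)))"
      using eq by (rule sum.cong[OF refl])
    also have "\<dots> \<le> L" by (rule L[OF div])
    finally show ?thesis by simp
  qed
  then show thesis using that[of "\<bar>L\<bar> + 1"] by simp
qed

lemma tagged_division_fine_exists:
  fixes \<delta> :: real
  assumes "\<delta> > 0"
  obtains p where "p tagged_division_of {0..1::real}" "\<forall>(t, K)\<in>p. diameter K < \<delta>"
proof -
  obtain p where p: "p tagged_division_of {0..1::real}" "(\<lambda>x. ball x (\<delta> / 3)) fine p"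
    using fine_division_exists_real[OF gauge_ball, of "\<delta> / 3"] assms by auto
  have "diameter K < \<delta>" if "(t, K) \<in> p" for t K
  proof -
    have "K \<subseteq> ball t (\<delta> / 3)" using p(2) that by (auto simp: fine_def)
    then have "diameter K \<le> diameter (ball t (\<delta> / 3))" by (intro diameter_subset) auto
    then show ?thesis using assms by simp
  qed
  then show thesis using that p by blast
qed

lemma tagged_division_unit_interval:
  assumes "p tagged_division_of {0..1::real}" "(t, K) \<in> p"
  obtains a b where "K = {a..b}" "0 \<le> a" "a \<le> t" "t \<le> b" "b \<le> 1" "Sup K = b" "Inf K = a"
    "diameter K = b - a"
proof -
  obtain a b where K: "K = cbox a b" using tagged_division_ofD(4)[OF assms] by blast
  have "t \<in> K" "K \<subseteq> {0..1}" using tagged_division_ofD(2,3)[OF assms] by auto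
  then show thesis using that[of a b] K by auto
qed

definition curve_sum :: "(complex \<Rightarrow> 'a::complex_inner) \<Rightarrow> (real \<Rightarrow> complex) \<Rightarrow> (real \<times> real set) set \<Rightarrow> 'a" where
  "curve_sum f g p = (\<Sum>(t, K)\<in>p. (g (Sup K) - g (Inf K)) *\<^sub>C f (g t))"

lemma has_curve_integral_alt:
  "has_curve_integral f I g \<longleftrightarrow> (\<forall>\<epsilon>>0. \<exists>\<delta>>0. \<forall>p. p tagged_division_of {0..1} \<and>
     (\<forall>(t, K)\<in>p. diameter K < \<delta>) \<longrightarrow> norm (curve_sum f g p - I) < \<epsilon>)"
  by (simp add: has_curve_integral_def curve_sum_def)

lemma has_curve_integral_norm_le:
  assumes I: "has_curve_integral f I g"
    and b: "\<And>p. p tagged_division_of {0..1} \<Longrightarrow> norm (curve_sum f g p) \<le> b"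
  shows "norm I \<le> b"
proof (rule field_le_epsilon)
  fix \<epsilon> :: real assume "\<epsilon> > 0"
  then obtain \<delta> where \<delta>: "\<delta> > 0" "\<And>p. p tagged_division_of {0..1} \<Longrightarrow>
      (\<forall>(t, K)\<in>p. diameter K < \<delta>) \<Longrightarrow> norm (curve_sum f g p - I) < \<epsilon>"
    using I unfolding has_curve_integral_alt by meson
  obtain p where p: "p tagged_division_of {0..1::real}" "\<forall>(t, K)\<in>p. diameter K < \<delta>"
    using tagged_division_fine_exists \<delta>(1) by blast
  have "norm I \<le> norm (curve_sum f g p) + norm (curve_sum f g p - I)"
    by (metis norm_triangle_sub norm_minus_commute add.commute)
  then show "norm I \<le> b + \<epsilon>" using b[OF p(1)] \<delta>(2)[OF p] by simp
qed

lemma has_curve_integral_add: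
  assumes "has_curve_integral f I g" "has_curve_integral f' I' g"
  shows "has_curve_integral (\<lambda>z. f z + f' z) (I + I') g"
  unfolding has_curve_integral_alt
proof (intro allI impI)
  fix \<epsilon> :: real assume "\<epsilon> > 0"
  then have e: "\<epsilon> / 2 > 0" by simp
  obtain \<delta> where \<delta>: "\<delta> > 0" "\<And>p. p tagged_division_of {0..1} \<Longrightarrow>
      (\<forall>(t, K)\<in>p. diameter K < \<delta>) \<Longrightarrow> norm (curve_sum f g p - I) < \<epsilon> / 2"
    using assms(1) e unfolding has_curve_integral_alt by meson
  obtain \<delta>' where \<delta>': "\<delta>' > 0" "\<And>p. p tagged_division_of {0..1} \<Longrightarrow>
      (\<forall>(t, K)\<in>p. diameter K < \<delta>') \<Longrightarrow> norm (curve_sum f' g p - I') < \<epsilon> / 2"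
    using assms(2) e unfolding has_curve_integral_alt by meson
  have "norm (curve_sum (\<lambda>z. f z + f' z) g p - (I + I')) < \<epsilon>"
    if p: "p tagged_division_of {0..1}" "\<forall>(t, K)\<in>p. diameter K < min \<delta> \<delta>'" for p
  proof -
    have "curve_sum (\<lambda>z. f z + f' z) g p = curve_sum f g p + curve_sum f' g p"
      by (simp add: curve_sum_def scaleC_add_right sum.distrib case_prod_unfold)
    then have eq: "curve_sum (\<lambda>z. f z + f' z) g p - (I + I')
        = (curve_sum f g p - I) + (curve_sum f' g p - I')" by simp
    have "norm (curve_sum f g p - I) < \<epsilon> / 2" "norm (curve_sum f' g p - I') < \<epsilon> / 2"
      using p by (auto intro!: \<delta>(2) \<delta>'(2) simp del: less_divide_eq_numeral1)
    then show ?thesis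
      unfolding eq using norm_triangle_ineq[of "curve_sum f g p - I" "curve_sum f' g p - I'"]
      by linarith
  qed
  then show "\<exists>\<delta>>0. \<forall>p. p tagged_division_of {0..1} \<and> (\<forall>(t, K)\<in>p. diameter K < \<delta>) \<longrightarrow>
      norm (curve_sum (\<lambda>z. f z + f' z) g p - (I + I')) < \<epsilon>"
    using \<delta>(1) \<delta>'(1) by (intro exI[of _ "min \<delta> \<delta>'"]) auto
qed

lemma has_curve_integral_scaleC:
  assumes "has_curve_integral f I g"
  shows "has_curve_integral (\<lambda>z. c *\<^sub>C f z) (c *\<^sub>C I) g"
  unfolding has_curve_integral_alt
proof (intro allI impI)
  fix \<epsilon> :: real assume e: "\<epsilon> > 0"
  have c: "cmod c + 1 > 0" by (simp add: add_nonneg_pos)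
  then have "\<epsilon> / (cmod c + 1) > 0" using e by simp
  then obtain \<delta> where \<delta>: "\<delta> > 0" "\<And>p. p tagged_division_of {0..1} \<Longrightarrow>
      (\<forall>(t, K)\<in>p. diameter K < \<delta>) \<Longrightarrow> norm (curve_sum f g p - I) < \<epsilon> / (cmod c + 1)"
    using assms unfolding has_curve_integral_alt by meson
  have "norm (curve_sum (\<lambda>z. c *\<^sub>C f z) g p - c *\<^sub>C I) < \<epsilon>"
    if p: "p tagged_division_of {0..1}" "\<forall>(t, K)\<in>p. diameter K < \<delta>" for p
  proof -
    have "curve_sum (\<lambda>z. c *\<^sub>C f z) g p = c *\<^sub>C curve_sum f g p"
      by (simp add: curve_sum_def scaleC_scaleC mult.commute complex_vector.scale_sum_right case_prod_unfold)
    then have "norm (curve_sum (\<lambda>z. c *\<^sub>C f z) g p - c *\<^sub>C I) = cmod c * norm (curve_sum f g p - I)"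
      by (simp add: norm_scaleC complex_vector.scale_right_diff_distrib[symmetric])
    also have "\<dots> \<le> (cmod c + 1) * norm (curve_sum f g p - I)" by (simp add: mult_right_mono)
    also have "\<dots> < \<epsilon>" using \<delta>(2)[OF p] c by (simp add: pos_less_divide_eq mult.commute)
    finally show ?thesis .
  qed
  then show "\<exists>\<delta>>0. \<forall>p. p tagged_division_of {0..1} \<and> (\<forall>(t, K)\<in>p. diameter K < \<delta>) \<longrightarrow>
      norm (curve_sum (\<lambda>z. c *\<^sub>C f z) g p - c *\<^sub>C I) < \<epsilon>"
    using \<delta>(1) by blast
qed

lemma has_curve_integral_diff:
  assumes "has_curve_integral f I g" "has_curve_integral f' I' g"
  shows "has_curve_integral (\<lambda>z. f z - f' z) (I - I') g"
  using has_curve_integral_add[OF assms(1) has_curve_integral_scaleC[OF assms(2), of "-1"]] by simp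

lemma has_curve_integral_0: "has_curve_integral (\<lambda>z. 0) 0 g"
  by (auto simp: has_curve_integral_alt curve_sum_def intro: exI[of _ 1])

lemma has_curve_integral_sum:
  assumes "\<And>i. i \<in> S \<Longrightarrow> has_curve_integral (f i) (I i) g"
  shows "has_curve_integral (\<lambda>z. \<Sum>i\<in>S. f i z) (\<Sum>i\<in>S. I i) g"
  using assms
  by (induction S rule: infinite_finite_induct)
    (auto intro: has_curve_integral_0 has_curve_integral_add)

lemma has_curve_integral_cong:
  assumes "\<And>z. z \<in> path_image g \<Longrightarrow> f z = f' z"
  shows "has_curve_integral f I g \<longleftrightarrow> has_curve_integral f' I g"
proof -
  have "curve_sum f g p = curve_sum f' g p" if p: "p tagged_division_of {0..1}" for p
    unfolding curve_sum_def
  proof (intro sum.cong refl, clarify)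
    fix t K assume "(t, K) \<in> p"
    then obtain a b where "0 \<le> a" "a \<le> t" "t \<le> b" "b \<le> (1::real)"
      using tagged_division_unit_interval[OF p] by metis
    then show "(g (Sup K) - g (Inf K)) *\<^sub>C f (g t) = (g (Sup K) - g (Inf K)) *\<^sub>C f' (g t)"
      using assms[of "g t"] by (simp add: path_image_def)
  qed
  then show ?thesis unfolding has_curve_integral_alt by metis
qed

lemma has_curve_integral_unique:
  assumes "has_curve_integral f I g" "has_curve_integral f I' g"
  shows "I = I'"
proof -
  have "norm (I - I') \<le> 0"
    by (rule has_curve_integral_norm_le[OF has_curve_integral_diff[OF assms]])
      (simp add: curve_sum_def)
  then show ?thesis by simp
qed

lemma curve_integral_eq: "has_curve_integral f I g \<Longrightarrow> curve_integral g f = I"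
  unfolding curve_integral_def using has_curve_integral_unique by blast

lemma norm_curve_sum_le:
  assumes L: "(\<Sum>(t, K)\<in>p. cmod (g (Sup K) - g (Inf K))) \<le> L"
    and p: "p tagged_division_of {0..1}" and b: "b \<ge> 0" "\<And>z. z \<in> path_image g \<Longrightarrow> norm (f z) \<le> b"
  shows "norm (curve_sum f g p) \<le> b * L"
proof -
  have "norm (curve_sum f g p) \<le> (\<Sum>(t, K)\<in>p. b * cmod (g (Sup K) - g (Inf K)))"
    unfolding curve_sum_def case_prod_unfold
  proof (rule sum_norm_le)
    fix q assume q: "q \<in> p"
    obtain a c where "0 \<le> a" "a \<le> fst q" "fst q \<le> c" "c \<le> (1::real)"
      using tagged_division_unit_interval[OF p] q by (metis prod.collapse)
    then have "norm (f (g (fst q))) \<le> b" using b(2)[of "g (fst q)"] by (simp add: path_image_def)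
    then show "norm ((g (Sup (snd q)) - g (Inf (snd q))) *\<^sub>C f (g (fst q)))
        \<le> b * cmod (g (Sup (snd q)) - g (Inf (snd q)))"
      by (simp add: norm_scaleC mult.commute[of b] mult_left_mono)
  qed
  also have "\<dots> \<le> b * L"
    using mult_left_mono[OF L b(1)] by (simp add: sum_distrib_left case_prod_unfold)
  finally show ?thesis .
qed

text \<open>A function with local primitives along the curve is integrated by adding up their increments.
  The local form covers the logarithm, which has no primitive near the whole curve.\<close>

lemma has_curve_integral_local_primitives:
  fixes v :: "'a::complex_inner"
  assumes g: "rectifiable_path g" and r: "r > 0" and d: "d > 0"
    and cont: "continuous_on (\<Union>t\<in>{0..1}. ball (g t) r) f"
    and F: "\<And>t. t \<in> {0..1} \<Longrightarrow> \<exists>F. (\<forall>z\<in>ball (g t) r. (F has_field_derivative f z) (at z)) \<and>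
              (\<forall>s\<in>{0..1}. \<bar>s - t\<bar> < d \<longrightarrow> q s - q t = F (g s) - F (g t))"
  shows "has_curve_integral (\<lambda>z. f z *\<^sub>C v) ((q 1 - q 0) *\<^sub>C v) g"
  unfolding has_curve_integral_alt
proof (intro allI impI)
  fix \<epsilon> :: real assume \<epsilon>: "\<epsilon> > 0"
  obtain L where L: "L > 0"
    "\<And>p. p tagged_division_of {0..1} \<Longrightarrow> (\<Sum>(t, K)\<in>p. cmod (g (Sup K) - g (Inf K))) \<le> L"
    using rectifiable_tagged_bound[OF g] by blast
  have pos: "L * norm v + 1 > 0" using L(1) by (simp add: add_nonneg_pos)
  define e where "e = \<epsilon> / (L * norm v + 1)"
  have e: "e > 0" using \<epsilon> pos by (simp add: e_def)
  have path: "path g" using g by (simp add: rectifiable_path_def)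
  have img: "compact (path_image g)" "path_image g \<noteq> {}" by (simp_all add: path compact_path_image)
  define C where "C = {z. infdist z (path_image g) \<le> r / 2}"
  have C: "compact C" unfolding C_def using img r by (intro compact_infdist_le) auto
  have "C \<subseteq> (\<Union>t\<in>{0..1}. ball (g t) r)"
  proof
    fix z assume z: "z \<in> C"
    obtain c where c: "c \<in> path_image g" "infdist z (path_image g) = dist z c"
      using infdist_attains_inf[OF compact_imp_closed[OF img(1)] img(2)] by blast
    then have "dist c z < r" using z r by (simp add: C_def dist_commute)
    then show "z \<in> (\<Union>t\<in>{0..1}. ball (g t) r)" using c(1) by (auto simp: path_image_def)
  qed
  then have "uniformly_continuous_on C f"
    using C cont continuous_on_subset compact_uniformly_continuous by blast
  then obtain \<rho>0 where \<rho>0: "\<rho>0 > 0" "\<And>x y. x \<in> C \<Longrightarrow> y \<in> C \<Longrightarrow> dist y x < \<rho>0 \<Longrightarrow> dist (f y) (f x) < e"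
    unfolding uniformly_continuous_on_def using e by metis
  define \<rho> where "\<rho> = min \<rho>0 (r / 2)"
  have \<rho>: "\<rho> > 0" using \<rho>0(1) r by (simp add: \<rho>_def)
  have "uniformly_continuous_on {0..1} g"
    using path by (intro compact_uniformly_continuous) (auto simp: path_def)
  then obtain \<delta>0 where \<delta>0: "\<delta>0 > 0"
    "\<And>s t. s \<in> {0..1} \<Longrightarrow> t \<in> {0..1} \<Longrightarrow> dist s t < \<delta>0 \<Longrightarrow> dist (g s) (g t) < \<rho>"
    unfolding uniformly_continuous_on_def using \<rho> by metis
  define \<delta> where "\<delta> = min \<delta>0 d"
  have step: "cmod (q b - q a - (g b - g a) * f (g t)) \<le> e * cmod (g b - g a)"
    if "0 \<le> a" "a \<le> t" "t \<le> b" "b \<le> 1" "b - a < \<delta>" for a t b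
  proof -
    have t01: "t \<in> {0..1}" using that by auto
    obtain F where F: "\<And>z. z \<in> ball (g t) r \<Longrightarrow> (F has_field_derivative f z) (at z)"
      "\<And>s. s \<in> {0..1} \<Longrightarrow> \<bar>s - t\<bar> < d \<Longrightarrow> q s - q t = F (g s) - F (g t)"
      using F[OF t01] by blast
    have near: "g s \<in> ball (g t) \<rho>" if "s \<in> {0..1}" "\<bar>s - t\<bar> < \<delta>" for s
      using \<delta>0(2)[OF that(1) t01] that(2) by (auto simp: \<delta>_def dist_real_def dist_commute)
    have "q b - q t = F (g b) - F (g t)" "q a - q t = F (g a) - F (g t)"
      using that by (auto intro!: F(2) simp: \<delta>_def)
    then have qF: "q b - q a = F (g b) - F (g a)" by (metis diff_add_cancel diff_diff_eq2 add_diff_cancel_right)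
    have C_ball: "z \<in> C" if "z \<in> ball (g t) \<rho>" for z
    proof -
      have "g t \<in> path_image g" using t01 by (auto simp: path_image_def)
      then have "infdist z (path_image g) \<le> dist z (g t)" by (rule infdist_le)
      also have "\<dots> \<le> r / 2" using that by (simp add: \<rho>_def dist_commute)
      finally show ?thesis by (simp add: C_def)
    qed
    have "norm ((F (g b) - g b * f (g t)) - (F (g a) - g a * f (g t))) \<le> e * norm (g b - g a)"
    proof (rule field_differentiable_bound[where S = "ball (g t) \<rho>" and f' = "\<lambda>z. f z - f (g t)"])
      show "((\<lambda>z. F z - z * f (g t)) has_field_derivative f z - f (g t)) (at z within ball (g t) \<rho>)"
        if "z \<in> ball (g t) \<rho>" for z
      proof -
        have "z \<in> ball (g t) r" using that \<rho>_def r by auto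
        from DERIV_subset[OF F(1)[OF this]]
        have "(F has_field_derivative f z) (at z within ball (g t) \<rho>)" by blast
        then show ?thesis by (auto intro!: derivative_eq_intros)
      qed
      show "cmod (f z - f (g t)) \<le> e" if "z \<in> ball (g t) \<rho>" for z
        using \<rho>0(2)[OF C_ball C_ball, of "g t" z] that \<rho>
        by (auto simp: dist_norm norm_minus_commute \<rho>_def)
      show "g b \<in> ball (g t) \<rho>" by (rule near) (use that in auto)
      show "g a \<in> ball (g t) \<rho>" by (rule near) (use that in auto)
    qed simp
    then show ?thesis unfolding qF by (simp add: algebra_simps)
  qed
  have "norm (curve_sum (\<lambda>z. f z *\<^sub>C v) g p - (q 1 - q 0) *\<^sub>C v) < \<epsilon>"
    if p: "p tagged_division_of {0..1}" "\<forall>(t, K)\<in>p. diameter K < \<delta>" for p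
  proof -
    have "q 1 - q 0 = (\<Sum>(t, K)\<in>p. q (Sup K) - q (Inf K))"
      using additive_tagged_division_1[of 0 1 p q] p(1) by simp
    then have "curve_sum (\<lambda>z. f z *\<^sub>C v) g p - (q 1 - q 0) *\<^sub>C v
        = (\<Sum>(t, K)\<in>p. ((g (Sup K) - g (Inf K)) * f (g t) - (q (Sup K) - q (Inf K))) *\<^sub>C v)"
      by (simp add: curve_sum_def scaleC_scaleC complex_vector.scale_sum_left sum_subtractf
          complex_vector.scale_left_diff_distrib case_prod_unfold)
    also have "norm \<dots> \<le> (\<Sum>(t, K)\<in>p. e * norm v * cmod (g (Sup K) - g (Inf K)))"
      unfolding case_prod_unfold
    proof (rule sum_norm_le)
      fix x assume x: "x \<in> p"
      obtain a b where K: "0 \<le> a" "a \<le> fst x" "fst x \<le> b" "b \<le> (1::real)" "Sup (snd x) = b"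
        "Inf (snd x) = a" "diameter (snd x) = b - a"
        using tagged_division_unit_interval[OF p(1)] x by (metis prod.collapse)
      have "b - a < \<delta>" using p(2) x K(7) by (auto simp: case_prod_unfold)
      from mult_right_mono[OF step[OF K(1-4) this] norm_ge_zero[of v]]
      show "norm (((g (Sup (snd x)) - g (Inf (snd x))) * f (g (fst x)) - (q (Sup (snd x)) - q (Inf (snd x)))) *\<^sub>C v)
          \<le> e * norm v * cmod (g (Sup (snd x)) - g (Inf (snd x)))"
        unfolding K(5,6) norm_scaleC
        by (subst norm_minus_commute) (simp add: mult_ac)
    qed
    also have "\<dots> = e * norm v * (\<Sum>(t, K)\<in>p. cmod (g (Sup K) - g (Inf K)))"
      by (simp add: sum_distrib_left case_prod_unfold)
    also have "\<dots> \<le> e * norm v * L" using L(2)[OF p(1)] e by (intro mult_left_mono) auto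
    also have "\<dots> < e * (L * norm v + 1)" using e by (simp add: algebra_simps)
    also have "\<dots> = \<epsilon>" using pos by (simp add: e_def)
    finally show ?thesis .
  qed
  then show "\<exists>\<delta>>0. \<forall>p. p tagged_division_of {0..1} \<and> (\<forall>(t, K)\<in>p. diameter K < \<delta>) \<longrightarrow>
      norm (curve_sum (\<lambda>z. f z *\<^sub>C v) g p - (q 1 - q 0) *\<^sub>C v) < \<epsilon>"
    using \<delta>0(1) d by (intro exI[of _ \<delta>]) (auto simp: \<delta>_def)
qed

text \<open>The increments of a continuous logarithm of the curve agree locally with those of the principal
  logarithm of \<open>(z - \<mu>) / (g t - \<mu>)\<close>, and its total increment is the winding number.\<close>

lemma has_curve_integral_inverse:
  fixes v :: "'a::complex_inner"
  assumes g: "rectifiable_path g" and \<mu>: "\<mu> \<notin> path_image g"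
  shows "has_curve_integral (\<lambda>z. (1 / (z - \<mu>)) *\<^sub>C v) ((2 * of_real pi * \<i> * winding_number g \<mu>) *\<^sub>C v) g"
proof -
  have path: "path g" using g by (simp add: rectifiable_path_def)
  obtain q where q: "path q" "pathfinish q - pathstart q = 2 * of_real pi * \<i> * winding_number g \<mu>"
    "\<And>t. t \<in> {0..1} \<Longrightarrow> g t = \<mu> + exp (q t)"
    using winding_number_as_continuous_log[OF path \<mu>] by blast
  define r where "r = infdist \<mu> (path_image g)"
  have r: "r > 0" unfolding r_def
    using \<mu> by (intro infdist_pos_not_in_closed closed_path_image path) auto
  have dist_r: "r \<le> dist (g t) \<mu>" if "t \<in> {0..1}" for t
    unfolding r_def using that by (subst dist_commute) (auto intro!: infdist_le simp: path_image_def)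
  have "uniformly_continuous_on {0..1} q"
    using q(1) by (intro compact_uniformly_continuous) (auto simp: path_def)
  then obtain d where d: "d > 0" "\<And>s t. s \<in> {0..1} \<Longrightarrow> t \<in> {0..1} \<Longrightarrow> dist s t < d \<Longrightarrow> dist (q s) (q t) < 1"
    unfolding uniformly_continuous_on_def by (metis zero_less_one)
  \<comment> \<open>On the ball of radius \<open>r\<close> about \<open>g t\<close> the quotient \<open>(z - \<mu>) / (g t - \<mu>)\<close> has positive real part;
    \<open>d\<close> keeps the imaginary part of the increment of \<open>q\<close> below \<open>\<pi>\<close>.\<close>
  have "has_curve_integral (\<lambda>z. (1 / (z - \<mu>)) *\<^sub>C v) ((q 1 - q 0) *\<^sub>C v) g"
  proof (rule has_curve_integral_local_primitives[OF g r d(1)])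
    show "continuous_on (\<Union>t\<in>{0..1}. ball (g t) r) (\<lambda>z. 1 / (z - \<mu>))"
      using dist_r by (intro continuous_intros) (force simp: dist_norm)
  next
    fix t :: real assume t: "t \<in> {0..1}"
    define F where "F z = Ln ((z - \<mu>) / (g t - \<mu>))" for z
    have nz: "g t - \<mu> \<noteq> 0" using q(3)[OF t] by simp
    have "(F has_field_derivative 1 / (z - \<mu>)) (at z)" if z: "z \<in> ball (g t) r" for z
    proof -
      have "cmod ((z - g t) / (g t - \<mu>)) < 1"
        using z dist_r[OF t] nz by (simp add: norm_divide dist_norm norm_minus_commute divide_less_eq)
      then have "Re ((z - g t) / (g t - \<mu>)) > -1" using abs_Re_le_cmod[of "(z - g t) / (g t - \<mu>)"] by linarith
      moreover have "(z - \<mu>) / (g t - \<mu>) = 1 + (z - g t) / (g t - \<mu>)" using nz by (simp add: field_simps)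
      ultimately have "Re ((z - \<mu>) / (g t - \<mu>)) > 0" by simp
      then have "(z - \<mu>) / (g t - \<mu>) \<notin> \<real>\<^sub>\<le>\<^sub>0" by (auto simp: complex_nonpos_Reals_iff)
      moreover have "z - \<mu> \<noteq> 0" using z dist_r[OF t] by auto
      ultimately show ?thesis
        unfolding F_def using nz by (auto intro!: derivative_eq_intros simp: divide_simps)
    qed
    moreover have "q s - q t = F (g s) - F (g t)" if s: "s \<in> {0..1}" "\<bar>s - t\<bar> < d" for s
    proof -
      have "cmod (q s - q t) < 1" using d(2)[OF s(1) t] s(2) by (simp add: dist_norm)
      then have "\<bar>Im (q s - q t)\<bar> < pi" using abs_Im_le_cmod[of "q s - q t"] pi_gt3 by linarith
      then have "Ln (exp (q s - q t)) = q s - q t" by (intro Ln_exp) auto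
      moreover have "(g s - \<mu>) / (g t - \<mu>) = exp (q s - q t)" using q(3) s(1) t by (simp add: exp_diff)
      ultimately show ?thesis using nz by (simp add: F_def)
    qed
    ultimately show "\<exists>F. (\<forall>z\<in>ball (g t) r. (F has_field_derivative 1 / (z - \<mu>)) (at z)) \<and>
        (\<forall>s\<in>{0..1}. \<bar>s - t\<bar> < d \<longrightarrow> q s - q t = F (g s) - F (g t))" by blast
  qed
  then show ?thesis using q(2) by (simp add: pathfinish_def pathstart_def)
qed

lemma has_curve_integral_inverse_power:
  fixes v :: "'a::complex_inner"
  assumes g: "rectifiable_path g" and closed: "pathfinish g = pathstart g" and \<mu>: "\<mu> \<notin> path_image g"
  shows "has_curve_integral (\<lambda>z. (1 / (z - \<mu>) ^ Suc (Suc k)) *\<^sub>C v) 0 g"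
proof -
  have path: "path g" using g by (simp add: rectifiable_path_def)
  define r where "r = infdist \<mu> (path_image g)"
  have r: "r > 0" unfolding r_def
    using \<mu> by (intro infdist_pos_not_in_closed closed_path_image path) auto
  have nz: "z \<noteq> \<mu>" if "t \<in> {0..1}" "z \<in> ball (g t) r" for t z
  proof -
    have "r \<le> dist \<mu> (g t)"
      unfolding r_def using that by (auto intro!: infdist_le simp: path_image_def)
    then show ?thesis using that by (auto simp: dist_commute)
  qed
  define F where "F z = (- 1 / of_nat (Suc k)) * inverse (z - \<mu>) ^ Suc k" for z
  have "has_curve_integral (\<lambda>z. (1 / (z - \<mu>) ^ Suc (Suc k)) *\<^sub>C v) ((F (g 1) - F (g 0)) *\<^sub>C v) g"
  proof (rule has_curve_integral_local_primitives[where q = "\<lambda>t. F (g t)", OF g r zero_less_one])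
    show "continuous_on (\<Union>t\<in>{0..1}. ball (g t) r) (\<lambda>z. 1 / (z - \<mu>) ^ Suc (Suc k))"
      using nz by (auto intro!: continuous_intros)
  next
    fix t :: real assume t: "t \<in> {0..1}"
    have "(F has_field_derivative 1 / (z - \<mu>) ^ Suc (Suc k)) (at z)" if z: "z \<in> ball (g t) r" for z
    proof -
      have "z - \<mu> \<noteq> 0" using nz[OF t z] by simp
      then have "((\<lambda>z. inverse (z - \<mu>)) has_field_derivative - (inverse (z - \<mu>) ^ Suc (Suc 0))) (at z)"
        by (auto intro!: derivative_eq_intros)
      from DERIV_power[OF this, of "Suc k"]
      have "((\<lambda>z. inverse (z - \<mu>) ^ Suc k) has_field_derivative
          of_nat (Suc k) * (- (inverse (z - \<mu>) ^ Suc (Suc 0)) * inverse (z - \<mu>) ^ k)) (at z)" by simp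
      from DERIV_cmult[OF this, of "- 1 / of_nat (Suc k)"]
      have "(F has_field_derivative
          (- 1 / of_nat (Suc k)) * (of_nat (Suc k) * (- (inverse (z - \<mu>) ^ Suc (Suc 0)) * inverse (z - \<mu>) ^ k))) (at z)"
        unfolding F_def .
      moreover have "(- 1 / of_nat (Suc k)) * (of_nat (Suc k) * (- (inverse (z - \<mu>) ^ Suc (Suc 0)) * inverse (z - \<mu>) ^ k))
          = 1 / (z - \<mu>) ^ Suc (Suc k)"
        by (simp add: divide_simps del: of_nat_Suc)
      ultimately show ?thesis by simp
    qed
    then show "\<exists>F'. (\<forall>z\<in>ball (g t) r. (F' has_field_derivative 1 / (z - \<mu>) ^ Suc (Suc k)) (at z)) \<and>
        (\<forall>s\<in>{0..1}. \<bar>s - t\<bar> < 1 \<longrightarrow> F (g s) - F (g t) = F' (g s) - F' (g t))" by blast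
  qed
  then show ?thesis using closed by (simp add: pathfinish_def pathstart_def)
qed


section \<open>Riesz projections of algebraic operators\<close>

lemma resolvent_eqI:
  assumes "bij (\<lambda>x. z *\<^sub>C x - T x)" "z *\<^sub>C y - T y = u"
  shows "resolvent UNIV T z u = y"
  unfolding resolvent_def using inv_f_f[OF bij_is_inj[OF assms(1)], of y] assms(2) by simp

lemma resolvent_solves:
  assumes "bij (\<lambda>x. z *\<^sub>C x - T x)"
  shows "z *\<^sub>C resolvent UNIV T z u - T (resolvent UNIV T z u) = u"
  unfolding resolvent_def using surj_f_inv_f[OF bij_is_surj[OF assms]] by simp

text \<open>Since every vector is a sum of generalized eigenvectors, on which the resolvent is a finite sum of
  vectors with coefficients \<open>(z - \<mu>)\<^sup>-\<^sup>k\<close>, the resolvent is integrable along the curve and its integral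
  is known explicitly.\<close>

locale riesz_setting = invariant_subspace UNIV T
  for T :: "'a::complex_inner \<Rightarrow> 'a" +
  fixes g :: "real \<Rightarrow> complex"
  assumes rect: "rectifiable_path g" and closed: "pathfinish g = pathstart g"
    and bij: "z \<in> path_image g \<Longrightarrow> bij (\<lambda>x. z *\<^sub>C x - T x)"
    and algebraic: "u \<in> root_span"
begin

lemma resolvent_add:
  "z \<in> path_image g \<Longrightarrow> resolvent UNIV T z (u + v) = resolvent UNIV T z u + resolvent UNIV T z v"
  using resolvent_solves[OF bij, of z u] resolvent_solves[OF bij, of z v]
  by (intro resolvent_eqI bij) (auto simp: add scaleC_add_right algebra_simps)

lemma resolvent_scaleC:
  "z \<in> path_image g \<Longrightarrow> resolvent UNIV T z (c *\<^sub>C u) = c *\<^sub>C resolvent UNIV T z u"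
proof (rule resolvent_eqI[OF bij])
  let ?r = "resolvent UNIV T z u"
  assume z: "z \<in> path_image g"
  have "z *\<^sub>C c *\<^sub>C ?r - T (c *\<^sub>C ?r) = c *\<^sub>C (z *\<^sub>C ?r - T ?r)"
    by (simp only: scale[OF UNIV_I] scaleC_scaleC complex_vector.scale_right_diff_distrib mult.commute)
  then show "z *\<^sub>C c *\<^sub>C ?r - T (c *\<^sub>C ?r) = c *\<^sub>C u" using resolvent_solves[OF bij[OF z], of u] by simp
qed

lemma has_integral_gen_eigenvector:
  assumes v: "v \<in> gen_eigenvectors UNIV T \<mu>" and \<mu>: "\<mu> \<notin> path_image g"
  shows "has_curve_integral (\<lambda>z. resolvent UNIV T z v) ((2 * of_real pi * \<i> * winding_number g \<mu>) *\<^sub>C v) g"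
proof -
  obtain n where n: "(shift T \<mu> ^^ n) v = 0" using v by (auto simp: gen_eigenvectors_def)
  have res: "resolvent UNIV T z v = (\<Sum>k<n. (1 / (z - \<mu>) ^ Suc k) *\<^sub>C (shift T \<mu> ^^ k) v)"
    if z: "z \<in> path_image g" for z
    using resolvent_on_gen_eigenvector(2)[OF UNIV_I n, of z] \<mu> z by (intro resolvent_eqI bij) auto
  have "has_curve_integral (\<lambda>z. (1 / (z - \<mu>) ^ Suc k) *\<^sub>C (shift T \<mu> ^^ k) v)
     (if k = 0 then (2 * of_real pi * \<i> * winding_number g \<mu>) *\<^sub>C v else 0) g" for k
  proof (cases k)
    case 0
    then show ?thesis using has_curve_integral_inverse[OF rect \<mu>, of v] by simp
  next
    case (Suc j)
    then show ?thesis
      using has_curve_integral_inverse_power[OF rect closed \<mu>, of j "(shift T \<mu> ^^ k) v"] by simp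
  qed
  then have *: "has_curve_integral (\<lambda>z. \<Sum>k<n. (1 / (z - \<mu>) ^ Suc k) *\<^sub>C (shift T \<mu> ^^ k) v)
     (\<Sum>k<n. if k = 0 then (2 * of_real pi * \<i> * winding_number g \<mu>) *\<^sub>C v else 0) g"
    by (intro has_curve_integral_sum)
  have eq: "(\<Sum>k<n. if k = 0 then (2 * of_real pi * \<i> * winding_number g \<mu>) *\<^sub>C v else 0)
     = (2 * of_real pi * \<i> * winding_number g \<mu>) *\<^sub>C v"
    using n by (cases n) (auto simp: sum.lessThan_Suc_shift)
  show ?thesis using *[unfolded eq] by (simp add: res cong: has_curve_integral_cong)
qed

lemma eigenvalue_not_on_curve:
  assumes "v \<in> gen_eigenvectors UNIV T \<mu>" "v \<noteq> 0"
  shows "\<mu> \<notin> path_image g"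
proof
  assume "\<mu> \<in> path_image g"
  from bij_is_inj[OF bij[OF this]] have inj: "inj (\<lambda>x. \<mu> *\<^sub>C x - T x)" .
  obtain y where "y \<noteq> 0" "T y = \<mu> *\<^sub>C y" using gen_eigenvector_imp_eigenvector[OF assms] by blast
  then show False using injD[OF inj, of y 0] by (simp add: zero)
qed

lemma integrable: "\<exists>I. has_curve_integral (\<lambda>z. resolvent UNIV T z u) I g"
  using algebraic[of u]
proof (induction rule: complex_vector.span_induct)
  case base
  have "has_curve_integral (\<lambda>z. resolvent UNIV T z 0) 0 g"
    using has_curve_integral_cong[of g "\<lambda>z. resolvent UNIV T z 0" "\<lambda>z. 0"]
      resolvent_scaleC[of _ 0 0] has_curve_integral_0 by auto
  moreover have "\<exists>I. has_curve_integral (\<lambda>z. resolvent UNIV T z (u + v)) I g"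
    if "has_curve_integral (\<lambda>z. resolvent UNIV T z u) I g" "has_curve_integral (\<lambda>z. resolvent UNIV T z v) J g"
    for u v I J
    using has_curve_integral_add[OF that]
      has_curve_integral_cong[of g "\<lambda>z. resolvent UNIV T z (u + v)"
        "\<lambda>z. resolvent UNIV T z u + resolvent UNIV T z v"] resolvent_add by metis
  moreover have "\<exists>I. has_curve_integral (\<lambda>z. resolvent UNIV T z (c *\<^sub>C u)) I g"
    if "has_curve_integral (\<lambda>z. resolvent UNIV T z u) I g" for c u I
    using has_curve_integral_scaleC[OF that, of c]
      has_curve_integral_cong[of g "\<lambda>z. resolvent UNIV T z (c *\<^sub>C u)"
        "\<lambda>z. c *\<^sub>C resolvent UNIV T z u"] resolvent_scaleC by metis
  ultimately show ?case by (auto simp: csubspace_iff)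
next
  case (step v)
  then obtain \<mu> where v: "v \<in> gen_eigenvectors UNIV T \<mu>" by blast
  show ?case
  proof (cases "v = 0")
    case True
    then show ?thesis
      using has_curve_integral_cong[of g "\<lambda>z. resolvent UNIV T z 0" "\<lambda>z. 0"]
        resolvent_scaleC[of _ 0 0] has_curve_integral_0 by auto
  next
    case False
    then show ?thesis using has_integral_gen_eigenvector[OF v] eigenvalue_not_on_curve[OF v] by blast
  qed
qed

lemma has_integral:
  "has_curve_integral (\<lambda>z. resolvent UNIV T z u) ((2 * of_real pi * \<i>) *\<^sub>C riesz_projection g T u) g"
proof -
  obtain I where I: "has_curve_integral (\<lambda>z. resolvent UNIV T z u) I g" using integrable by blast
  then show ?thesis
    by (simp add: riesz_projection_def curve_integral_eq[OF I] scaleC_scaleC scaleC_one)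
qed

lemma riesz_eqI:
  assumes "has_curve_integral (\<lambda>z. resolvent UNIV T z u) ((2 * of_real pi * \<i>) *\<^sub>C v) g"
  shows "riesz_projection g T u = v"
  by (simp add: riesz_projection_def curve_integral_eq[OF assms] scaleC_scaleC scaleC_one)

lemma riesz_add: "riesz_projection g T (u + v) = riesz_projection g T u + riesz_projection g T v"
proof (rule riesz_eqI)
  show "has_curve_integral (\<lambda>z. resolvent UNIV T z (u + v))
     ((2 * of_real pi * \<i>) *\<^sub>C (riesz_projection g T u + riesz_projection g T v)) g"
    using has_curve_integral_add[OF has_integral[of u] has_integral[of v]]
    unfolding scaleC_add_right[symmetric] by (simp add: resolvent_add cong: has_curve_integral_cong)
qed

lemma riesz_scaleC: "riesz_projection g T (c *\<^sub>C u) = c *\<^sub>C riesz_projection g T u"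
proof (rule riesz_eqI)
  show "has_curve_integral (\<lambda>z. resolvent UNIV T z (c *\<^sub>C u))
     ((2 * of_real pi * \<i>) *\<^sub>C c *\<^sub>C riesz_projection g T u) g"
    using has_curve_integral_scaleC[OF has_integral[of u], of c]
    unfolding complex_vector.scale_left_commute[of c]
    by (simp add: resolvent_scaleC cong: has_curve_integral_cong)
qed

lemma riesz_gen_eigenvector:
  assumes v: "v \<in> gen_eigenvectors UNIV T \<mu>" "v \<noteq> 0"
  shows "riesz_projection g T v = winding_number g \<mu> *\<^sub>C v"
  using has_integral_gen_eigenvector[OF v(1) eigenvalue_not_on_curve[OF v]]
  by (intro riesz_eqI) (simp add: scaleC_scaleC)

text \<open>On each generalized eigenspace the operator acts as a winding number, hence as \<open>0\<close> or as the
  orientation \<open>\<sigma>\<close> of the curve.\<close>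

lemma riesz_idempotent:
  assumes wn: "\<And>\<mu>. \<mu> \<notin> path_image g \<Longrightarrow> winding_number g \<mu> = 0 \<or> winding_number g \<mu> = \<sigma>"
  shows "riesz_projection g T (riesz_projection g T u) = \<sigma> *\<^sub>C riesz_projection g T u"
  using algebraic[of u]
proof (induction rule: complex_vector.span_induct)
  case base
  have "riesz_projection g T 0 = 0" using riesz_scaleC[of 0 0] by simp
  then show ?case
    by (auto simp: csubspace_iff riesz_add riesz_scaleC scaleC_add_right scaleC_scaleC mult.commute)
next
  case (step v)
  then obtain \<mu> where v: "v \<in> gen_eigenvectors UNIV T \<mu>" by blast
  have z: "riesz_projection g T 0 = 0" using riesz_scaleC[of 0 0] by simp
  show ?case
  proof (cases "v = 0")
    case False
    then show ?thesis
      using riesz_gen_eigenvector[OF v] wn[OF eigenvalue_not_on_curve[OF v]] riesz_scaleC z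
      by auto
  qed (simp add: z)
qed

end

section \<open>Perturbation of the Riesz projection\<close>

lemma clinear_props:
  assumes "clinear f"
  shows "f (x + y) = f x + f y" "f (c *\<^sub>C x) = c *\<^sub>C f x" "f 0 = 0" "f (x - y) = f x - f y"
    "f (- x) = - f x"
proof -
  show *: "f (x + y) = f x + f y" "f (c *\<^sub>C x) = c *\<^sub>C f x" for x y c using assms by (auto simp: clinear_iff)
  show "f 0 = 0" using *(2)[of 0 0] by simp
  show m: "f (- x) = - f x" for x using *(2)[of "-1" x] by simp
  show "f (x - y) = f x - f y" using *(1)[of x "- y"] m[of y] by simp
qed

lemma clinear_invariant_UNIV: "clinear T \<Longrightarrow> invariant_subspace UNIV T"
  by unfold_locales (auto simp: linear_op_def clinear_iff csubspace_iff)

lemma res_set_bounded_below: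
  assumes "\<zeta> \<in> res_set UNIV UNIV S"
  shows "\<exists>c>0. \<forall>u. c * norm u \<le> norm (\<zeta> *\<^sub>C u - S u)"
proof -
  obtain K where K: "\<And>u. norm u \<le> K * norm (\<zeta> *\<^sub>C u - S u)" using assms by (auto simp: res_set_def)
  have "norm u \<le> (\<bar>K\<bar> + 1) * norm (\<zeta> *\<^sub>C u - S u)" for u
    using K[of u] by (rule order_trans) (intro mult_right_mono, auto)
  then have "1 / (\<bar>K\<bar> + 1) * norm u \<le> norm (\<zeta> *\<^sub>C u - S u)" for u
    by (simp add: pos_divide_le_eq mult.commute)
  then show ?thesis by (intro exI[of _ "1 / (\<bar>K\<bar> + 1)"]) auto
qed

text \<open>The best constant \<open>c\<close> depends on \<open>\<zeta>\<close> with Lipschitz constant \<open>1\<close>, so half of it works on a ball of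
  that radius.\<close>

lemma uniform_lower_bound:
  fixes S :: "'a::complex_inner \<Rightarrow> 'a"
  assumes K: "compact K" and low: "\<And>\<zeta>. \<zeta> \<in> K \<Longrightarrow> \<exists>c>0. \<forall>u\<in>F. c * norm u \<le> norm (\<zeta> *\<^sub>C u - S u)"
  shows "\<exists>c>0. \<forall>\<zeta>\<in>K. \<forall>u\<in>F. c * norm u \<le> norm (\<zeta> *\<^sub>C u - S u)"
proof -
  obtain c where c: "\<And>\<zeta>. \<zeta> \<in> K \<Longrightarrow> c \<zeta> > 0"
    "\<And>\<zeta> u. \<zeta> \<in> K \<Longrightarrow> u \<in> F \<Longrightarrow> c \<zeta> * norm u \<le> norm (\<zeta> *\<^sub>C u - S u)"
    using low by metis
  have "K \<subseteq> (\<Union>\<zeta>\<in>K. ball \<zeta> (c \<zeta> / 2))" using c(1) by force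
  then obtain C where C: "C \<subseteq> K" "finite C" "K \<subseteq> (\<Union>\<zeta>\<in>C. ball \<zeta> (c \<zeta> / 2))"
    using compactE_image[OF K, of K "\<lambda>\<zeta>. ball \<zeta> (c \<zeta> / 2)"] by blast
  define d where "d = Min (insert 1 ((\<lambda>\<zeta>. c \<zeta> / 2) ` C))"
  have "d > 0" unfolding d_def using C c(1) by (subst Min_gr_iff) auto
  moreover have "d * norm u \<le> norm (\<zeta> *\<^sub>C u - S u)" if z: "\<zeta> \<in> K" and u: "u \<in> F" for \<zeta> u
  proof -
    obtain \<eta> where \<eta>: "\<eta> \<in> C" "\<zeta> \<in> ball \<eta> (c \<eta> / 2)" using C z by blast
    have "d \<le> c \<eta> / 2" unfolding d_def using \<eta> C by (intro Min_le) auto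
    then have "d * norm u \<le> c \<eta> / 2 * norm u" by (rule mult_right_mono) simp
    moreover have "cmod (\<eta> - \<zeta>) * norm u \<le> c \<eta> / 2 * norm u"
      using \<eta>(2) by (intro mult_right_mono) (auto simp: dist_norm)
    moreover have "c \<eta> * norm u \<le> norm (\<eta> *\<^sub>C u - S u)" using c(2) \<eta> C u by blast
    moreover have "\<eta> *\<^sub>C u - S u = (\<zeta> *\<^sub>C u - S u) + (\<eta> - \<zeta>) *\<^sub>C u"
      by (simp add: complex_vector.scale_left_diff_distrib)
    then have "norm (\<eta> *\<^sub>C u - S u) \<le> norm (\<zeta> *\<^sub>C u - S u) + cmod (\<eta> - \<zeta>) * norm u"
      by (metis norm_triangle_ineq norm_scaleC)
    ultimately show ?thesis by (simp add: field_simps)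
  qed
  ultimately show ?thesis by blast
qed

text \<open>The perturbed equation \<open>(\<zeta> - T) x = y\<close> reads \<open>x = (\<zeta> - S)\<^sup>-\<^sup>1 (y + (T - S) x)\<close>, a contraction with
  factor \<open>1/2\<close>.\<close>

lemma perturbed_bijective:
  fixes S T :: "'v::chilbert_space \<Rightarrow> 'v"
  assumes S: "clinear S" and T: "clinear T" and bij: "bij (\<lambda>x. \<zeta> *\<^sub>C x - S x)" and c: "c > 0"
    and low: "\<And>u. c * norm u \<le> norm (\<zeta> *\<^sub>C u - S u)"
    and close: "\<And>u. norm (T u - S u) \<le> c / 2 * norm u"
  shows "bij (\<lambda>x. \<zeta> *\<^sub>C x - T x)" "\<And>u. c / 2 * norm u \<le> norm (\<zeta> *\<^sub>C u - T u)"
proof -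
  show low': "c / 2 * norm u \<le> norm (\<zeta> *\<^sub>C u - T u)" for u
  proof -
    have "\<zeta> *\<^sub>C u - S u = (\<zeta> *\<^sub>C u - T u) + (T u - S u)" by simp
    then have "norm (\<zeta> *\<^sub>C u - S u) \<le> norm (\<zeta> *\<^sub>C u - T u) + norm (T u - S u)"
      by (metis norm_triangle_ineq)
    then show ?thesis using low[of u] close[of u] by linarith
  qed
  have "inj (\<lambda>x. \<zeta> *\<^sub>C x - T x)"
  proof (rule injI)
    fix x y assume "\<zeta> *\<^sub>C x - T x = \<zeta> *\<^sub>C y - T y"
    then have "\<zeta> *\<^sub>C (x - y) - T (x - y) = 0"
      by (simp add: clinear_props[OF T] complex_vector.scale_right_diff_distrib algebra_simps)
    then have "c / 2 * norm (x - y) \<le> 0" using low'[of "x - y"] by simp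
    then show "x = y" using c by (simp add: mult_le_0_iff)
  qed
  moreover have "\<exists>x. \<zeta> *\<^sub>C x - T x = y" for y
  proof -
    define R where "R = inv (\<lambda>x. \<zeta> *\<^sub>C x - S x)"
    have R: "\<zeta> *\<^sub>C R u - S (R u) = u" for u
      using surj_f_inv_f[OF bij_is_surj[OF bij], of u] by (simp add: R_def)
    have Rdiff: "norm (R u - R v) \<le> norm (u - v) / c" for u v
    proof -
      have "\<zeta> *\<^sub>C (R u - R v) - S (R u - R v) = (\<zeta> *\<^sub>C R u - S (R u)) - (\<zeta> *\<^sub>C R v - S (R v))"
        by (simp add: clinear_props[OF S] complex_vector.scale_right_diff_distrib)
      then have "\<zeta> *\<^sub>C (R u - R v) - S (R u - R v) = u - v" by (simp add: R)
      then have "c * norm (R u - R v) \<le> norm (u - v)" using low[of "R u - R v"] by simp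
      then show ?thesis using c by (simp add: pos_le_divide_eq mult.commute)
    qed
    define f where "f x = R (y + (T x - S x))" for x
    have "dist (f x) (f x') \<le> 1 / 2 * dist x x'" for x x'
    proof -
      have "norm (f x - f x') \<le> norm ((y + (T x - S x)) - (y + (T x' - S x'))) / c"
        unfolding f_def by (rule Rdiff)
      also have "(y + (T x - S x)) - (y + (T x' - S x')) = T (x - x') - S (x - x')"
        by (simp add: clinear_props[OF S] clinear_props[OF T])
      also have "norm \<dots> / c \<le> (c / 2 * norm (x - x')) / c"
        using close c by (intro divide_right_mono) auto
      finally show ?thesis using c by (simp add: dist_norm)
    qed
    then obtain x where "f x = x" using banach_fix_type[of "1/2" f] by auto
    then have "\<zeta> *\<^sub>C x - S x = y + (T x - S x)" using R[of "y + (T x - S x)"] by (simp add: f_def)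
    then have "\<zeta> *\<^sub>C x - T x = y" by (simp add: algebra_simps)
    then show ?thesis by blast
  qed
  then have "surj (\<lambda>x. \<zeta> *\<^sub>C x - T x)" by (auto simp: surj_def intro: sym)
  ultimately show "bij (\<lambda>x. \<zeta> *\<^sub>C x - T x)" by (simp add: bij_def)
qed

lemma compact_region:
  fixes g :: "real \<Rightarrow> complex"
  shows "path g \<Longrightarrow> compact (path_image g \<union> inside (path_image g))"
  unfolding compact_eq_bounded_closed
  by (simp add: bounded_inside bounded_path_image closed_path_image_Un_inside)

definition finite_rank_perturbation ::
  "('v::complex_inner \<Rightarrow> 'v) \<Rightarrow> real \<Rightarrow> ('v \<Rightarrow> 'v) \<Rightarrow> bool" where
  "finite_rank_perturbation S d S' \<longleftrightarrow> clinear S' \<and>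
     (\<exists>Y w. csubspace Y \<and> fin_dim Y \<and> (\<forall>u. S' u - w *\<^sub>C u \<in> Y)) \<and>
     (\<forall>u. norm (S' u - S u) \<le> d * norm u)"

text \<open>\<open>\<sigma>\<close> is the orientation of the curve: for a clockwise curve the integral is the negative of a
  projection.\<close>

definition riesz_near ::
  "(real \<Rightarrow> complex) \<Rightarrow> ('v::complex_inner \<Rightarrow> 'v) \<Rightarrow> complex \<Rightarrow> ('v \<Rightarrow> 'v) \<Rightarrow> real \<Rightarrow> bool" where
  "riesz_near g S \<sigma> Q \<epsilon> \<longleftrightarrow> clinear (riesz_projection g S) \<and>
     (\<forall>u. riesz_projection g S (riesz_projection g S u) = \<sigma> *\<^sub>C riesz_projection g S u) \<and>
     (\<forall>u. norm (riesz_projection g S u - \<sigma> *\<^sub>C Q u) \<le> \<epsilon> * norm u)"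

text \<open>\<open>S'\<close> is compared with its block diagonal part \<open>T = S Q + (1 - Q) S' (1 - Q)\<close>, where \<open>Q\<close> is the
  orthogonal projection onto the span \<open>W\<close> of eigenvectors. Both are of the form \<open>w + finite rank\<close>, so
  their contour integrals are sums of winding numbers times generalized eigenvectors. For \<open>T\<close> the
  result is exactly \<open>\<sigma> Q\<close>: the eigenvectors in \<open>W\<close> belong to points inside the curve, and the lower
  bound for \<open>\<zeta> - S\<close> on the complement forces the other eigenvalues of \<open>T\<close> to lie outside. The
  resolvents of \<open>S'\<close> and \<open>T\<close> differ by \<open>O(d)\<close> on the curve, hence so do the integrals.\<close>

lemma riesz_projection_stable:
  fixes S :: "'v::chilbert_space \<Rightarrow> 'v"
  assumes simple: "simple_path g" and closed: "pathfinish g = pathstart g" and rect: "rectifiable_path g"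
    and S: "clinear S" and G: "orthonormal G"
    and EW: "cspan G = cspan W"
    and eig: "\<And>e. e \<in> W \<Longrightarrow> \<exists>\<mu>\<in>inside (path_image g). S e = \<mu> *\<^sub>C e"
    and compl: "\<And>u. oproj G u = 0 \<Longrightarrow> oproj G (S u) = 0"
    and res: "path_image g \<subseteq> res_set UNIV UNIV S"
    and low: "\<And>\<zeta>. \<zeta> \<in> path_image g \<union> inside (path_image g) \<Longrightarrow>
       \<exists>c>0. \<forall>u\<in>{u. oproj G u = 0}. c * norm u \<le> norm (\<zeta> *\<^sub>C u - S u)"
  shows "\<exists>\<sigma>. (\<sigma> = 1 \<or> \<sigma> = -1) \<and> (\<forall>\<epsilon>>0. \<exists>d>0. \<forall>S'. finite_rank_perturbation S d S' \<longrightarrow>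
     riesz_near g S' \<sigma> (oproj G) \<epsilon>)"
proof -
  have path: "path g" using simple by (rule simple_path_imp_path)
  obtain \<sigma> where \<sigma>: "\<sigma> = 1 \<or> \<sigma> = -1" "\<And>\<mu>. \<mu> \<in> inside (path_image g) \<Longrightarrow> winding_number g \<mu> = \<sigma>"
    using simple_closed_path_winding_number_inside[OF simple] by metis
  have wn_out: "winding_number g \<mu> = 0" if "\<mu> \<notin> path_image g \<union> inside (path_image g)" for \<mu>
  proof -
    have "\<mu> \<in> outside (path_image g)" using that by (simp add: outside_inside)
    then show ?thesis by (rule winding_number_zero_in_outside[OF path closed])
  qed
  obtain L where L: "L > 0"
    "\<And>p. p tagged_division_of {0..1} \<Longrightarrow> (\<Sum>(t, K)\<in>p. cmod (g (Sup K) - g (Inf K))) \<le> L"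
    using rectifiable_tagged_bound[OF rect] by blast
  have "\<exists>c>0. \<forall>u\<in>UNIV. c * norm u \<le> norm (\<zeta> *\<^sub>C u - S u)" if "\<zeta> \<in> path_image g" for \<zeta>
    using res_set_bounded_below subsetD[OF res that] by blast
  then obtain c1 where c1: "c1 > 0" "\<And>\<zeta> u. \<zeta> \<in> path_image g \<Longrightarrow> c1 * norm u \<le> norm (\<zeta> *\<^sub>C u - S u)"
    using uniform_lower_bound[OF compact_path_image[OF path], of UNIV S] by auto
  obtain c2 where c2: "c2 > 0" "\<And>\<zeta> u. \<zeta> \<in> path_image g \<union> inside (path_image g) \<Longrightarrow> oproj G u = 0 \<Longrightarrow>
      c2 * norm u \<le> norm (\<zeta> *\<^sub>C u - S u)"
    using uniform_lower_bound[OF compact_region[OF path] low] by blast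
  define c where "c = min c1 c2"
  have c: "c > 0" using c1 c2 by (simp add: c_def)
  have cT: "c * norm u \<le> norm (\<zeta> *\<^sub>C u - S u)" if "\<zeta> \<in> path_image g" for \<zeta> u
    using c1(2)[OF that, of u] mult_right_mono[of c c1 "norm u"] by (simp add: c_def)
  have cF: "c * norm u \<le> norm (\<zeta> *\<^sub>C u - S u)"
    if "\<zeta> \<in> path_image g \<union> inside (path_image g)" "oproj G u = 0" for \<zeta> u
    using c2(2)[OF that] mult_right_mono[of c c2 "norm u"] by (simp add: c_def)
  have bijS: "bij (\<lambda>x. \<zeta> *\<^sub>C x - S x)" if "\<zeta> \<in> path_image g" for \<zeta>
    using res that by (auto simp: res_set_def)
  define Q where "Q = oproj G"
  define F where "F u = u - Q u" for u
  have Q: "Q (u + v) = Q u + Q v" "Q (a *\<^sub>C u) = a *\<^sub>C Q u" "Q (u - v) = Q u - Q v" "Q (Q u) = Q u" for u v a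
    unfolding Q_def using oproj_ident[OF G oproj_in_span] by (auto simp: oproj_add oproj_scaleC oproj_diff)
  have Q0: "Q 0 = 0" using Q(2)[of 0 0] by simp
  have F: "F (u + v) = F u + F v" "F (a *\<^sub>C u) = a *\<^sub>C F u" "F (u - v) = F u - F v" "Q (F u) = 0" for u v a
    by (auto simp: F_def Q complex_vector.scale_right_diff_distrib)
  have F0: "F u = u" if "Q u = 0" for u using that by (simp add: F_def)
  have nF: "norm (F u) \<le> norm u" for u unfolding F_def Q_def by (rule norm_oproj_le(2)[OF G])
  have W_in: "Q e = e" if "e \<in> cspan W" for e
    unfolding Q_def using oproj_ident[OF G] EW that by metis
  have SE: "S u \<in> cspan G" if "u \<in> cspan G" for u
    using that unfolding EW
  proof (induction rule: complex_vector.span_induct)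
    case base show ?case
      by (auto simp: csubspace_iff clinear_props[OF S] complex_vector.span_zero
          complex_vector.span_add complex_vector.span_scale)
  next
    case (step e)
    then show ?case
      using eig[OF step] complex_vector.span_scale[OF complex_vector.span_base[OF step]] by auto
  qed
  have stable: "riesz_near g S' \<sigma> (oproj G) \<epsilon>"
    if \<epsilon>: "\<epsilon> > 0" and d: "d > 0" "d \<le> c / 2" "8 * d / c\<^sup>2 * L \<le> \<epsilon>" and S': "clinear S'"
      and Y: "csubspace Y" "fin_dim Y" and fr: "\<And>u. S' u - w *\<^sub>C u \<in> Y"
      and close: "\<And>u. norm (S' u - S u) \<le> d * norm u" for \<epsilon> d S' Y w
  proof -
    define T where "T u = S (Q u) + F (S' (F u))" for u
    have T: "clinear T"
      by (auto simp: clinear_iff T_def Q F clinear_props[OF S] clinear_props[OF S'] scaleC_add_right)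
    have T_F: "T u = F (S' u)" if "Q u = 0" for u
      using that by (simp add: T_def F0 clinear_props[OF S])
    have TS: "norm (T u - S u) \<le> d * norm u" for u
    proof -
      have "S u = S (Q u) + S (F u)" using clinear_props(1)[OF S, of "Q u" "F u"] by (simp add: F_def)
      moreover have "S (F u) = F (S (F u))"
        using compl[of "F u"] F(4)[of u] by (simp add: F0 Q_def)
      ultimately have "T u - S u = F (S' (F u) - S (F u))" unfolding T_def F(3) by simp
      then have "norm (T u - S u) \<le> norm (S' (F u) - S (F u))" using nF by simp
      also have "\<dots> \<le> d * norm (F u)" by (rule close)
      also have "\<dots> \<le> d * norm u" using nF d by simp
      finally show ?thesis .
    qed
    have d_le: "d * norm u \<le> c / 2 * norm u" for u using d by (intro mult_right_mono) auto
    note pS' = perturbed_bijective[OF S S' bijS c cT order_trans[OF close d_le]]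
    note pT = perturbed_bijective[OF S T bijS c cT order_trans[OF TS d_le]]
    interpret iS': invariant_subspace UNIV S' by (rule clinear_invariant_UNIV[OF S'])
    interpret iT: invariant_subspace UNIV T by (rule clinear_invariant_UNIV[OF T])
    obtain B where B: "finite B" "cspan B = Y" using Y by (auto simp: fin_dim_def)
    have BG: "y \<in> cspan (B \<union> G)" if "y \<in> cspan B \<or> y \<in> cspan G" for y
      using that complex_vector.span_mono[of B "B \<union> G"] complex_vector.span_mono[of G "B \<union> G"] by blast
    have FY: "F y \<in> cspan (B \<union> G)" if "y \<in> Y" for y
      unfolding F_def Q_def using that B oproj_in_span[of G y] by (intro complex_vector.span_diff BG) auto
    have T_fr: "T u - w *\<^sub>C u \<in> cspan (B \<union> G)" for u
    proof -
      have "w *\<^sub>C u = w *\<^sub>C Q u + w *\<^sub>C F (F u)"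
        by (simp add: F0 F(4)) (simp add: F_def complex_vector.scale_right_diff_distrib)
      then have "T u - w *\<^sub>C u = (S (Q u) - w *\<^sub>C Q u) + F (S' (F u) - w *\<^sub>C F u)"
        by (simp add: T_def F)
      moreover have "S (Q u) - w *\<^sub>C Q u \<in> cspan G"
        unfolding Q_def using oproj_in_span by (intro complex_vector.span_diff SE complex_vector.span_scale)
      ultimately show ?thesis using BG FY[OF fr] complex_vector.span_add by metis
    qed
    have fdBG: "csubspace (cspan (B \<union> G))" "fin_dim (cspan (B \<union> G))"
      using B G by (auto simp: fin_dim_def orthonormal_def)
    interpret rS': riesz_setting S' g
      by unfold_locales (use rect closed pS'(1) iS'.finite_rank_root_span[OF Y] fr in auto)
    interpret rT: riesz_setting T g
      by unfold_locales (use rect closed pT(1) iT.finite_rank_root_span[OF fdBG] T_fr in auto)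
    have lin: "clinear (riesz_projection g S')" by (simp add: clinear_iff rS'.riesz_add rS'.riesz_scaleC)
    have wn: "winding_number g \<mu> = 0 \<or> winding_number g \<mu> = \<sigma>" if "\<mu> \<notin> path_image g" for \<mu>
      using \<sigma>(2) wn_out that by blast
    have linT: "clinear (riesz_projection g T)" by (simp add: clinear_iff rT.riesz_add rT.riesz_scaleC)
    have T_E: "riesz_projection g T u = \<sigma> *\<^sub>C u" if "u \<in> cspan W" for u
      using that
    proof (induction rule: complex_vector.span_induct)
      case base show ?case
        by (auto simp: csubspace_iff clinear_props[OF linT] scaleC_add_right complex_vector.scale_left_commute)
    next
      case (step e)
      obtain \<mu> where \<mu>: "\<mu> \<in> inside (path_image g)" "S e = \<mu> *\<^sub>C e" using eig[OF step] by blast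
      have "Q e = e" using W_in step complex_vector.span_base by blast
      then have "T e = \<mu> *\<^sub>C e" using \<mu> Q0 by (simp add: T_def F_def clinear_props[OF S'])
      then have "(shift T \<mu> ^^ 1) e = 0" by (simp add: shift_def)
      then have "e \<in> gen_eigenvectors UNIV T \<mu>" unfolding gen_eigenvectors_def by blast
      from rT.riesz_gen_eigenvector[OF this] show ?case
        using \<sigma>(2)[OF \<mu>(1)] clinear_props(3)[OF linT] by (cases "e = 0") auto
    qed
    define X where "X = {u. Q u = 0}"
    have X: "invariant_subspace X T"
    proof
      show "linear_op X T" using clinear_props[OF T] Q Q0 by (auto simp: linear_op_def csubspace_iff X_def)
      show "T x \<in> X" if "x \<in> X" for x using that T_F F(4) by (simp add: X_def)
    qed
    have T_X: "riesz_projection g T u = 0" if "u \<in> X" for u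
    proof -
      interpret iX: invariant_subspace X T by (rule X)
      have "u \<in> iX.root_span" using iX.finite_rank_root_span[OF fdBG that T_fr] .
      then show ?thesis
      proof (induction rule: complex_vector.span_induct)
        case base show ?case by (auto simp: csubspace_iff clinear_props[OF linT])
      next
        case (step v)
        then obtain \<mu> where v: "v \<in> gen_eigenvectors X T \<mu>" by blast
        show ?case
        proof (cases "v = 0")
          case False
          obtain y where y: "y \<in> X" "y \<noteq> 0" "T y = \<mu> *\<^sub>C y"
            using iX.gen_eigenvector_imp_eigenvector[OF v False] by blast
          have Qy: "Q y = 0" using y by (simp add: X_def)
          have "\<mu> \<notin> path_image g \<union> inside (path_image g)"
          proof
            \<comment> \<open>an eigenvector of \<open>T\<close> in the complement is almost an eigenvector of \<open>S\<close>\<close>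
            assume \<mu>: "\<mu> \<in> path_image g \<union> inside (path_image g)"
            have "c * norm y \<le> norm (\<mu> *\<^sub>C y - S y)" using cF[OF \<mu>] Qy by (simp add: Q_def)
            also have "\<mu> *\<^sub>C y - S y = T y - S y" using y by simp
            also have "norm \<dots> \<le> d * norm y" by (rule TS)
            also have "\<dots> \<le> c / 2 * norm y" by (rule d_le)
            finally show False using c y(2) by simp
          qed
          moreover have "v \<in> gen_eigenvectors UNIV T \<mu>" using v by (auto simp: gen_eigenvectors_def)
          ultimately show ?thesis using rT.riesz_gen_eigenvector[of v \<mu>] False wn_out by simp
        qed (simp add: clinear_props[OF linT])
      qed
    qed
    have T_Q: "riesz_projection g T u = \<sigma> *\<^sub>C oproj G u" for u
    proof -
      have "riesz_projection g T (Q u) = \<sigma> *\<^sub>C Q u"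
        using T_E[of "Q u"] EW oproj_in_span[of G u] by (simp add: Q_def)
      moreover have "riesz_projection g T (F u) = 0" using T_X F(4) by (simp add: X_def)
      ultimately show ?thesis using rT.riesz_add[of "Q u" "F u"] by (simp add: F_def Q_def)
    qed
    have diff: "norm (resolvent UNIV S' \<zeta> u - resolvent UNIV T \<zeta> u) \<le> 8 * d / c\<^sup>2 * norm u"
      if \<zeta>: "\<zeta> \<in> path_image g" for \<zeta> u
    proof -
      define x where "x = resolvent UNIV S' \<zeta> u"
      define y where "y = resolvent UNIV T \<zeta> u"
      have x: "\<zeta> *\<^sub>C x - S' x = u" unfolding x_def by (rule resolvent_solves[OF pS'(1)[OF \<zeta> \<zeta>]])
      have y: "\<zeta> *\<^sub>C y - T y = u" unfolding y_def by (rule resolvent_solves[OF pT(1)[OF \<zeta> \<zeta>]])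
      have "\<zeta> *\<^sub>C (x - y) - S' (x - y) = (\<zeta> *\<^sub>C x - S' x) - (\<zeta> *\<^sub>C y - T y) + (S' y - T y)"
        by (simp add: clinear_props[OF S'] complex_vector.scale_right_diff_distrib)
      then have eq: "\<zeta> *\<^sub>C (x - y) - S' (x - y) = (S' y - S y) - (T y - S y)" by (simp add: x y)
      have "c / 2 * norm (x - y) \<le> norm ((S' y - S y) - (T y - S y))"
        using pS'(2)[OF \<zeta> \<zeta>, of "x - y"] unfolding eq .
      also have "\<dots> \<le> d * norm y + d * norm y"
        by (rule order_trans[OF norm_triangle_ineq4 add_mono[OF close TS]])
      also have "\<dots> = 2 * d * norm y" by simp
      also have "\<dots> \<le> 2 * d * (2 / c * norm u)"
        using pT(2)[OF \<zeta> \<zeta>, of y] c d unfolding y by (intro mult_left_mono) (auto simp: field_simps)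
      finally show ?thesis using c by (simp add: x_def y_def field_simps power2_eq_square)
    qed
    have "norm (riesz_projection g S' u - \<sigma> *\<^sub>C oproj G u) \<le> \<epsilon> * norm u" for u
    proof -
      define v where "v = riesz_projection g S' u - riesz_projection g T u"
      have "has_curve_integral (\<lambda>\<zeta>. resolvent UNIV S' \<zeta> u - resolvent UNIV T \<zeta> u) ((2 * of_real pi * \<i>) *\<^sub>C v) g"
        using has_curve_integral_diff[OF rS'.has_integral[of u] rT.has_integral[of u]]
        unfolding v_def complex_vector.scale_right_diff_distrib .
      then have "norm ((2 * of_real pi * \<i>) *\<^sub>C v) \<le> (8 * d / c\<^sup>2 * norm u) * L"
        by (rule has_curve_integral_norm_le)
          (intro norm_curve_sum_le L(2) diff; use c d in simp)
      then have "2 * pi * norm v \<le> (8 * d / c\<^sup>2 * norm u) * L" by (simp add: norm_scaleC norm_mult)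
      moreover have "1 * norm v \<le> 2 * pi * norm v" using pi_gt3 by (intro mult_right_mono) auto
      ultimately have "norm v \<le> (8 * d / c\<^sup>2 * L) * norm u" by (simp add: mult_ac)
      also have "\<dots> \<le> \<epsilon> * norm u" using d(3) by (rule mult_right_mono) simp
      finally show ?thesis by (simp add: v_def T_Q)
    qed
    then show ?thesis using lin rS'.riesz_idempotent[OF wn] unfolding riesz_near_def by blast
  qed
  have choose: "\<exists>d>0. d \<le> c / 2 \<and> 8 * d / c\<^sup>2 * L \<le> \<epsilon>" if \<epsilon>: "\<epsilon> > 0" for \<epsilon>
  proof -
    define B where "B = 8 * L / c\<^sup>2"
    have B: "B > 0" using c L(1) by (simp add: B_def)
    define d where "d = min (c / 2) (\<epsilon> / B)"
    have "d * B \<le> \<epsilon>" using B by (simp add: d_def pos_le_divide_eq[symmetric])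
    then have "8 * d / c\<^sup>2 * L \<le> \<epsilon>" by (simp add: B_def mult_ac)
    moreover have "d > 0" using c \<epsilon> B by (simp add: d_def)
    moreover have "d \<le> c / 2" unfolding d_def by (rule min.cobounded1)
    ultimately show ?thesis by blast
  qed
  show ?thesis
  proof (intro exI[of _ \<sigma>] conjI \<sigma>(1) allI impI)
    fix \<epsilon> :: real assume \<epsilon>: "\<epsilon> > 0"
    obtain d where d: "d > 0" "d \<le> c / 2" "8 * d / c\<^sup>2 * L \<le> \<epsilon>" using choose[OF \<epsilon>] by blast
    have "riesz_near g S' \<sigma> (oproj G) \<epsilon>" if "finite_rank_perturbation S d S'" for S'
      using that stable[OF \<epsilon> d] unfolding finite_rank_perturbation_def by blast
    then show "\<exists>d>0. \<forall>S'. finite_rank_perturbation S d S' \<longrightarrow> riesz_near g S' \<sigma> (oproj G) \<epsilon>"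
      using d(1) by blast
  qed
qed

text \<open>The proof of the Fredholm alternative with one sufficiently good finite-rank approximation \<open>T\<close> of
  \<open>S - w\<close>: for unit vectors \<open>x\<^sub>n\<close> with \<open>(\<mu> - S) x\<^sub>n \<longlonglongrightarrow> 0\<close>, a subsequence of \<open>T x\<^sub>n\<close> converges;
  \<open>H = (\<mu> - S) + T\<close> is bounded below because it is close to \<open>\<mu> - w\<close>, so this subsequence of \<open>x\<^sub>n\<close>
  converges as well, to a unit eigenvector.\<close>

lemma injective_imp_bounded_below:
  fixes S :: "'v::chilbert_space \<Rightarrow> 'v"
  assumes S: "clinear S" "bounded_linear S" and T: "clinear T"
    and Y: "fin_dim Y" "\<And>u. T u \<in> Y"
    and close: "\<And>u. norm (S u - w *\<^sub>C u - T u) \<le> cmod (\<mu> - w) / 2 * norm u" and \<mu>: "\<mu> \<noteq> w"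
    and F: "csubspace F" "closed F" and inj: "\<And>u. u \<in> F \<Longrightarrow> S u = \<mu> *\<^sub>C u \<Longrightarrow> u = 0"
  shows "\<exists>c>0. \<forall>u\<in>F. c * norm u \<le> norm (\<mu> *\<^sub>C u - S u)"
proof (rule ccontr)
  assume neg: "\<not> ?thesis"
  have "\<exists>u\<in>F. norm u = 1 \<and> norm (\<mu> *\<^sub>C u - S u) < 1 / real (Suc n)" for n
  proof -
    have "1 / real (Suc n) > 0" by simp
    then obtain u where u: "u \<in> F" "norm (\<mu> *\<^sub>C u - S u) < 1 / real (Suc n) * norm u"
      using neg by (meson not_le)
    then have nz: "norm u > 0" by (metis mult_zero_right norm_ge_zero not_less order_less_le)
    define a where "a = complex_of_real (1 / norm u)"
    have a: "cmod a = 1 / norm u" using nz unfolding a_def norm_of_real by simp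
    have "\<mu> *\<^sub>C (a *\<^sub>C u) - S (a *\<^sub>C u) = a *\<^sub>C (\<mu> *\<^sub>C u - S u)"
      by (simp add: clinear_props[OF S(1)] complex_vector.scale_right_diff_distrib complex_vector.scale_left_commute)
    then have "norm (\<mu> *\<^sub>C (a *\<^sub>C u) - S (a *\<^sub>C u)) < 1 / real (Suc n)"
      using u(2) nz by (simp add: norm_scaleC a divide_less_eq)
    moreover have "norm (a *\<^sub>C u) = 1" using nz by (simp add: norm_scaleC a)
    ultimately show ?thesis using u(1) F(1) by (intro bexI[of _ "a *\<^sub>C u"]) (auto simp: csubspace_iff)
  qed
  then obtain x where x: "\<And>n. x n \<in> F" "\<And>n. norm (x n) = 1"
    "\<And>n. norm (\<mu> *\<^sub>C x n - S (x n)) < 1 / real (Suc n)" by metis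
  obtain KS where KS: "\<And>u. norm (S u) \<le> norm u * KS" using bounded_linear.bounded[OF S(2)] by blast
  have "norm (T (x n)) \<le> KS + cmod w + cmod (\<mu> - w) / 2" for n
  proof -
    have "T (x n) = S (x n) - w *\<^sub>C x n - (S (x n) - w *\<^sub>C x n - T (x n))" by simp
    then have "norm (T (x n)) \<le> norm (S (x n) - w *\<^sub>C x n) + norm (S (x n) - w *\<^sub>C x n - T (x n))"
      by (metis norm_triangle_ineq4)
    moreover have "norm (S (x n) - w *\<^sub>C x n) \<le> norm (S (x n)) + norm (w *\<^sub>C x n)" by (rule norm_triangle_ineq4)
    ultimately show ?thesis using close[of "x n"] KS[of "x n"] x(2)[of n] by (simp add: norm_scaleC)
  qed
  then obtain l s where s: "strict_mono (s :: nat \<Rightarrow> nat)" "((\<lambda>n. T (x n)) \<circ> s) \<longlonglongrightarrow> l"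
    using bounded_seq_in_fin_dim_convergent[OF Y(1), of "\<lambda>n. T (x n)"] Y(2) by blast
  define H where "H u = \<mu> *\<^sub>C u - S u + T u" for u
  have H_low: "cmod (\<mu> - w) / 2 * norm u \<le> norm (H u)" for u
  proof -
    have "(\<mu> - w) *\<^sub>C u = H u + (S u - w *\<^sub>C u - T u)"
      by (simp add: H_def complex_vector.scale_left_diff_distrib)
    then have "cmod (\<mu> - w) * norm u \<le> norm (H u) + norm (S u - w *\<^sub>C u - T u)"
      by (metis norm_scaleC norm_triangle_ineq)
    then show ?thesis using close[of u] by (simp add: field_simps)
  qed
  have H_diff: "H (u - v) = H u - H v" for u v
    by (simp add: H_def clinear_props[OF S(1)] clinear_props[OF T] complex_vector.scale_right_diff_distrib)
  have res0: "(\<lambda>n. \<mu> *\<^sub>C x (s n) - S (x (s n))) \<longlonglongrightarrow> 0"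
  proof (rule Lim_null_comparison)
    show "\<forall>\<^sub>F n in sequentially. norm (\<mu> *\<^sub>C x (s n) - S (x (s n))) \<le> 1 / real (Suc n)"
    proof (intro always_eventually allI)
      fix n
      have "n \<le> s n" by (rule seq_suble[OF s(1)])
      then have "1 / real (Suc (s n)) \<le> 1 / real (Suc n)" by (simp add: field_simps)
      then show "norm (\<mu> *\<^sub>C x (s n) - S (x (s n))) \<le> 1 / real (Suc n)" using x(3)[of "s n"] by simp
    qed
    show "(\<lambda>n. 1 / real (Suc n)) \<longlonglongrightarrow> 0" using LIMSEQ_inverse_real_of_nat by (simp add: inverse_eq_divide)
  qed
  have "(\<lambda>n. H (x (s n))) \<longlonglongrightarrow> 0 + l"
    unfolding H_def using tendsto_add[OF res0 s(2)[unfolded comp_def]] .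
  then have Cauchy_H: "Cauchy (\<lambda>n. H (x (s n)))" by (rule LIMSEQ_imp_Cauchy)
  have "Cauchy (\<lambda>n. x (s n))"
  proof (rule metric_CauchyI)
    fix e :: real assume e: "e > 0"
    have pos: "cmod (\<mu> - w) / 2 > 0" using \<mu> by simp
    then have "cmod (\<mu> - w) / 2 * e > 0" using e by (rule mult_pos_pos)
    then obtain M where M: "\<And>m n. m \<ge> M \<Longrightarrow> n \<ge> M \<Longrightarrow> dist (H (x (s m))) (H (x (s n))) < cmod (\<mu> - w) / 2 * e"
      using metric_CauchyD[OF Cauchy_H] by blast
    have "dist (x (s m)) (x (s n)) < e" if "m \<ge> M" "n \<ge> M" for m n
    proof -
      have "cmod (\<mu> - w) / 2 * norm (x (s m) - x (s n)) < cmod (\<mu> - w) / 2 * e"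
        using H_low[of "x (s m) - x (s n)"] M[OF that] by (simp add: H_diff dist_norm)
      then show ?thesis using pos by (metis dist_norm mult_less_cancel_left_pos)
    qed
    then show "\<exists>M. \<forall>m\<ge>M. \<forall>n\<ge>M. dist (x (s m)) (x (s n)) < e" by blast
  qed
  then obtain y where y: "(\<lambda>n. x (s n)) \<longlonglongrightarrow> y" using Cauchy_convergent convergent_def by metis
  have "y \<in> F" using closed_sequentially[OF F(2) _ y] x(1) by blast
  have "(\<lambda>n. \<mu> *\<^sub>C x (s n) - S (x (s n))) \<longlonglongrightarrow> \<mu> *\<^sub>C y - S y"
    by (intro tendsto_diff bounded_linear.tendsto[OF bounded_linear_scaleC_right] bounded_linear.tendsto[OF S(2)] y)
  then have "\<mu> *\<^sub>C y - S y = 0" using res0 LIMSEQ_unique by blast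
  then have "y = 0" using inj[OF \<open>y \<in> F\<close>] by simp
  moreover have "(\<lambda>n. norm (x (s n))) \<longlonglongrightarrow> norm y" using y by (rule tendsto_norm)
  then have "norm y = 1" using x(2) LIMSEQ_unique[OF _ tendsto_const] by simp
  ultimately show False by simp
qed

section \<open>Hermitian operators and residuals\<close>

lemma norm_orthogonal_sum:
  assumes "finite J" "\<And>i j. i \<in> J \<Longrightarrow> j \<in> J \<Longrightarrow> i \<noteq> j \<Longrightarrow> cinner (y i) (y j) = 0"
  shows "(norm (sum y J))\<^sup>2 = (\<Sum>i\<in>J. (norm (y i))\<^sup>2)"
  using assms
proof (induction J rule: finite_induct)
  case (insert i J)
  have "cinner (y i) (sum y J) = 0"
    unfolding cinner_sum_right using insert by (intro sum.neutral) auto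
  then show ?case using insert by (simp add: pythagoras)
qed simp

text \<open>By orthogonality, the squared residual is the mean of \<open>|l - \<mu>|\<^sup>2\<close>, weighted by the squared norms of
  the components of \<open>u\<close>; so not all eigenvalues involved are farther from \<open>\<mu>\<close> than the residual.\<close>

lemma eigenvalue_near_residual:
  fixes T :: "'a::complex_inner \<Rightarrow> 'a"
  assumes T: "linear_op X T" and V: "\<And>l x. l \<in> I \<Longrightarrow> x \<in> V l \<Longrightarrow> x \<in> X \<and> T x = l *\<^sub>C x"
    and sub: "\<And>l. l \<in> I \<Longrightarrow> csubspace (V l)"
    and orth: "\<And>l k x y. l \<in> I \<Longrightarrow> k \<in> I \<Longrightarrow> l \<noteq> k \<Longrightarrow> x \<in> V l \<Longrightarrow> y \<in> V k \<Longrightarrow> cinner x y = 0"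
    and u: "u \<in> cspan (\<Union>l\<in>I. V l)" "u \<noteq> 0" "norm (T u - \<mu> *\<^sub>C u) \<le> \<rho> * norm u"
  shows "\<exists>l\<in>I. cmod (l - \<mu>) \<le> \<rho> \<and> (\<exists>x\<in>V l. x \<noteq> 0)"
proof -
  have "\<exists>J x. finite J \<and> J \<subseteq> I \<and> (\<forall>l\<in>J. x l \<in> V l) \<and> (\<forall>l. l \<notin> J \<longrightarrow> x l = 0) \<and> u = sum x J"
    using u(1)
  proof (induction rule: complex_vector.span_induct)
    case base
    let ?P = "\<lambda>u. \<exists>J x. finite J \<and> J \<subseteq> I \<and> (\<forall>l\<in>J. x l \<in> V l) \<and> (\<forall>l. l \<notin> J \<longrightarrow> x l = 0) \<and> u = sum x J"
    have "?P 0" by (intro exI[of _ "{}"] exI[of _ "\<lambda>_. 0"]) auto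
    moreover have "?P (u + v)" if P: "?P u" "?P v" for u v
    proof -
      obtain J x where J: "finite J" "J \<subseteq> I" "\<forall>l\<in>J. x l \<in> V l" "\<forall>l. l \<notin> J \<longrightarrow> x l = 0" "u = sum x J"
        using P(1) by blast
      obtain J' x' where J': "finite J'" "J' \<subseteq> I" "\<forall>l\<in>J'. x' l \<in> V l" "\<forall>l. l \<notin> J' \<longrightarrow> x' l = 0" "v = sum x' J'"
        using P(2) by blast
      have "u = sum x (J \<union> J')" "v = sum x' (J \<union> J')"
        unfolding J(5) J'(5) using J J' by (intro sum.mono_neutral_left; auto)+
      then have "u + v = sum (\<lambda>l. x l + x' l) (J \<union> J')" by (simp add: sum.distrib)
      moreover have "x l + x' l \<in> V l" if l: "l \<in> J \<union> J'" for l
      proof -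
        have I: "l \<in> I" using l J(2) J'(2) by blast
        have zero: "0 \<in> V l" by (rule complex_vector.subspace_0[OF sub[OF I]])
        have "x l \<in> V l" using J(3,4) zero by (cases "l \<in> J") auto
        moreover have "x' l \<in> V l" using J'(3,4) zero by (cases "l \<in> J'") auto
        ultimately show ?thesis using complex_vector.subspace_add[OF sub[OF I]] by blast
      qed
      ultimately show ?thesis
        using J(1,2,4) J'(1,2,4) by (intro exI[of _ "J \<union> J'"] exI[of _ "\<lambda>l. x l + x' l"]) auto
    qed
    moreover have "?P (c *\<^sub>C u)" if P: "?P u" for c u
    proof -
      obtain J x where J: "finite J" "J \<subseteq> I" "\<forall>l\<in>J. x l \<in> V l" "\<forall>l. l \<notin> J \<longrightarrow> x l = 0" "u = sum x J"
        using P by blast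
      then have "c *\<^sub>C u = sum (\<lambda>l. c *\<^sub>C x l) J" by (simp add: complex_vector.scale_sum_right)
      moreover have "c *\<^sub>C x l \<in> V l" if "l \<in> J" for l
        using J that complex_vector.subspace_scale[OF sub] by blast
      ultimately show ?thesis using J(1,2,4) by (intro exI[of _ J] exI[of _ "\<lambda>l. c *\<^sub>C x l"]) auto
    qed
    ultimately show ?case by (auto simp: csubspace_iff)
  next
    case (step v)
    then obtain l where "l \<in> I" "v \<in> V l" by blast
    then show ?case by (intro exI[of _ "{l}"] exI[of _ "\<lambda>k. if k = l then v else 0"]) auto
  qed
  then obtain J x where J: "finite J" "J \<subseteq> I" "\<And>l. l \<in> J \<Longrightarrow> x l \<in> V l" "u = sum x J" by metis
  have "T u = T (\<Sum>l\<in>J. 1 *\<^sub>C x l)" by (simp add: J(4) scaleC_one)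
  also have "\<dots> = (\<Sum>l\<in>J. 1 *\<^sub>C T (x l))" using J V by (intro linear_op_sum[OF T]) blast
  also have "\<dots> = (\<Sum>l\<in>J. l *\<^sub>C x l)" using J V by (intro sum.cong) (auto simp: scaleC_one)
  finally have "T u - \<mu> *\<^sub>C u = (\<Sum>l\<in>J. (l - \<mu>) *\<^sub>C x l)"
    by (simp add: J(4) complex_vector.scale_sum_right sum_subtractf complex_vector.scale_left_diff_distrib)
  moreover have "cinner ((l - \<mu>) *\<^sub>C x l) ((k - \<mu>) *\<^sub>C x k) = 0" "cinner (x l) (x k) = 0"
    if "l \<in> J" "k \<in> J" "l \<noteq> k" for l k
    using orth[of l k "x l" "x k"] J that by (auto simp: cinner_scaleC_left cinner_scaleC_right)
  ultimately have nT: "(norm (T u - \<mu> *\<^sub>C u))\<^sup>2 = (\<Sum>l\<in>J. (cmod (l - \<mu>))\<^sup>2 * (norm (x l))\<^sup>2)"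
    and nu: "(norm u)\<^sup>2 = (\<Sum>l\<in>J. (norm (x l))\<^sup>2)"
    using J(1) by (simp_all add: J(4) norm_orthogonal_sum norm_scaleC power_mult_distrib)
  have \<rho>: "\<rho> \<ge> 0" using order_trans[OF norm_ge_zero u(3)] u(2) by (simp add: zero_le_mult_iff)
  show ?thesis
  proof (rule ccontr)
    assume neg: "\<not> ?thesis"
    then have far: "\<rho> < cmod (l - \<mu>)" if "l \<in> J" "x l \<noteq> 0" for l
      using that J(2,3) by (meson not_le subsetD)
    obtain l where l: "l \<in> J" "x l \<noteq> 0" using u(2) J(4) by (metis sum.neutral)
    have "\<rho>\<^sup>2 * (norm u)\<^sup>2 = (\<Sum>l\<in>J. \<rho>\<^sup>2 * (norm (x l))\<^sup>2)" by (simp add: nu sum_distrib_left)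
    also have "\<dots> < (\<Sum>l\<in>J. (cmod (l - \<mu>))\<^sup>2 * (norm (x l))\<^sup>2)"
    proof (rule sum_strict_mono_ex1[OF J(1)])
      show "\<forall>l\<in>J. \<rho>\<^sup>2 * (norm (x l))\<^sup>2 \<le> (cmod (l - \<mu>))\<^sup>2 * (norm (x l))\<^sup>2"
      proof
        fix l assume l: "l \<in> J"
        show "\<rho>\<^sup>2 * (norm (x l))\<^sup>2 \<le> (cmod (l - \<mu>))\<^sup>2 * (norm (x l))\<^sup>2"
          using far[OF l] \<rho> by (cases "x l = 0") (auto intro!: mult_right_mono power_mono)
      qed
      show "\<exists>l\<in>J. \<rho>\<^sup>2 * (norm (x l))\<^sup>2 < (cmod (l - \<mu>))\<^sup>2 * (norm (x l))\<^sup>2"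
        using l far[OF l] \<rho> by (intro bexI[of _ l]) (auto intro!: mult_strict_right_mono power_strict_mono)
    qed
    also have "\<dots> \<le> (\<rho> * norm u)\<^sup>2" unfolding nT[symmetric] by (intro power_mono u(3)) simp
    finally show False by (simp add: power_mult_distrib)
  qed
qed

lemma hermitian_eigenvectors_orthogonal:
  assumes sym: "\<And>x y. x \<in> X \<Longrightarrow> y \<in> X \<Longrightarrow> cinner (T x) y = cinner x (T y)"
    and x: "x \<in> X" "T x = l *\<^sub>C x" and y: "y \<in> X" "T y = k *\<^sub>C y" and "l \<noteq> k"
  shows "cinner x y = 0"
proof (cases "x = 0 \<or> y = 0")
  case False
  have "k * cinner y y = cnj k * cinner y y"
    using sym[OF y(1) y(1)] y by (simp add: cinner_scaleC_left cinner_scaleC_right)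
  then have "k = cnj k" using False by simp
  moreover have "l * cinner x y = cnj k * cinner x y"
    using sym[OF x(1) y(1)] x y by (simp add: cinner_scaleC_left cinner_scaleC_right)
  ultimately show ?thesis using \<open>l \<noteq> k\<close> by simp
qed auto

context invariant_subspace
begin

lemma hermitian_gen_eigenvector:
  assumes sym: "\<And>x y. x \<in> X \<Longrightarrow> y \<in> X \<Longrightarrow> cinner (T x) y = cinner x (T y)"
    and x: "x \<in> gen_eigenvectors X T l"
  shows "T x = l *\<^sub>C x"
proof (cases "x = 0")
  case False
  obtain y where y: "y \<in> X" "y \<noteq> 0" "T y = l *\<^sub>C y" using gen_eigenvector_imp_eigenvector[OF x False] .
  have "l * cinner y y = cnj l * cinner y y"
    using sym[OF y(1) y(1)] y by (simp add: cinner_scaleC_left cinner_scaleC_right)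
  then have real: "cnj l = l" using y(2) by simp
  interpret N: invariant_subspace X "shift T l" by (rule shift_invariant)
  have symN: "cinner (shift T l x) y = cinner x (shift T l y)" if "x \<in> X" "y \<in> X" for x y
    using that sym real
    by (simp add: shift_def cinner_diff_left cinner_diff_right cinner_scaleC_left cinner_scaleC_right)
  obtain n where "x \<in> X" "(shift T l ^^ n) x = 0" using x by (auto simp: gen_eigenvectors_def)
  then have "shift T l x = 0"
  proof (induction n)
    case 0
    then show ?case by (simp add: N.zero)
  next
    case (Suc n)
    show ?case
    proof (cases n)
      case 0
      then show ?thesis using Suc by simp
    next
      case (Suc j)
      let ?y = "(shift T l ^^ j) x"
      have y: "?y \<in> X" using Suc.prems N.pow_in by blast
      have "shift T l (shift T l ?y) = 0" using Suc.prems Suc by simp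
      then have "cinner (shift T l ?y) (shift T l ?y) = 0"
        using symN[OF N.maps[OF y] y] by simp
      then have "(shift T l ^^ n) x = 0" using Suc by simp
      then show ?thesis using Suc.IH Suc.prems by blast
    qed
  qed
  then show ?thesis by (simp add: shift_def)
qed (simp add: zero)

lemma hermitian_eigenvalue_near_residual:
  assumes fd: "fin_dim X" and sym: "\<And>x y. x \<in> X \<Longrightarrow> y \<in> X \<Longrightarrow> cinner (T x) y = cinner x (T y)"
    and u: "u \<in> X" "u \<noteq> 0" "norm (T u - \<mu> *\<^sub>C u) \<le> \<rho> * norm u"
  shows "\<exists>l. cmod (l - \<mu>) \<le> \<rho> \<and> (\<exists>x\<in>X. x \<noteq> 0 \<and> T x = l *\<^sub>C x)"
proof -
  have eq: "gen_eigenvectors X T l = {x \<in> X. T x = l *\<^sub>C x}" for l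
  proof -
    have "x \<in> gen_eigenvectors X T l" if "x \<in> X" "T x = l *\<^sub>C x" for x
      using that by (auto simp: gen_eigenvectors_def shift_def intro!: exI[of _ 1])
    then show ?thesis
      using hermitian_gen_eigenvector[OF sym] by (auto simp: gen_eigenvectors_def)
  qed
  have "\<exists>l\<in>UNIV. cmod (l - \<mu>) \<le> \<rho> \<and> (\<exists>x\<in>gen_eigenvectors X T l. x \<noteq> 0)"
  proof (rule eigenvalue_near_residual[OF linear])
    show "csubspace (gen_eigenvectors X T l)" for l by (rule subspace_gen_eigenvectors)
    show "cinner x y = 0" if "l \<noteq> k" "x \<in> gen_eigenvectors X T l" "y \<in> gen_eigenvectors X T k" for l k x y
      using that sym by (auto simp: eq intro: hermitian_eigenvectors_orthogonal[where X = X and T = T])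
    show "u \<in> cspan (\<Union>l\<in>UNIV. gen_eigenvectors X T l)" by (rule fin_dim_root_span[OF fd u(1)])
  qed (use u eq in auto)
  then show ?thesis unfolding eq by blast
qed

end


section \<open>Polar decomposition and form on eigenvectors\<close>

text \<open>\<open>P\<close> is \<open>|A|\<close> and \<open>B\<close> is its square root.\<close>

locale form_setting =
  fixes D :: "'h::complex_inner set" and A U :: "'h \<Rightarrow> 'h" and DP :: "'h set" and P :: "'h \<Rightarrow> 'h"
    and DB :: "'h set" and B :: "'h \<Rightarrow> 'h"
  assumes sa: "selfadjoint_op D A" and polar: "polar_decomposition D A U DP P"
    and sqrt: "positive_sqrt DP P DB B"
begin

lemma A_linear: "linear_op D A" and A_sym: "x \<in> D \<Longrightarrow> y \<in> D \<Longrightarrow> cinner (A x) y = cinner x (A y)"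
  using sa by (auto simp: selfadjoint_op_def)

lemma U_clinear: "clinear U" and U_sym: "cinner (U x) y = cinner x (U y)"
  and U_iso: "(\<And>y. U y = 0 \<Longrightarrow> cinner x y = 0) \<Longrightarrow> norm (U x) = norm x"
  using polar by (auto simp: polar_decomposition_def partial_isometry_def selfadjoint_op_def)

lemma P_facts: "DP = D" "linear_op D P" "x \<in> D \<Longrightarrow> y \<in> D \<Longrightarrow> cinner (P x) y = cinner x (P y)"
  "x \<in> D \<Longrightarrow> 0 \<le> Re (cinner (P x) x)" "U x = 0 \<longleftrightarrow> x \<in> D \<and> P x = 0"
  "x \<in> D \<Longrightarrow> A x = U (P x)" "U x \<in> D \<longleftrightarrow> x \<in> D" "x \<in> D \<Longrightarrow> A x = P (U x)"
  using polar by (auto simp: polar_decomposition_def positive_op_def selfadjoint_op_def)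

lemma B_facts: "linear_op DB B" "x \<in> DB \<Longrightarrow> y \<in> DB \<Longrightarrow> cinner (B x) y = cinner x (B y)"
  "x \<in> DB \<Longrightarrow> 0 \<le> Re (cinner (B x) x)" "x \<in> D \<longleftrightarrow> x \<in> DB \<and> B x \<in> DB" "x \<in> D \<Longrightarrow> P x = B (B x)"
  using sqrt P_facts(1) by (auto simp: positive_sqrt_def positive_op_def selfadjoint_op_def)

lemma DB_subspace: "csubspace DB" and D_subspace: "csubspace D"
  using B_facts(1) A_linear by (auto simp: linear_op_def)

lemma B_add: "x \<in> DB \<Longrightarrow> y \<in> DB \<Longrightarrow> B (x + y) = B x + B y"
  and B_scale: "x \<in> DB \<Longrightarrow> B (c *\<^sub>C x) = c *\<^sub>C B x"
  using B_facts(1) by (auto simp: linear_op_def)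

lemma U_range_orth: "U y = 0 \<Longrightarrow> cinner (U x) y = 0"
  by (simp add: U_sym)

text \<open>\<open>U\<close> is isometric on its own range, which is orthogonal to the kernel by symmetry.\<close>

lemma U_norm_le: "norm (U x) \<le> norm x"
proof -
  have "norm (U (U x)) = norm (U x)" by (rule U_iso[OF U_range_orth])
  moreover have "(norm (U x))\<^sup>2 = Re (cinner (U (U x)) x)" by (simp add: norm_eq_Re_cinner U_sym)
  ultimately have "norm (U x) * norm (U x) \<le> norm (U x) * norm x"
    using cinner_Cauchy_Schwarz[of "U (U x)" x] complex_Re_le_cmod[of "cinner (U (U x)) x"]
    by (simp add: power2_eq_square)
  then show ?thesis by (cases "norm (U x) = 0") (auto simp: mult_le_cancel_left)
qed

lemma U_U_ident:
  assumes "\<And>y. U y = 0 \<Longrightarrow> cinner x y = 0"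
  shows "U (U x) = x"
proof -
  have n: "norm (U (U x)) = norm x" "norm (U x) = norm x"
    using U_iso[OF U_range_orth, of x] U_iso[OF assms] by auto
  have "(norm (U (U x) - x))\<^sup>2 = (norm (U (U x)))\<^sup>2 + (norm x)\<^sup>2 - 2 * Re (cinner (U (U x)) x)"
    using norm_add_square[of "U (U x)" "- x"] by simp
  also have "cinner (U (U x)) x = cinner (U x) (U x)" by (simp add: U_sym)
  finally show ?thesis using n by (simp add: cinner_self_norm)
qed

lemma P_range_orth: "x \<in> D \<Longrightarrow> U y = 0 \<Longrightarrow> cinner (P x) y = 0"
  using P_facts(3,5) by simp

lemma norm_P_eq_norm_A: "x \<in> D \<Longrightarrow> norm (P x) = norm (A x)"
  using U_iso[OF P_range_orth] P_facts(6) by metis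

lemma norm_B_square_le: "x \<in> D \<Longrightarrow> (norm (B x))\<^sup>2 \<le> norm (A x) * norm x"
proof -
  assume x: "x \<in> D"
  then have "(norm (B x))\<^sup>2 = Re (cinner (P x) x)"
    using B_facts(2)[of "B x" x] B_facts(4,5) by (simp add: norm_eq_Re_cinner)
  also have "\<dots> \<le> norm (P x) * norm x"
    using complex_Re_le_cmod cinner_Cauchy_Schwarz order_trans by blast
  finally show ?thesis using norm_P_eq_norm_A[OF x] by simp
qed

text \<open>Otherwise \<open>S x - s x\<close> would be an eigenvector for the negative number \<open>- s\<close>.\<close>

lemma positive_root_unique:
  assumes S: "linear_op DS S" "\<And>x. x \<in> DS \<Longrightarrow> 0 \<le> Re (cinner (S x) x)"
    and x: "x \<in> DS" "S x \<in> DS" "S (S x) = complex_of_real (s * s) *\<^sub>C x" and s: "s > 0"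
  shows "S x = complex_of_real s *\<^sub>C x"
proof -
  have DS: "csubspace DS" and add: "\<And>x y. x \<in> DS \<Longrightarrow> y \<in> DS \<Longrightarrow> S (x + y) = S x + S y"
    and sc: "\<And>c x. x \<in> DS \<Longrightarrow> S (c *\<^sub>C x) = c *\<^sub>C S x" using S(1) by (auto simp: linear_op_def)
  define y where "y = S x + complex_of_real (- s) *\<^sub>C x"
  have sx: "complex_of_real (- s) *\<^sub>C x \<in> DS" using DS x(1) by (simp only: csubspace_iff)
  then have y: "y \<in> DS" using DS x(2) unfolding y_def csubspace_iff by blast
  have "S y = complex_of_real (s * s) *\<^sub>C x + complex_of_real (- s) *\<^sub>C S x"
    unfolding y_def by (simp only: add[OF x(2) sx] sc[OF x(1)] x(3))
  also have "\<dots> = complex_of_real (- s) *\<^sub>C y"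
    unfolding y_def by (simp add: scaleC_add_right scaleC_scaleC complex_vector.scale_right_diff_distrib)
  finally have "cinner (S y) y = complex_of_real (- s) * cinner y y" by (simp only: cinner_scaleC_left)
  then have "Re (cinner (S y) y) = - (s * (norm y)\<^sup>2)" by (simp add: cinner_self_norm)
  then have "s * (norm y)\<^sup>2 \<le> 0" using S(2)[OF y] by linarith
  then have "y = 0" using s by (simp add: mult_le_0_iff)
  then show ?thesis unfolding y_def by (simp add: eq_neg_iff_add_eq_0)
qed

text \<open>On an eigenvector the polar decomposition and the square root can be read off without functional
  calculus: \<open>|A|\<^sup>2\<close> acts as \<open>l\<^sup>2\<close>, hence \<open>|A|\<close> as \<open>|l|\<close>, hence \<open>B\<close> as the root of \<open>|l|\<close>.\<close>

lemma eigenvector_facts: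
  assumes x: "x \<in> D" "A x = complex_of_real l *\<^sub>C x" and l: "l \<noteq> 0"
  shows "U x = complex_of_real (sgn l) *\<^sub>C x" "B x = complex_of_real (root 2 \<bar>l\<bar>) *\<^sub>C x"
proof -
  have UP: "U (P x) = complex_of_real l *\<^sub>C x" using P_facts(6) x by simp
  then have Px: "P x \<in> D" using P_facts(7)[of "P x"] x(1) D_subspace by (simp add: csubspace_iff)
  have "U (P (P x)) = P (U (P x))" using P_facts(6,8)[OF Px] by simp
  also have "\<dots> = complex_of_real l *\<^sub>C P x"
    using P_facts(2) x(1) unfolding UP by (auto simp: linear_op_def)
  finally have "U (U (P (P x))) = complex_of_real (\<bar>l\<bar> * \<bar>l\<bar>) *\<^sub>C x"
    using UP by (simp add: clinear_props[OF U_clinear] scaleC_scaleC)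
  then have "P (P x) = complex_of_real (\<bar>l\<bar> * \<bar>l\<bar>) *\<^sub>C x"
    using U_U_ident[OF P_range_orth[OF Px]] by simp
  from positive_root_unique[OF P_facts(2,4) x(1) Px this]
  have P: "P x = complex_of_real \<bar>l\<bar> *\<^sub>C x" using l by simp
  have "complex_of_real \<bar>l\<bar> *\<^sub>C U x = complex_of_real l *\<^sub>C x"
    using UP unfolding P by (simp add: clinear_props[OF U_clinear])
  then have "complex_of_real (1 / \<bar>l\<bar>) *\<^sub>C complex_of_real \<bar>l\<bar> *\<^sub>C U x
      = complex_of_real (1 / \<bar>l\<bar>) *\<^sub>C complex_of_real l *\<^sub>C x" by simp
  moreover have "1 / \<bar>l\<bar> * \<bar>l\<bar> = 1" "1 / \<bar>l\<bar> * l = sgn l" using l by (auto simp: sgn_real_def)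
  ultimately show "U x = complex_of_real (sgn l) *\<^sub>C x"
    by (simp only: scaleC_scaleC of_real_mult[symmetric] of_real_1 scaleC_one)
  have "B (B x) = complex_of_real (root 2 \<bar>l\<bar> * root 2 \<bar>l\<bar>) *\<^sub>C x"
    using B_facts(5)[OF x(1)] P by (simp add: real_root_mult[symmetric] power2_eq_square[symmetric])
  from positive_root_unique[OF B_facts(1,3) _ _ this]
  show "B x = complex_of_real (root 2 \<bar>l\<bar>) *\<^sub>C x" using B_facts(4) x(1) l by simp
qed

lemma kernel_facts:
  assumes x: "x \<in> D" "A x = 0"
  shows "B x = 0"
proof -
  have "norm (P x) = 0" using norm_P_eq_norm_A[OF x(1)] x(2) by simp
  then have "(norm (B x))\<^sup>2 = 0"
    using norm_B_square_le[OF x(1)] x(2) by simp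
  then show ?thesis by simp
qed

abbreviation "a \<equiv> form_of U B"

lemma form_add: "x \<in> DB \<Longrightarrow> y \<in> DB \<Longrightarrow> a (x + y) u = a x u + a y u"
  "u \<in> DB \<Longrightarrow> v \<in> DB \<Longrightarrow> a x (u + v) = a x u + a x v"
  by (simp_all add: form_of_def B_add clinear_props[OF U_clinear] cinner_add_left cinner_add_right)

lemma form_scale: "x \<in> DB \<Longrightarrow> a (c *\<^sub>C x) y = c * a x y" "y \<in> DB \<Longrightarrow> a x (c *\<^sub>C y) = cnj c * a x y"
  by (simp_all add: form_of_def B_scale clinear_props[OF U_clinear] cinner_scaleC_left cinner_scaleC_right)

lemma form_hermitian: "a x y = cnj (a y x)"
  unfolding form_of_def by (metis U_sym cinner_commute)

lemma form_bound: "cmod (a x y) \<le> norm (B x) * norm (B y)"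
  unfolding form_of_def
  using cinner_Cauchy_Schwarz[of "U (B x)" "B y"] mult_right_mono[OF U_norm_le, of "norm (B y)" "B x"]
  by (rule order_trans) simp

text \<open>Against an eigenvector for \<open>l \<noteq> 0\<close>, the form and the energy inner product are multiples of the inner product;
  so orthogonality to an eigenvector means the same in both spaces.\<close>

lemma form_eigenvector:
  assumes x: "x \<in> D" "A x = complex_of_real l *\<^sub>C x" and l: "l \<noteq> 0" and y: "y \<in> DB"
  shows "a x y = cinner (A x) y" "cinner (B x) (B y) = complex_of_real \<bar>l\<bar> * cinner x y"
proof -
  let ?r = "root 2 \<bar>l\<bar>"
  note f = eigenvector_facts[OF x l]
  have "cinner x (B y) = complex_of_real ?r * cinner x y"
    using B_facts(2)[of x y] B_facts(4) x(1) y f(2) by (simp add: cinner_scaleC_left)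
  moreover have rr: "?r * ?r = \<bar>l\<bar>" by (simp add: real_root_mult[symmetric] power2_eq_square[symmetric])
  ultimately show BB: "cinner (B x) (B y) = complex_of_real \<bar>l\<bar> * cinner x y"
    unfolding f(2) cinner_scaleC_left by (metis mult.assoc of_real_mult)
  have "a x y = complex_of_real (sgn l) * cinner (B x) (B y)"
    unfolding form_of_def f(2) by (simp add: clinear_props[OF U_clinear] f(1) cinner_scaleC_left)
  also have "\<dots> = complex_of_real (sgn l * \<bar>l\<bar>) * cinner x y" unfolding BB by simp
  also have "sgn l * \<bar>l\<bar> = l" by (simp add: sgn_mult_abs)
  finally show "a x y = cinner (A x) y" unfolding x(2) cinner_scaleC_left .
qed

lemma ritz_unique:
  assumes F: "csubspace F" and v: "v \<in> F" "\<And>y. y \<in> F \<Longrightarrow> cinner v y = a x y"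
  shows "ritz_op a F x = v"
  unfolding ritz_op_def
proof (rule the_equality)
  fix u assume u: "u \<in> F \<and> (\<forall>y\<in>F. cinner u y = a x y)"
  have "u - v \<in> F" using u v F complex_vector.subspace_diff by blast
  then have "cinner (u - v) (u - v) = 0" using u v by (simp add: cinner_diff_left)
  then show "u = v" by simp
qed (use v in auto)

lemma ritz_facts:
  assumes F: "csubspace F" "fin_dim F" "F \<subseteq> DB" and x: "x \<in> F"
  shows "ritz_op a F x \<in> F" "\<And>y. y \<in> F \<Longrightarrow> cinner (ritz_op a F x) y = a x y"
proof -
  obtain G where G: "orthonormal G" "cspan G = F" using F(2) by (rule fin_dim_orthonormal_basis)
  define v where "v = (\<Sum>e\<in>G. a x e *\<^sub>C e)"
  have GF: "e \<in> F" if "e \<in> G" for e using G(2) that complex_vector.span_base by blast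
  have v: "v \<in> F" unfolding v_def using F(1) GF
    by (intro complex_vector.subspace_sum complex_vector.subspace_scale)
  have vy: "cinner v y = a x y" if y: "y \<in> F" for y
  proof -
    have "y = (\<Sum>e\<in>G. cinner y e *\<^sub>C e)" using oproj_ident[OF G(1), of y] G(2) y by (simp add: oproj_def)
    then have "B y = B (\<Sum>e\<in>G. cinner y e *\<^sub>C e)" by simp
    also have "\<dots> = (\<Sum>e\<in>G. cinner y e *\<^sub>C B e)"
      using GF F(3) by (intro linear_op_sum[OF B_facts(1)]) auto
    finally have "a x y = (\<Sum>e\<in>G. cnj (cinner y e) * a x e)"
      by (simp add: form_of_def cinner_sum_right cinner_scaleC_right)
    also have "\<dots> = (\<Sum>e\<in>G. a x e * cinner e y)"
      by (intro sum.cong refl) (metis cinner_commute mult.commute)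
    finally show ?thesis by (simp add: v_def cinner_sum_left cinner_scaleC_left)
  qed
  have "ritz_op a F x = v" using F(1) v vy by (rule ritz_unique)
  then show "ritz_op a F x \<in> F" "\<And>y. y \<in> F \<Longrightarrow> cinner (ritz_op a F x) y = a x y" using v vy by auto
qed

lemma ritz_invariant:
  assumes F: "csubspace F" "fin_dim F" "F \<subseteq> DB"
  shows "invariant_subspace F (ritz_op a F)"
proof
  show "linear_op F (ritz_op a F)"
    unfolding linear_op_def
  proof (intro conjI ballI allI F(1))
    fix x y assume xy: "x \<in> F" "y \<in> F"
    show "ritz_op a F (x + y) = ritz_op a F x + ritz_op a F y"
    proof (rule ritz_unique[OF F(1)])
      show "ritz_op a F x + ritz_op a F y \<in> F"
        using ritz_facts[OF F] xy F(1) complex_vector.subspace_add by blast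
      show "cinner (ritz_op a F x + ritz_op a F y) v = a (x + y) v" if "v \<in> F" for v
        using ritz_facts[OF F] xy F(3) that by (simp add: cinner_add_left form_add subset_iff)
    qed
  next
    fix c x assume x: "x \<in> F"
    show "ritz_op a F (c *\<^sub>C x) = c *\<^sub>C ritz_op a F x"
    proof (rule ritz_unique[OF F(1)])
      show "c *\<^sub>C ritz_op a F x \<in> F"
        using ritz_facts[OF F] x F(1) complex_vector.subspace_scale by blast
      show "cinner (c *\<^sub>C ritz_op a F x) v = a (c *\<^sub>C x) v" if "v \<in> F" for v
        using ritz_facts[OF F] x F(3) that by (simp add: cinner_scaleC_left form_scale subset_iff)
    qed
  qed
qed (use ritz_facts[OF F] in auto)

lemma ritz_hermitian:
  assumes F: "csubspace F" "fin_dim F" "F \<subseteq> DB" and "x \<in> F" "y \<in> F"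
  shows "cinner (ritz_op a F x) y = cinner x (ritz_op a F y)"
  using ritz_facts(2)[OF F] assms(4,5) form_hermitian cinner_commute by metis

end


section \<open>Resolvents and the rational filter\<close>

lemma resolvent_props:
  assumes A: "linear_op D A" and \<zeta>: "\<zeta> \<in> res_set UNIV D A"
  shows "resolvent D A \<zeta> x \<in> D" "\<zeta> *\<^sub>C resolvent D A \<zeta> x - A (resolvent D A \<zeta> x) = x"
    "\<And>y. y \<in> D \<Longrightarrow> resolvent D A \<zeta> (\<zeta> *\<^sub>C y - A y) = y"
proof -
  have bij: "bij_betw (\<lambda>x. \<zeta> *\<^sub>C x - A x) D UNIV" using \<zeta> by (simp add: res_set_def)
  then have x: "x \<in> (\<lambda>x. \<zeta> *\<^sub>C x - A x) ` D" by (simp add: bij_betw_def)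
  show "resolvent D A \<zeta> x \<in> D" unfolding resolvent_def by (rule inv_into_into[OF x])
  show "\<zeta> *\<^sub>C resolvent D A \<zeta> x - A (resolvent D A \<zeta> x) = x"
    unfolding resolvent_def by (rule f_inv_into_f[OF x])
  show "resolvent D A \<zeta> (\<zeta> *\<^sub>C y - A y) = y" if "y \<in> D" for y
    using inv_into_f_f[OF bij_betw_imp_inj_on[OF bij] that] by (simp add: resolvent_def)
qed

lemma resolvent_clinear:
  assumes A: "linear_op D A" and \<zeta>: "\<zeta> \<in> res_set UNIV D A"
  shows "clinear (resolvent D A \<zeta>)"
  unfolding clinear_iff
proof (intro conjI allI)
  note R = resolvent_props[OF A \<zeta>]
  let ?R = "resolvent D A \<zeta>"
  have D: "csubspace D" using A by (simp add: linear_op_def)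
  fix x y c
  have "\<zeta> *\<^sub>C (?R x + ?R y) - A (?R x + ?R y) = (\<zeta> *\<^sub>C ?R x - A (?R x)) + (\<zeta> *\<^sub>C ?R y - A (?R y))"
    using A R(1) by (simp add: linear_op_def scaleC_add_right)
  then have "\<zeta> *\<^sub>C (?R x + ?R y) - A (?R x + ?R y) = x + y" by (simp only: R(2))
  then show "?R (x + y) = ?R x + ?R y"
    using R(3)[of "?R x + ?R y"] complex_vector.subspace_add[OF D R(1) R(1)] by simp
  have "\<zeta> *\<^sub>C (c *\<^sub>C ?R x) - A (c *\<^sub>C ?R x) = c *\<^sub>C (\<zeta> *\<^sub>C ?R x - A (?R x))"
    using A R(1) by (simp add: linear_op_def complex_vector.scale_right_diff_distrib complex_vector.scale_left_commute)
  then have "\<zeta> *\<^sub>C (c *\<^sub>C ?R x) - A (c *\<^sub>C ?R x) = c *\<^sub>C x" by (simp only: R(2))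
  then show "?R (c *\<^sub>C x) = c *\<^sub>C ?R x"
    using R(3)[of "c *\<^sub>C ?R x"] complex_vector.subspace_scale[OF D R(1)] by simp
qed

lemma resolvent_commute:
  assumes A: "linear_op D A" and \<zeta>: "\<zeta> \<in> res_set UNIV D A" "\<eta> \<in> res_set UNIV D A"
  shows "resolvent D A \<zeta> (resolvent D A \<eta> x) = resolvent D A \<eta> (resolvent D A \<zeta> x)"
proof -
  note R = resolvent_props[OF A \<zeta>(1)] and R' = resolvent_props[OF A \<zeta>(2)]
  have D: "csubspace D" and add: "\<And>x y. x \<in> D \<Longrightarrow> y \<in> D \<Longrightarrow> A (x + y) = A x + A y"
    and sc: "\<And>c x. x \<in> D \<Longrightarrow> A (c *\<^sub>C x) = c *\<^sub>C A x" using A by (auto simp: linear_op_def)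
  define x' where "x' = resolvent D A \<eta> x"
  define y where "y = resolvent D A \<zeta> x'"
  have x': "x' \<in> D" "\<eta> *\<^sub>C x' - A x' = x" using R' by (auto simp: x'_def)
  have y: "y \<in> D" "\<zeta> *\<^sub>C y - A y = x'" using R by (auto simp: y_def)
  define v where "v = x' + (\<eta> - \<zeta>) *\<^sub>C y"
  have v: "v \<in> D" unfolding v_def using x'(1) y(1) D complex_vector.subspace_add complex_vector.subspace_scale by blast
  have v_eq: "v = \<eta> *\<^sub>C y - A y"
    unfolding v_def y(2)[symmetric] by (simp add: complex_vector.scale_left_diff_distrib)
  have sy: "(\<eta> - \<zeta>) *\<^sub>C y \<in> D" using y(1) D complex_vector.subspace_scale by blast
  have "\<zeta> *\<^sub>C v - A v = (\<zeta> *\<^sub>C x' - A x') + (\<eta> - \<zeta>) *\<^sub>C (\<zeta> *\<^sub>C y - A y)"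
    unfolding v_def add[OF x'(1) sy] sc[OF y(1)]
    by (simp add: scaleC_add_right complex_vector.scale_right_diff_distrib complex_vector.scale_left_commute)
  also have "\<dots> = x" unfolding y(2) x'(2)[symmetric] by (simp add: complex_vector.scale_left_diff_distrib)
  finally have "resolvent D A \<zeta> x = v" using R(3)[OF v] by simp
  then show ?thesis using R'(3)[OF y(1)] v_eq by (simp add: y_def x'_def)
qed

context invariant_subspace
begin

lemma linear_op_poly_op: "linear_op X (poly_op T p)"
  using subspace
  by (auto simp: linear_op_def poly_op_def pow_add pow_scale scaleC_add_right sum.distrib
      complex_vector.scale_sum_right scaleC_scaleC mult.commute)

lemma eigenvector_exists:
  assumes "u \<in> X" "u \<noteq> 0" "p \<noteq> 0" "poly_op T p u = 0"
  obtains \<rho> y where "y \<in> X" "y \<noteq> 0" "T y = \<rho> *\<^sub>C y"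
proof -
  have "u \<in> root_span" using assms annihilated_imp_root_span by blast
  moreover have "root_span \<subseteq> {0}" if "(\<Union>\<mu>. gen_eigenvectors X T \<mu>) \<subseteq> {0}"
    using that by (intro complex_vector.span_minimal complex_vector.subspace_single_0)
  ultimately obtain \<mu> v where "v \<in> gen_eigenvectors X T \<mu>" "v \<noteq> 0" using assms(2) by blast
  from gen_eigenvector_imp_eigenvector[OF this] show thesis using that by blast
qed

end

text \<open>An eigenvector of the filtered operator yields an eigenvector of \<open>A\<close> in any subspace that the
  resolvents leave invariant: after multiplication by the denominators, the eigenvalue equation is a
  polynomial equation in the single bounded operator \<open>R(z\<^sub>0)\<close>.\<close>

lemma filter_eigenvector_imp_eigenvector:
  fixes X :: "'h::complex_inner set"
  assumes A: "linear_op D A" and z: "\<And>k. k < N \<Longrightarrow> z k \<in> res_set UNIV D A"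
    and X: "csubspace X" "\<And>k x. k < N \<Longrightarrow> x \<in> X \<Longrightarrow> resolvent D A (z k) x \<in> X"
    and x: "x \<in> X" "x \<noteq> 0" "filter_op w N (\<lambda>k. resolvent D A (z k)) x = \<mu> *\<^sub>C x" and \<mu>: "\<mu> \<noteq> w N"
  shows "\<exists>\<xi> y. y \<in> X \<and> y \<in> D \<and> y \<noteq> 0 \<and> A y = \<xi> *\<^sub>C y \<and> rat_filter w z N \<xi> = \<mu>"
proof -
  let ?R = "\<lambda>k. resolvent D A (z k)"
  note R = resolvent_props[OF A z]
  note Rl = resolvent_clinear[OF A z, THEN clinear_props(1)] resolvent_clinear[OF A z, THEN clinear_props(2)]
  have N: "N > 0"
  proof (rule ccontr)
    assume "\<not> N > 0"
    then have "(\<mu> - w N) *\<^sub>C x = 0"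
      using x(3) by (auto simp: filter_op_def complex_vector.scale_left_diff_distrib)
    then show False using \<mu> x(2) \<open>\<not> N > 0\<close> by auto
  qed
  interpret RU: invariant_subspace UNIV "?R 0"
    by (rule clinear_invariant_UNIV[OF resolvent_clinear[OF A z[OF N]]])
  define K where "K = {x \<in> X. filter_op w N ?R x = \<mu> *\<^sub>C x}"
  have filter_sum: "filter_op w N ?R (R0 u) = R0 (filter_op w N ?R u)"
    if "R0 = ?R 0" for R0 u
  proof -
    note l = resolvent_clinear[OF A z[OF N], THEN clinear_props(1)] resolvent_clinear[OF A z[OF N], THEN clinear_props(2)]
    have "?R 0 (\<Sum>k<N. w k *\<^sub>C ?R k u) = (\<Sum>k<N. w k *\<^sub>C ?R 0 (?R k u))"
      by (rule linear_op_sum[OF RU.linear]) simp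
    also have "\<dots> = (\<Sum>k<N. w k *\<^sub>C ?R k (?R 0 u))"
      using resolvent_commute[OF A z[OF N] z] by (intro sum.cong) auto
    finally show ?thesis by (simp add: that filter_op_def l)
  qed
  interpret RK: invariant_subspace K "?R 0"
  proof
    have "filter_op w N ?R (u + v) = filter_op w N ?R u + filter_op w N ?R v" for u v
      by (simp add: filter_op_def Rl scaleC_add_right sum.distrib)
    moreover have "filter_op w N ?R (c *\<^sub>C u) = c *\<^sub>C filter_op w N ?R u" for c u
      by (simp add: filter_op_def Rl scaleC_add_right complex_vector.scale_sum_right scaleC_scaleC mult.commute)
    ultimately have "csubspace K"
      using X(1) unfolding csubspace_iff K_def
      by (auto simp: scaleC_add_right complex_vector.scale_left_commute)
        (metis complex_vector.scale_zero_left complex_vector.scale_zero_right)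
    then show "linear_op K (?R 0)"
      using RU.linear by (auto simp: linear_op_def)
    show "?R 0 u \<in> K" if "u \<in> K" for u
      using that X(2)[OF N] filter_sum[OF refl, of u] RU.scale by (auto simp: K_def)
  qed
  \<comment> \<open>\<open>l k\<close> represents \<open>(z k - A) R(z 0) = 1 + (z k - z 0) R(z 0)\<close>, which turns \<open>R(z k)\<close> into \<open>R(z 0)\<close>\<close>
  define l where "l k = [:1, z k - z 0:]" for k
  define den where "den = (\<Prod>k<N. l k)"
  define cof where "cof k = (\<Prod>j\<in>{..<N} - {k}. l j)" for k
  define g where "g = smult (\<mu> - w N) den - (\<Sum>k<N. smult (w k) (cof k * [:0, 1:]))"
  have den: "den = cof k * l k" if "k < N" for k
    unfolding den_def cof_def using that by (subst prod.remove[of _ k]) auto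
  have lR: "poly_op (?R 0) (l k) (?R k u) = ?R 0 u" if k: "k < N" for k u
  proof -
    have "poly_op (?R 0) (l k) (?R k u) = ?R k u + (z k - z 0) *\<^sub>C ?R 0 (?R k u)"
      by (simp add: l_def RU.poly_op_pCons RU.zero scaleC_one RU.scale)
    also have "\<dots> = ?R 0 (z 0 *\<^sub>C ?R k u - A (?R k u)) + ?R 0 ((z k - z 0) *\<^sub>C ?R k u)"
      using R(3)[OF N R(1)[OF k]] by (simp add: RU.scale)
    also have "\<dots> = ?R 0 (z k *\<^sub>C ?R k u - A (?R k u))"
      by (simp add: RU.add[symmetric] complex_vector.scale_left_diff_distrib)
    finally show ?thesis using R(2)[OF k] by simp
  qed
  have "poly_op (?R 0) g x = 0"
  proof -
    have "(\<mu> - w N) *\<^sub>C poly_op (?R 0) den x = poly_op (?R 0) den ((\<mu> - w N) *\<^sub>C x)"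
      using RU.linear_op_poly_op by (simp add: linear_op_def)
    also have "(\<mu> - w N) *\<^sub>C x = (\<Sum>k<N. w k *\<^sub>C ?R k x)"
      using x(3) by (simp add: filter_op_def complex_vector.scale_left_diff_distrib algebra_simps)
    also have "poly_op (?R 0) den \<dots> = (\<Sum>k<N. w k *\<^sub>C poly_op (?R 0) den (?R k x))"
      by (rule linear_op_sum[OF RU.linear_op_poly_op]) simp
    also have "\<dots> = (\<Sum>k<N. w k *\<^sub>C poly_op (?R 0) (cof k * [:0, 1:]) x)"
      by (intro sum.cong refl)
        (simp only: den lessThan_iff RU.poly_op_mult[OF UNIV_I] lR, simp add: RU.poly_op_pCons RU.zero scaleC_one)
    finally show ?thesis
      unfolding g_def poly_op_diff poly_op_smult poly_op_sum by simp
  qed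
  moreover have "poly g 0 = \<mu> - w N" by (simp add: g_def den_def l_def poly_prod poly_sum)
  then have "g \<noteq> 0" using \<mu> by auto
  moreover have "x \<in> K" using x by (simp add: K_def)
  ultimately obtain \<rho> y where y: "y \<in> K" "y \<noteq> 0" "?R 0 y = \<rho> *\<^sub>C y"
    using RK.eigenvector_exists[of x g] x(2) by blast
  have D: "csubspace D" and sc: "\<And>c x. x \<in> D \<Longrightarrow> A (c *\<^sub>C x) = c *\<^sub>C A x"
    using A by (auto simp: linear_op_def)
  have A0: "A 0 = 0" using sc[of 0 0] D by (simp add: csubspace_iff)
  have \<rho>: "\<rho> \<noteq> 0" using R(2)[OF N, of y] y(2,3) A0 by auto
  have yD: "y \<in> D"
    using R(1)[OF N, of y] y(3) \<rho> complex_vector.subspace_scale[OF D, of "?R 0 y" "1 / \<rho>"]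
    by (simp add: scaleC_scaleC scaleC_one)
  define \<xi> where "\<xi> = z 0 - 1 / \<rho>"
  have "\<rho> *\<^sub>C (z 0 *\<^sub>C y - A y) = y"
    using R(2)[OF N, of y] unfolding y(3) sc[OF yD]
    by (simp add: complex_vector.scale_right_diff_distrib scaleC_scaleC mult.commute)
  then have "(1 / \<rho>) *\<^sub>C \<rho> *\<^sub>C (z 0 *\<^sub>C y - A y) = (1 / \<rho>) *\<^sub>C y" by simp
  then have "z 0 *\<^sub>C y - A y = (1 / \<rho>) *\<^sub>C y" using \<rho> by (simp add: scaleC_scaleC scaleC_one)
  then have Ay: "A y = \<xi> *\<^sub>C y" by (simp add: \<xi>_def complex_vector.scale_left_diff_distrib algebra_simps)
  have Ry: "?R k y = (1 / (z k - \<xi>)) *\<^sub>C y" if k: "k < N" for k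
  proof -
    have "z k *\<^sub>C y - A y = (z k - \<xi>) *\<^sub>C y" by (simp add: Ay complex_vector.scale_left_diff_distrib)
    then have eq: "(z k - \<xi>) *\<^sub>C ?R k y = y" using R(3)[OF k yD] Rl(2)[OF k] by simp
    then have "z k - \<xi> \<noteq> 0" using y(2) by auto
    then have "?R k y = (1 / (z k - \<xi>)) *\<^sub>C (z k - \<xi>) *\<^sub>C ?R k y" by (simp add: scaleC_scaleC scaleC_one)
    then show ?thesis unfolding eq .
  qed
  have "\<mu> *\<^sub>C y = filter_op w N ?R y" using y(1) by (simp add: K_def)
  also have "\<dots> = w N *\<^sub>C y + (\<Sum>k<N. (w k / (z k - \<xi>)) *\<^sub>C y)"
    by (simp add: filter_op_def Ry scaleC_scaleC)
  also have "\<dots> = rat_filter w z N \<xi> *\<^sub>C y"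
    by (simp add: rat_filter_def scaleC_add_left complex_vector.scale_sum_left)
  finally have "rat_filter w z N \<xi> = \<mu>" using y(2) by simp
  then show ?thesis using y(1,2) yD Ay unfolding K_def by blast
qed

lemma filter_eigenvalue:
  assumes A: "linear_op D A" and z: "\<And>k. k < N \<Longrightarrow> z k \<in> res_set UNIV D A"
    and x: "x \<in> D" "x \<noteq> 0" "A x = l *\<^sub>C x"
  shows "filter_op w N (\<lambda>k. resolvent D A (z k)) x = rat_filter w z N l *\<^sub>C x"
proof -
  have R: "resolvent D A (z k) x = (1 / (z k - l)) *\<^sub>C x" if k: "k < N" for k
  proof -
    let ?R = "resolvent D A (z k)"
    have "z k *\<^sub>C x - A x = (z k - l) *\<^sub>C x" by (simp add: x complex_vector.scale_left_diff_distrib)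
    then have eq: "(z k - l) *\<^sub>C ?R x = x"
      using resolvent_props(3)[OF A z[OF k] x(1)] clinear_props(2)[OF resolvent_clinear[OF A z[OF k]]] by simp
    then have "z k - l \<noteq> 0" using x(2) by auto
    then have "?R x = (1 / (z k - l)) *\<^sub>C (z k - l) *\<^sub>C ?R x" by (simp add: scaleC_scaleC scaleC_one)
    then show ?thesis unfolding eq .
  qed
  have "filter_op w N (\<lambda>k. resolvent D A (z k)) x = w N *\<^sub>C x + (\<Sum>k<N. (w k / (z k - l)) *\<^sub>C x)"
    by (simp add: filter_op_def R scaleC_scaleC)
  also have "\<dots> = rat_filter w z N l *\<^sub>C x"
    by (simp add: rat_filter_def scaleC_add_left complex_vector.scale_sum_left)
  finally show ?thesis .
qed

text \<open>The adjoint of the resolvent acts on \<open>e\<close> as a scalar.\<close>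

lemma resolvent_orth_eigenvector:
  assumes A: "linear_op D A" and sym: "\<And>x y. x \<in> D \<Longrightarrow> y \<in> D \<Longrightarrow> cinner (A x) y = cinner x (A y)"
    and \<zeta>: "\<zeta> \<in> res_set UNIV D A" and e: "e \<in> D" "A e = complex_of_real l *\<^sub>C e"
    and orth: "cinner x e = 0"
  shows "cinner (resolvent D A \<zeta> x) e = 0"
proof (cases "e = 0")
  case False
  let ?y = "resolvent D A \<zeta> x"
  note R = resolvent_props[OF A \<zeta>]
  have "cinner x e = \<zeta> * cinner ?y e - cinner (A ?y) e"
    by (subst R(2)[of x, symmetric]) (simp add: cinner_diff_left cinner_scaleC_left)
  also have "cinner (A ?y) e = complex_of_real l * cinner ?y e"
    using sym[OF R(1) e(1)] e(2) by (simp add: cinner_scaleC_right)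
  finally have *: "(\<zeta> - complex_of_real l) * cinner ?y e = 0" using orth by (auto simp: algebra_simps)
  have "\<zeta> \<noteq> complex_of_real l"
  proof
    assume "\<zeta> = complex_of_real l"
    then have "resolvent D A \<zeta> 0 = e" using R(3)[OF e(1)] e(2) by simp
    then show False using clinear_props(3)[OF resolvent_clinear[OF A \<zeta>]] False by simp
  qed
  then show ?thesis using * by simp
qed simp

lemma rat_filter_at_infinity: "((\<lambda>x. rat_filter w z N (complex_of_real x)) \<longlongrightarrow> w N) at_top"
proof -
  have "filterlim (\<lambda>x. z k - complex_of_real x) at_infinity at_top" for k
    by (rule tendsto_add_filterlim_at_infinity[where c = "z k" and g = "\<lambda>x. - complex_of_real x", simplified])
      (auto intro: filterlim_at_top_imp_at_infinity
        simp: filterlim_at_infinity_conv_norm_at_top filterlim_abs_real)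
  then have "((\<lambda>x. w k / (z k - complex_of_real x)) \<longlongrightarrow> 0) at_top" for k
    by (intro tendsto_divide_0[OF tendsto_const])
  then have "((\<lambda>x. w N + (\<Sum>k<N. w k / (z k - complex_of_real x))) \<longlongrightarrow> w N + (\<Sum>k<N. 0)) at_top"
    by (intro tendsto_add tendsto_const tendsto_sum)
  then show ?thesis by (simp add: rat_filter_def)
qed

text \<open>The bound on \<open>w N\<close> is the limit of the first one, since the outer set is unbounded.\<close>

lemma filter_kappa_separates:
  assumes kappa: "filter_kappa w z N y \<delta> \<gamma> < 1"
    and x: "x \<in> I_set y \<gamma>" "\<And>k. k < N \<Longrightarrow> complex_of_real x \<noteq> z k"
  shows "\<And>t. t \<in> O_set y \<delta> \<gamma> \<Longrightarrow> (\<And>k. k < N \<Longrightarrow> complex_of_real t \<noteq> z k) \<Longrightarrow>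
      cmod (rat_filter w z N (complex_of_real t)) < cmod (rat_filter w z N (complex_of_real x))"
    and "cmod (w N) < cmod (rat_filter w z N (complex_of_real x))"
proof -
  define mag where "mag t = ennreal (cmod (rat_filter w z N (complex_of_real t)))" for t
  define poles where "poles = {t. \<exists>k<N. complex_of_real t = z k}"
  define s where "s = (SUP t \<in> O_set y \<delta> \<gamma> - poles. mag t)"
  define i where "i = (INF t \<in> I_set y \<gamma> - poles. mag t)"
  have "i \<noteq> 0" "s / i < 1"
    using kappa unfolding filter_kappa_def Let_def mag_def[symmetric] poles_def[symmetric]
      s_def[symmetric] i_def[symmetric] by (auto split: if_splits)
  have "i \<le> mag x" unfolding i_def using x by (intro INF_lower) (auto simp: poles_def)
  then have "i < top" by (metis mag_def ennreal_less_top order_le_less_trans)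
  have "s < i"
  proof (rule ccontr)
    assume "\<not> s < i"
    then have "i / i \<le> s / i" by (intro divide_right_mono_ennreal) simp
    then show False using \<open>s / i < 1\<close> \<open>i \<noteq> 0\<close> \<open>i < top\<close> by (simp add: ennreal_divide_self)
  qed
  then have "s < mag x" using \<open>i \<le> mag x\<close> by simp
  then obtain r where r: "s = ennreal r" "0 \<le> r" by (cases s) (auto simp: mag_def)
  have rx: "r < cmod (rat_filter w z N (complex_of_real x))"
    using \<open>s < mag x\<close> r by (simp add: mag_def ennreal_less_iff)
  have le: "cmod (rat_filter w z N (complex_of_real t)) \<le> r"
    if "t \<in> O_set y \<delta> \<gamma>" "\<And>k. k < N \<Longrightarrow> complex_of_real t \<noteq> z k" for t
  proof -
    have "mag t \<le> s" unfolding s_def using that by (intro SUP_upper) (auto simp: poles_def)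
    then show ?thesis using r by (simp add: mag_def)
  qed
  show "cmod (rat_filter w z N (complex_of_real t)) < cmod (rat_filter w z N (complex_of_real x))"
    if "t \<in> O_set y \<delta> \<gamma>" "\<And>k. k < N \<Longrightarrow> complex_of_real t \<noteq> z k" for t
    using le[OF that] rx by simp
  \<comment> \<open>beyond \<open>T\<close> there are no poles, and all points belong to the outer set\<close>
  have "\<forall>\<^sub>F t in at_top. cmod (rat_filter w z N (complex_of_real t)) \<le> r"
  proof -
    define T where "T = \<bar>y\<bar> + \<bar>(1 + \<delta>) * \<gamma>\<bar> + (\<Sum>k<N. cmod (z k)) + 1"
    have "cmod (rat_filter w z N (complex_of_real t)) \<le> r" if t: "t \<ge> T" for t
    proof (rule le)
      have zs: "0 \<le> (\<Sum>k<N. cmod (z k))" by (intro sum_nonneg) simp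
      show "t \<in> O_set y \<delta> \<gamma>" using t zs unfolding O_set_def T_def mem_Collect_eq by linarith
      fix k assume k: "k < N"
      have "cmod (z k) \<le> (\<Sum>k<N. cmod (z k))" using k by (intro member_le_sum) auto
      then have "cmod (z k) < t" using t unfolding T_def by linarith
      then show "complex_of_real t \<noteq> z k" by (metis abs_ge_self leD norm_of_real)
    qed
    then show ?thesis unfolding eventually_at_top_linorder by blast
  qed
  from tendsto_upperbound[OF tendsto_norm[OF rat_filter_at_infinity] this]
  show "cmod (w N) < cmod (rat_filter w z N (complex_of_real x))" using rx by simp
qed

section \<open>Ritz values and the gap\<close>

lemma eigenvalue_in_spectrum:
  assumes "csubspace D" "T 0 = 0" "x \<in> D" "x \<noteq> 0" "T x = l *\<^sub>C x"
  shows "l \<in> spectrum X D T"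
proof -
  have "\<not> inj_on (\<lambda>x. l *\<^sub>C x - T x) D"
    using assms inj_onD[of "\<lambda>x. l *\<^sub>C x - T x" D x 0] by (auto simp: csubspace_iff)
  then show ?thesis by (simp add: spectrum_def res_set_def bij_betw_def)
qed

lemma oproj_eqI:
  assumes G: "orthonormal G" and p: "p \<in> cspan G" "\<And>e. e \<in> cspan G \<Longrightarrow> cinner (x - p) e = 0"
  shows "oproj G x = p"
proof -
  have "oproj G (x - p) = 0" using p(2) by (rule oproj_eq_0)
  then show ?thesis using oproj_ident[OF G p(1)] by (simp add: oproj_diff)
qed

lemma norm_residual_le_gap:
  assumes G: "orthonormal G" and X: "csubspace X" and u: "u \<in> X"
  shows "norm (u - oproj G u) \<le> gap (cspan G) X * norm u"
proof (cases "u = 0")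
  case True
  then show ?thesis by (simp add: oproj_def)
next
  case False
  define c where "c = complex_of_real (1 / norm u)"
  have c: "cmod c = 1 / norm u" unfolding c_def norm_of_real by simp
  define v where "v = c *\<^sub>C u"
  have v: "v \<in> {x \<in> X. norm x = 1}" using X u False by (simp add: v_def csubspace_iff norm_scaleC c)
  have "infdist x (cspan G) \<le> 1" if "norm x = 1" for x
    using infdist_le[OF complex_vector.span_zero[of G], of x] that by (simp add: dist_norm)
  then have "bdd_above ((\<lambda>x. infdist x (cspan G)) ` {x \<in> X. norm x = 1})"
    by (intro bdd_aboveI2[where M = 1]) auto
  then have "infdist v (cspan G) \<le> (SUP x \<in> {x \<in> X. norm x = 1}. infdist x (cspan G))"
    using v by (intro cSUP_upper)
  also have "\<dots> \<le> gap (cspan G) X" by (simp add: gap_def)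
  finally have "norm (v - oproj G v) \<le> gap (cspan G) X" by (simp add: infdist_cspan[OF G])
  moreover have eq: "v - oproj G v = c *\<^sub>C (u - oproj G u)"
    by (simp add: v_def oproj_scaleC complex_vector.scale_right_diff_distrib)
  ultimately have "1 / norm u * norm (u - oproj G u) \<le> gap (cspan G) X" by (simp only: norm_scaleC c)
  then show ?thesis using False by (simp add: field_simps)
qed

lemma gap_le:
  assumes G: "orthonormal G" and X: "csubspace X" and e: "e \<in> cspan G" "e \<noteq> 0" and \<epsilon>: "\<epsilon> < 1"
    and 1: "\<And>x. x \<in> cspan G \<Longrightarrow> \<exists>y\<in>X. norm (x - y) \<le> \<epsilon> * norm x"
    and 2: "\<And>x. x \<in> X \<Longrightarrow> norm (x - oproj G x) \<le> \<epsilon> * norm x"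
  shows "gap (cspan G) X \<le> \<epsilon>"
proof -
  have unit: "{x \<in> Y. norm x = 1} \<noteq> {}" if "csubspace Y" "e \<in> Y" "e \<noteq> 0" for Y and e :: 'a
  proof -
    have "complex_of_real (1 / norm e) *\<^sub>C e \<in> Y" using that by (simp only: csubspace_iff)
    moreover have "cmod (complex_of_real (1 / norm e)) = 1 / norm e" unfolding norm_of_real by simp
    then have "norm (complex_of_real (1 / norm e) *\<^sub>C e) = 1" using that by (simp only: norm_scaleC) simp
    ultimately show ?thesis by blast
  qed
  obtain y where y: "y \<in> X" "norm (e - y) \<le> \<epsilon> * norm e" using 1[OF e(1)] by blast
  have "y \<noteq> 0"
  proof
    assume "y = 0"
    then have "1 * norm e \<le> \<epsilon> * norm e" using y by simp
    then show False using e(2) \<epsilon> by (simp add: mult_le_cancel_right)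
  qed
  have "infdist x X \<le> \<epsilon>" if "x \<in> cspan G" "norm x = 1" for x
    using 1[OF that(1)] that(2) by (auto simp: dist_norm intro: infdist_le2)
  then have "(SUP x \<in> {x \<in> cspan G. norm x = 1}. infdist x X) \<le> \<epsilon>"
    using unit[OF complex_vector.subspace_span e] by (intro cSUP_least) auto
  moreover have "(SUP x \<in> {x \<in> X. norm x = 1}. infdist x (cspan G)) \<le> \<epsilon>"
    using unit[OF X y(1) \<open>y \<noteq> 0\<close>] 2 by (intro cSUP_least) (auto simp: infdist_cspan[OF G] dest: 2)
  ultimately show ?thesis by (simp add: gap_def)
qed

lemma hausdorff_dist_le:
  assumes "X \<noteq> {}" "Y \<noteq> {}" "\<And>x. x \<in> X \<Longrightarrow> \<exists>y\<in>Y. cmod (x - y) \<le> c" "\<And>y. y \<in> Y \<Longrightarrow> \<exists>x\<in>X. cmod (y - x) \<le> c"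
  shows "hausdorff_dist X Y \<le> c"
proof -
  have "infdist x Y \<le> c" if "x \<in> X" for x
    using assms(3)[OF that] by (auto simp: dist_norm intro: infdist_le2)
  moreover have "infdist y X \<le> c" if "y \<in> Y" for y
    using assms(4)[OF that] by (auto simp: dist_norm intro: infdist_le2)
  ultimately show ?thesis
    unfolding hausdorff_dist_def using assms(1,2) by (intro max.boundedI cSUP_least)
qed

context form_setting
begin

lemma A_add: "x \<in> D \<Longrightarrow> y \<in> D \<Longrightarrow> A (x + y) = A x + A y"
  and A_scale: "x \<in> D \<Longrightarrow> A (c *\<^sub>C x) = c *\<^sub>C A x"
  using A_linear by (auto simp: linear_op_def)

lemma A_zero: "A 0 = 0"
  using A_scale[of 0 0] D_subspace by (simp add: csubspace_iff)

lemma B_zero: "B 0 = 0"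
  using B_scale[of 0 0] DB_subspace by (simp add: csubspace_iff)

lemma eigenspace_subspace: "csubspace (eigenspace D A l)"
  using A_linear D_subspace
  by (auto simp: csubspace_iff eigenspace_def linear_op_def scaleC_add_right complex_vector.scale_left_commute)
    (metis complex_vector.scale_zero_left complex_vector.scale_zero_right)

end

text \<open>Excluding the eigenvalue \<open>0\<close> makes the energy norm a norm on \<open>E\<close>.\<close>

locale cluster_setting = form_setting D A U DP P DB B
  for D :: "'h::complex_inner set" and A U DP P DB B +
  fixes \<Lambda> :: "complex set" and E :: "'h set"
  assumes real: "l \<in> \<Lambda> \<Longrightarrow> \<exists>r. l = complex_of_real r" and nonzero: "0 \<notin> \<Lambda>"
    and eigen: "l \<in> \<Lambda> \<Longrightarrow> eigenspace D A l \<noteq> {0}" and nonempty: "\<Lambda> \<noteq> {}"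
    and E_eq: "E = cspan (\<Union>l\<in>\<Lambda>. eigenspace D A l)" and E_fin: "fin_dim E"
begin

lemma D_subset_DB: "D \<subseteq> DB"
  using B_facts(4) by blast

lemma E_subspace: "csubspace E"
  unfolding E_eq by (rule complex_vector.subspace_span)

lemma E_subset: "E \<subseteq> D"
  unfolding E_eq by (intro complex_vector.span_minimal D_subspace) (auto simp: eigenspace_def)

lemma eigenspaceE:
  assumes "l \<in> \<Lambda>" "x \<in> eigenspace D A l"
  obtains r where "l = complex_of_real r" "r \<noteq> 0" "x \<in> D" "A x = complex_of_real r *\<^sub>C x"
proof -
  obtain r where r: "l = complex_of_real r" using real[OF assms(1)] by blast
  then have "r \<noteq> 0" using assms(1) nonzero by auto
  then show thesis using that r assms(2) by (simp add: eigenspace_def)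
qed

text \<open>Span induction in which all vectors under consideration are known to lie in \<open>E\<close>, hence in the
  domains of \<open>A\<close> and \<open>B\<close>.\<close>

lemma cluster_induct [consumes 1, case_names base add scale eigen]:
  assumes "x \<in> E" and z: "Q 0" and add: "\<And>x y. x \<in> E \<Longrightarrow> y \<in> E \<Longrightarrow> Q x \<Longrightarrow> Q y \<Longrightarrow> Q (x + y)"
    and scale: "\<And>c x. x \<in> E \<Longrightarrow> Q x \<Longrightarrow> Q (c *\<^sub>C x)"
    and eig: "\<And>r x. x \<in> E \<Longrightarrow> x \<in> D \<Longrightarrow> r \<noteq> 0 \<Longrightarrow> A x = complex_of_real r *\<^sub>C x \<Longrightarrow> Q x"
  shows "Q x"
proof -
  have "x \<in> E \<and> Q x"
    using assms(1) unfolding E_eq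
  proof (induction rule: complex_vector.span_induct)
    case base
    show ?case using z add scale E_subspace unfolding E_eq[symmetric]
      by (auto simp: csubspace_iff)
  next
    case (step x)
    then obtain l where l: "l \<in> \<Lambda>" "x \<in> eigenspace D A l" by blast
    then have "x \<in> E" unfolding E_eq by (intro complex_vector.span_base) blast
    then show ?case using eig eigenspaceE[OF l] unfolding E_eq by metis
  qed
  then show ?thesis by blast
qed

lemma A_maps: "x \<in> E \<Longrightarrow> A x \<in> E"
proof (induction rule: cluster_induct)
  case base then show ?case using A_zero complex_vector.subspace_0[OF E_subspace] by simp
next
  case (add x y) then show ?case
    using A_add[of x y] subsetD[OF E_subset] complex_vector.subspace_add[OF E_subspace, of "A x" "A y"]
    by auto
next
  case (scale c x) then show ?case
    using A_scale[of x c] E_subset complex_vector.subspace_scale[OF E_subspace, of "A x" c] by auto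
next
  case (eigen r x) then show ?case using complex_vector.subspace_scale[OF E_subspace] by auto
qed

lemma form_cluster: "x \<in> E \<Longrightarrow> y \<in> DB \<Longrightarrow> form_of U B x y = cinner (A x) y"
proof (induction rule: cluster_induct)
  case base then show ?case
    by (simp add: form_of_def B_zero A_zero clinear_props[OF U_clinear])
next
  case (add u v)
  have "u \<in> D" "v \<in> D" "u \<in> DB" "v \<in> DB" using add E_subset D_subset_DB by auto
  then show ?case using add by (simp add: form_add A_add cinner_add_left)
next
  case (scale c u)
  have "u \<in> D" "u \<in> DB" using scale E_subset D_subset_DB by auto
  then show ?case using scale by (simp add: form_scale A_scale cinner_scaleC_left)
next
  case (eigen r u) then show ?case using form_eigenvector(1)[of u r y] by simp
qed

lemma energy_orth:
  assumes x: "x \<in> DB"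
  shows "(\<forall>e\<in>E. cinner (B e) (B x) = 0) \<longleftrightarrow> (\<forall>e\<in>E. cinner e x = 0)"
proof
  assume orth: "\<forall>e\<in>E. cinner (B e) (B x) = 0"
  have "e \<in> E \<Longrightarrow> cinner e x = 0" for e
  proof (induction rule: cluster_induct)
    case (eigen r e)
    then show ?case using orth form_eigenvector(2)[OF eigen(2,4,3) x] by auto
  qed (simp_all add: cinner_add_left cinner_scaleC_left)
  then show "\<forall>e\<in>E. cinner e x = 0" by blast
next
  assume orth: "\<forall>e\<in>E. cinner e x = 0"
  have "e \<in> E \<Longrightarrow> cinner (B e) (B x) = 0" for e
  proof (induction rule: cluster_induct)
    case base then show ?case by (simp add: B_zero)
  next
    case (add u v)
    have "u \<in> DB" "v \<in> DB" using add E_subset D_subset_DB by auto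
    then show ?case using add by (simp add: B_add cinner_add_left)
  next
    case (scale c u)
    have "u \<in> DB" using scale E_subset D_subset_DB by auto
    then show ?case using scale by (simp add: B_scale cinner_scaleC_left)
  next
    case (eigen r e)
    then show ?case using orth form_eigenvector(2)[OF eigen(2,4,3) x] by auto
  qed
  then show "\<forall>e\<in>E. cinner (B e) (B x) = 0" by blast
qed

lemma ritz_cluster: "x \<in> E \<Longrightarrow> ritz_op (form_of U B) E x = A x"
  using form_cluster E_subset D_subset_DB by (intro ritz_unique[OF E_subspace] A_maps) auto

definition A_norm :: real where
  "A_norm = subspace_onorm E (ritz_op (form_of U B) E)"

lemma A_norm_bound: "x \<in> E \<Longrightarrow> norm (A x) \<le> A_norm * norm x"
proof -
  assume x: "x \<in> E"
  have "linear_op E A" using A_add A_scale E_subspace E_subset[THEN subsetD] by (auto simp: linear_op_def)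
  then obtain K where K: "\<And>x. x \<in> E \<Longrightarrow> norm (A x) \<le> K * norm x"
    using linear_op_fin_dim_bounded[OF E_fin] by blast
  have le: "norm (A v) \<le> A_norm" if v: "v \<in> E" "norm v = 1" for v
  proof -
    have "norm (ritz_op (form_of U B) E v) \<le> A_norm"
      unfolding A_norm_def subspace_onorm_def
    proof (rule cSUP_upper)
      show "bdd_above ((\<lambda>x. norm (ritz_op (form_of U B) E x)) ` {x \<in> E. norm x = 1})"
        using K ritz_cluster by (intro bdd_aboveI2[where M = K]) force
    qed (use v in simp)
    then show ?thesis using ritz_cluster v by simp
  qed
  show ?thesis
  proof (cases "x = 0")
    case True then show ?thesis by (simp add: A_zero)
  next
    case False
    define c where "c = complex_of_real (1 / norm x)"
    have c: "cmod c = 1 / norm x" unfolding c_def norm_of_real by simp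
    have "norm (A (c *\<^sub>C x)) \<le> A_norm"
      using x False complex_vector.subspace_scale[OF E_subspace x] by (intro le) (auto simp: norm_scaleC c)
    then show ?thesis using A_scale x E_subset False by (simp add: norm_scaleC c field_simps subset_iff)
  qed
qed

lemma eigenvalue_le_A_norm:
  assumes "l \<in> \<Lambda>" shows "cmod l \<le> A_norm"
proof -
  obtain x where x: "x \<in> eigenspace D A l" "x \<noteq> 0"
    using eigen[OF assms] complex_vector.subspace_0[OF eigenspace_subspace] by blast
  then have "x \<in> E" using assms unfolding E_eq by (intro complex_vector.span_base) blast
  then have "cmod l * norm x \<le> A_norm * norm x"
    using A_norm_bound[of x] x(1) by (simp add: eigenspace_def norm_scaleC)
  then show ?thesis using x(2) by (simp add: mult_le_cancel_right)
qed

lemma A_norm_pos: "A_norm > 0"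
proof -
  obtain l where "l \<in> \<Lambda>" using nonempty by blast
  moreover from this have "l \<noteq> 0" using nonzero by blast
  ultimately show ?thesis using eigenvalue_le_A_norm by (metis norm_le_zero_iff not_less order_trans)
qed

lemma norm_B_cluster_le: "x \<in> E \<Longrightarrow> norm (B x) \<le> root 2 A_norm * norm x"
proof -
  assume x: "x \<in> E"
  have "(norm (B x))\<^sup>2 \<le> norm (A x) * norm x" using norm_B_square_le x E_subset by blast
  also have "\<dots> \<le> A_norm * norm x * norm x" using A_norm_bound[OF x] by (rule mult_right_mono) simp
  also have "\<dots> = (root 2 A_norm * norm x)\<^sup>2"
    using A_norm_pos by (simp add: power_mult_distrib) (simp add: power2_eq_square)
  finally show ?thesis by (rule power2_le_imp_le) (use A_norm_pos in simp)
qed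

text \<open>The orthogonal projection \<open>Q\<close> onto \<open>E\<close> splits both the inner product and the form, because
  \<open>E\<close> is spanned by eigenvectors.\<close>

context
  fixes G :: "'h set" and X :: "'h set"
  assumes G: "orthonormal G" "cspan G = E" and X: "csubspace X" "X \<subseteq> DB"
begin

lemma residual_orth: "e \<in> E \<Longrightarrow> cinner (u - oproj G u) e = 0" "e \<in> E \<Longrightarrow> cinner e (u - oproj G u) = 0"
  using oproj_residual_orth[OF G(1), of e u] G(2) cinner_eq_0_commute by auto

lemma proj_in: "oproj G u \<in> E" "oproj G u \<in> D" "oproj G u \<in> DB"
  using oproj_in_span[of G u] G(2) E_subset D_subset_DB by auto

lemma residual_in: "u \<in> X \<Longrightarrow> u - oproj G u \<in> DB"
  using X(2) proj_in(3) complex_vector.subspace_diff[OF DB_subspace] by blast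

lemma cinner_split:
  "cinner u v = cinner (oproj G u) (oproj G v) + cinner (u - oproj G u) (v - oproj G v)"
proof -
  have "cinner u v = cinner (oproj G u + (u - oproj G u)) (oproj G v + (v - oproj G v))" by simp
  also have "\<dots> = cinner (oproj G u) (oproj G v) + cinner (u - oproj G u) (v - oproj G v)"
    unfolding cinner_add_left cinner_add_right
    using residual_orth(1)[OF proj_in(1), of u v] residual_orth(2)[OF proj_in(1), of u v] by simp
  finally show ?thesis .
qed

lemma form_split:
  assumes "u \<in> X" "v \<in> X"
  shows "form_of U B u v
    = cinner (A (oproj G u)) (oproj G v) + form_of U B (u - oproj G u) (v - oproj G v)"
proof -
  note in' = residual_in[OF assms(1)] residual_in[OF assms(2)]
  have z1: "form_of U B (oproj G u) (v - oproj G v) = 0"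
    using form_cluster[OF proj_in(1) in'(2)] residual_orth(2)[OF A_maps[OF proj_in(1)]] by simp
  have "form_of U B (oproj G v) (u - oproj G u) = 0"
    using form_cluster[OF proj_in(1) in'(1)] residual_orth(2)[OF A_maps[OF proj_in(1)]] by simp
  then have z2: "form_of U B (u - oproj G u) (oproj G v) = 0" by (metis form_hermitian complex_cnj_zero)
  have "form_of U B u v
      = form_of U B (oproj G u + (u - oproj G u)) (oproj G v + (v - oproj G v))" by simp
  also have "\<dots> = form_of U B (oproj G u) (oproj G v) + form_of U B (u - oproj G u) (v - oproj G v)"
    using in' proj_in(3) z1 z2 complex_vector.subspace_add[OF DB_subspace]
    by (simp only: form_add) simp
  finally show ?thesis using form_cluster[OF proj_in(1) proj_in(3)] by simp
qed

text \<open>The projection is the same for both norms: its residual is at most \<open>g\<close> times the energy norm of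
  \<open>u\<close>, and \<open>Q u\<close>, which is shorter than \<open>u\<close> in \<open>H\<close>, has energy controlled by the norm of \<open>A\<close> on \<open>E\<close>.\<close>

lemma norm_B_le:
  assumes g: "0 \<le> g" "g < 1" and u: "u \<in> X" "norm (B (u - oproj G u)) \<le> g * norm (B u)"
  shows "norm (B u) \<le> 1 / (1 - g) * root 2 A_norm * norm u"
proof -
  have "B u = B (oproj G u) + B (u - oproj G u)"
    using B_add[OF proj_in(3) residual_in[OF u(1)], of u] by simp
  then have "norm (B u) \<le> norm (B (oproj G u)) + norm (B (u - oproj G u))"
    by (metis norm_triangle_ineq)
  also have "norm (B (oproj G u)) \<le> root 2 A_norm * norm u"
    using norm_B_cluster_le[OF proj_in(1), of u] norm_oproj_le(1)[OF G(1), of u] A_norm_pos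
    by (meson mult_left_mono order_trans real_root_ge_zero less_imp_le)
  finally have "(1 - g) * norm (B u) \<le> root 2 A_norm * norm u" using u(2) by (simp add: algebra_simps)
  then show ?thesis using g by (simp add: field_simps)
qed

text \<open>\<open>Q\<close> maps \<open>X\<close> bijectively onto \<open>E\<close>.\<close>

lemma ritz_space_fin_dim:
  assumes t: "t < 1" "\<And>u. u \<in> X \<Longrightarrow> norm (u - oproj G u) \<le> t * norm u"
    and surj: "\<And>e. e \<in> E \<Longrightarrow> \<exists>u\<in>X. oproj G u = e"
  shows "fin_dim X"
proof -
  have "\<forall>e\<in>G. \<exists>u\<in>X. oproj G u = e" using surj G(2) complex_vector.span_base by blast
  then obtain f where f: "\<And>e. e \<in> G \<Longrightarrow> f e \<in> X \<and> oproj G (f e) = e" by metis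
  have "X \<subseteq> cspan (f ` G)"
  proof
    fix u assume u: "u \<in> X"
    define v where "v = (\<Sum>e\<in>G. cinner u e *\<^sub>C f e)"
    have vX: "v \<in> X" unfolding v_def using X(1) f
      by (intro complex_vector.subspace_sum complex_vector.subspace_scale) auto
    have lin: "linear_op UNIV (oproj G)" by (auto simp: linear_op_def oproj_add oproj_scaleC csubspace_iff)
    have "oproj G v = (\<Sum>e\<in>G. cinner u e *\<^sub>C oproj G (f e))"
      unfolding v_def by (rule linear_op_sum[OF lin]) simp
    also have "\<dots> = oproj G u" unfolding oproj_def[of G u] using f by (intro sum.cong) auto
    finally have "oproj G (u - v) = 0" by (simp add: oproj_diff)
    then have "norm (u - v) \<le> t * norm (u - v)"
      using t(2)[of "u - v"] u vX complex_vector.subspace_diff[OF X(1)] by simp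
    then have "1 * norm (u - v) \<le> t * norm (u - v)" by simp
    then have "u = v" using t(1) by (simp only: mult_le_cancel_right) auto
    moreover have "v \<in> cspan (f ` G)" unfolding v_def
      by (intro complex_vector.span_sum complex_vector.span_scale complex_vector.span_base) auto
    ultimately show "u \<in> cspan (f ` G)" by simp
  qed
  moreover have "cspan (f ` G) \<subseteq> X" using f X(1) by (intro complex_vector.span_minimal) auto
  ultimately have "cspan (f ` G) = X" by blast
  moreover have "finite (f ` G)" using G(1) by (simp add: orthonormal_def)
  ultimately show ?thesis unfolding fin_dim_def by blast
qed

text \<open>Both directions compare residuals. For \<open>u, v\<close> in \<open>X\<close>, splitting \<open>u\<close> and \<open>v\<close> along \<open>E\<close> shows that
  \<open>a(u, v) - \<mu> (u, v)\<close> equals \<open>((A - \<mu>) Q u, Q v)\<close> up to products of two residuals, which are bounded by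
  \<open>(L\<^sup>2 g\<^sup>2 + |\<mu>| t\<^sup>2) \<parallel>u\<parallel> \<parallel>v\<parallel>\<close>, \<open>L\<close> being \<open>Lambda_max B X\<close>. If \<open>Q u\<close> is an eigenvector for \<open>\<mu>\<close>, then \<open>v = (T - \<mu>) u\<close> gives a small residual of the
  Ritz operator \<open>T\<close>; if \<open>u\<close> is a Ritz vector for \<open>\<mu>\<close>, the \<open>v\<close> with \<open>Q v = (A - \<mu>) Q u\<close> gives a small
  residual of \<open>A\<close>. Passing between \<open>u\<close> and \<open>Q u\<close> costs a factor \<open>1 / (1 - t\<^sup>2)\<close>, whose effect is of order
  \<open>t\<^sup>2\<close> and is absorbed by the second summand.\<close>

lemma ritz_estimate:
  assumes g: "0 \<le> g" "g \<le> 1 / 2" "\<And>u. u \<in> X \<Longrightarrow> norm (B (u - oproj G u)) \<le> g * norm (B u)"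
    and t: "0 \<le> t" "t\<^sup>2 \<le> 1 / 2" "\<And>u. u \<in> X \<Longrightarrow> norm (u - oproj G u) \<le> t * norm u"
    and surj: "\<And>e. e \<in> E \<Longrightarrow> \<exists>u\<in>X. oproj G u = e"
  shows "(Lambda_max B X)\<^sup>2 \<le> (1 / (1 - g))\<^sup>2 * A_norm"
    "hausdorff_dist \<Lambda> (spectrum X X (ritz_op (form_of U B) X))
      \<le> (Lambda_max B X)\<^sup>2 * g\<^sup>2 + 10 * A_norm * t\<^sup>2"
proof -
  define L where "L = Lambda_max B X"
  define n where "n = A_norm"
  have n: "n > 0" using A_norm_pos by (simp add: n_def)
  have t1: "t < 1"
  proof (rule ccontr)
    assume "\<not> t < 1"
    then have "1 \<le> t\<^sup>2" by (simp add: one_le_power)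
    then show False using t(2) by simp
  qed
  have fd: "fin_dim X" by (rule ritz_space_fin_dim[OF t1 t(3) surj])
  let ?T = "ritz_op (form_of U B) X"
  interpret T: invariant_subspace X ?T by (rule ritz_invariant[OF X(1) fd X(2)])
  note Tf = ritz_facts[OF X(1) fd X(2)]
  have bound: "norm (B u) \<le> (1 / (1 - g) * root 2 n) * norm u" if "u \<in> X" for u
    unfolding n_def using norm_B_le[of g u] g that by simp
  have K0: "0 \<le> 1 / (1 - g) * root 2 n" using g n by simp
  obtain l0 x0 where l0: "l0 \<in> \<Lambda>" "x0 \<in> eigenspace D A l0" "x0 \<noteq> 0"
    using nonempty eigen complex_vector.subspace_0[OF eigenspace_subspace] by blast
  have eig_E: "x \<in> E" if "l \<in> \<Lambda>" "x \<in> eigenspace D A l" for l x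
    using that unfolding E_eq by (intro complex_vector.span_base) blast
  have proj0: "oproj G 0 = 0" by (simp add: oproj_def)
  obtain u0 where u0: "u0 \<in> X" "u0 \<noteq> 0" using surj[OF eig_E[OF l0(1,2)]] l0(3) proj0 by metis
  have bdd: "bdd_above ((\<lambda>e. norm (B e) / norm e) ` (X - {0}))"
    using bound by (intro bdd_aboveI2[where M = "1 / (1 - g) * root 2 n"]) (auto simp: divide_le_eq)
  have L_le: "L \<le> 1 / (1 - g) * root 2 n"
    unfolding L_def Lambda_max_def using u0 bound by (intro cSUP_least) (auto simp: divide_le_eq)
  have BL: "norm (B u) \<le> L * norm u" if u: "u \<in> X" for u
  proof (cases "u = 0")
    case False
    then have "norm (B u) / norm u \<le> L"
      unfolding L_def Lambda_max_def using u by (intro cSUP_upper bdd) auto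
    then show ?thesis using False by (simp add: divide_le_eq)
  qed (simp add: B_zero)
  have L0: "0 \<le> L" using BL[OF u0(1)] u0(2) by (metis norm_ge_zero order_trans zero_le_mult_iff norm_le_zero_iff)
  have "L\<^sup>2 \<le> (1 / (1 - g) * root 2 n)\<^sup>2" using L_le L0 by (rule power_mono)
  also have "\<dots> = (1 / (1 - g))\<^sup>2 * n" using n by (simp add: power_mult_distrib power_divide)
  finally have L2: "L\<^sup>2 \<le> (1 / (1 - g))\<^sup>2 * n" .
  then show "(Lambda_max B X)\<^sup>2 \<le> (1 / (1 - g))\<^sup>2 * A_norm" by (simp add: L_def n_def)
  have "1 / (1 - g) \<le> 2" using g by (simp add: field_simps)
  then have "(1 / (1 - g))\<^sup>2 \<le> 2\<^sup>2" using g by (intro power_mono) auto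
  then have "(1 / (1 - g))\<^sup>2 * n \<le> 4 * n" using n by (intro mult_right_mono) auto
  with L2 have L4: "L\<^sup>2 \<le> 4 * n" by simp
  have "g\<^sup>2 \<le> (1 / 2)\<^sup>2" using g by (intro power_mono) auto
  then have g4: "g\<^sup>2 \<le> 1 / 4" by (simp add: power_divide)
  define \<rho> where "\<rho> = L\<^sup>2 * g\<^sup>2 + 10 * n * t\<^sup>2"
  have form_res: "cmod (form_of U B (u - oproj G u) (v - oproj G v)) \<le> L\<^sup>2 * g\<^sup>2 * (norm u * norm v)"
    if "u \<in> X" "v \<in> X" for u v
  proof -
    have gL: "norm (B (u - oproj G u)) \<le> g * (L * norm u)" if "u \<in> X" for u
      using g(3)[OF that] mult_left_mono[OF BL[OF that] g(1)] by simp
    have "cmod (form_of U B (u - oproj G u) (v - oproj G v))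
        \<le> norm (B (u - oproj G u)) * norm (B (v - oproj G v))" by (rule form_bound)
    also have "\<dots> \<le> (g * (L * norm u)) * (g * (L * norm v))"
      using gL that g(1) L0 by (intro mult_mono) auto
    finally show ?thesis by (simp add: power2_eq_square mult_ac)
  qed
  have inner_res: "cmod (cinner (u - oproj G u) (v - oproj G v)) \<le> t\<^sup>2 * (norm u * norm v)"
    if "u \<in> X" "v \<in> X" for u v
  proof -
    have "cmod (cinner (u - oproj G u) (v - oproj G v)) \<le> norm (u - oproj G u) * norm (v - oproj G v)"
      by (rule cinner_Cauchy_Schwarz)
    also have "\<dots> \<le> (t * norm u) * (t * norm v)" using t that by (intro mult_mono) auto
    finally show ?thesis by (simp add: power2_eq_square mult_ac)
  qed
  have eq_self: "cmod (cinner x x) = (norm x)\<^sup>2" for x :: 'h by (simp add: cinner_self_norm norm_power)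
  have near1: "\<exists>lh\<in>spectrum X X ?T. cmod (l - lh) \<le> \<rho>" if l: "l \<in> \<Lambda>" for l
  proof -
    obtain e where e: "e \<in> eigenspace D A l" "e \<noteq> 0"
      using eigen[OF l] complex_vector.subspace_0[OF eigenspace_subspace] by blast
    obtain u where u: "u \<in> X" "oproj G u = e" using surj[OF eig_E[OF l e(1)]] by blast
    have u_nz: "u \<noteq> 0" using u(2) e(2) proj0 by auto
    define v where "v = ?T u - l *\<^sub>C u"
    have v: "v \<in> X" unfolding v_def using u T.in_X T.maps by auto
    have Ae: "A e = l *\<^sub>C e" using e by (simp add: eigenspace_def)
    have "cinner v v = cinner (?T u - l *\<^sub>C u) v" by (simp add: v_def)
    also have "\<dots> = form_of U B u v - l * cinner u v"
      using Tf(2)[OF u(1) v] by (simp add: cinner_diff_left cinner_scaleC_left)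
    also have "\<dots> = form_of U B (u - oproj G u) (v - oproj G v)
        - l * cinner (u - oproj G u) (v - oproj G v)"
      using form_split[OF u(1) v] cinner_split[of u v]
      by (simp add: u(2) Ae cinner_scaleC_left distrib_left)
    finally have "(norm v)\<^sup>2 \<le> cmod (form_of U B (u - oproj G u) (v - oproj G v))
        + cmod l * cmod (cinner (u - oproj G u) (v - oproj G v))"
      using eq_self[of v] norm_triangle_ineq4 by (metis norm_mult)
    also have "\<dots> \<le> L\<^sup>2 * g\<^sup>2 * (norm u * norm v) + n * (t\<^sup>2 * (norm u * norm v))"
      using form_res[OF u(1) v] inner_res[OF u(1) v] eigenvalue_le_A_norm[OF l] n
      by (intro add_mono mult_mono) (auto simp: n_def)
    also have "\<dots> = ((L\<^sup>2 * g\<^sup>2 + n * t\<^sup>2) * norm u) * norm v" by (simp add: algebra_simps)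
    finally have "norm v * norm v \<le> ((L\<^sup>2 * g\<^sup>2 + n * t\<^sup>2) * norm u) * norm v" by (simp add: power2_eq_square)
    moreover have "0 \<le> (L\<^sup>2 * g\<^sup>2 + n * t\<^sup>2) * norm u" using n by simp
    ultimately have "norm v \<le> (L\<^sup>2 * g\<^sup>2 + n * t\<^sup>2) * norm u"
      by (cases "norm v = 0") (auto simp: mult_le_cancel_right)
    also have "\<dots> \<le> \<rho> * norm u" unfolding \<rho>_def using n by (intro mult_right_mono add_left_mono) auto
    finally obtain lh x where "cmod (lh - l) \<le> \<rho>" "x \<in> X" "x \<noteq> 0" "?T x = lh *\<^sub>C x"
      using T.hermitian_eigenvalue_near_residual[OF fd ritz_hermitian[OF X(1) fd X(2)] u(1) u_nz, of l \<rho>]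
      by (auto simp: v_def)
    then show ?thesis
      using eigenvalue_in_spectrum[where T = "?T", OF X(1) T.zero] by (intro bexI[of _ lh]) (auto simp: norm_minus_commute)
  qed
  have near2: "\<exists>l\<in>\<Lambda>. cmod (lh - l) \<le> \<rho>" if lh: "lh \<in> spectrum X X ?T" for lh
  proof -
    obtain u where u: "u \<in> X" "u \<noteq> 0" "?T u = lh *\<^sub>C u"
      using T.fin_dim_non_eigenvalue_res_set[OF fd, of lh] lh by (auto simp: spectrum_def)
    define e where "e = oproj G u"
    define f where "f = A e - lh *\<^sub>C e"
    have eE: "e \<in> E" unfolding e_def by (rule proj_in)
    have fE: "f \<in> E" unfolding f_def
      using complex_vector.subspace_diff[OF E_subspace A_maps[OF eE] complex_vector.subspace_scale[OF E_subspace eE]] .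
    obtain v where v: "v \<in> X" "oproj G v = f" using surj[OF fE] by blast
    have norm_proj: "(1 - t\<^sup>2) * (norm u)\<^sup>2 \<le> (norm (oproj G u))\<^sup>2" if "u \<in> X" for u
    proof -
      have "(norm (u - oproj G u))\<^sup>2 \<le> (t * norm u)\<^sup>2" using t(3)[OF that] by (intro power_mono) auto
      then show ?thesis using norm_oproj_square[OF G(1), of u] by (simp add: power_mult_distrib algebra_simps)
    qed
    have lh_u: "lh * cinner u u = form_of U B u u"
      using Tf(2)[OF u(1) u(1)] u(3) by (simp add: cinner_scaleC_left)
    have "cmod lh * (norm u)\<^sup>2 \<le> norm (B u) * norm (B u)"
      using form_bound[of u u] unfolding lh_u[symmetric] norm_mult eq_self .
    also have "\<dots> \<le> (L * norm u) * (L * norm u)" using BL[OF u(1)] L0 by (intro mult_mono) auto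
    also have "\<dots> = L\<^sup>2 * (norm u)\<^sup>2" by (simp add: power2_eq_square)
    finally have lhL: "cmod lh \<le> L\<^sup>2" using u(2) by (simp add: mult_le_cancel_right)
    have "cinner f f = (cinner (A e) f - lh * cinner e f)"
      by (subst (1) f_def) (simp add: cinner_diff_left cinner_scaleC_left)
    also have "\<dots> = lh * cinner (u - oproj G u) (v - oproj G v)
        - form_of U B (u - oproj G u) (v - oproj G v)"
      using form_split[OF u(1) v(1)] cinner_split[of u v] Tf(2)[OF u(1) v(1)]
      by (simp add: v(2) e_def[symmetric] u(3) cinner_scaleC_left distrib_left)
        (simp add: algebra_simps)
    finally have "(norm f)\<^sup>2 \<le> cmod lh * cmod (cinner (u - oproj G u) (v - oproj G v))
        + cmod (form_of U B (u - oproj G u) (v - oproj G v))"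
      using eq_self[of f] norm_triangle_ineq4 by (metis norm_mult)
    also have "\<dots> \<le> L\<^sup>2 * (t\<^sup>2 * (norm u * norm v)) + L\<^sup>2 * g\<^sup>2 * (norm u * norm v)"
      using form_res[OF u(1) v(1)] inner_res[OF u(1) v(1)] lhL
      by (intro add_mono mult_mono) auto
    finally have ff: "(norm f)\<^sup>2 \<le> (L\<^sup>2 * t\<^sup>2 + L\<^sup>2 * g\<^sup>2) * (norm u * norm v)" by (simp add: algebra_simps)
    have uv: "(1 - t\<^sup>2) * (norm u * norm v) \<le> norm e * norm f"
    proof (rule power2_le_imp_le)
      have "((1 - t\<^sup>2) * (norm u * norm v))\<^sup>2 = ((1 - t\<^sup>2) * (norm u)\<^sup>2) * ((1 - t\<^sup>2) * (norm v)\<^sup>2)"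
        by (simp add: power2_eq_square mult_ac)
      also have "\<dots> \<le> (norm e)\<^sup>2 * (norm f)\<^sup>2"
        using norm_proj[OF u(1)] norm_proj[OF v(1)] t(2) by (intro mult_mono) (auto simp: v(2) e_def)
      finally show "((1 - t\<^sup>2) * (norm u * norm v))\<^sup>2 \<le> (norm e * norm f)\<^sup>2" by (simp add: power_mult_distrib)
    qed simp
    \<comment> \<open>source of the constant 10: \<open>g \<le> 1/2\<close> gives \<open>L\<^sup>2 \<le> 4 n\<close> and \<open>L\<^sup>2 g\<^sup>2 \<le> n\<close>, and \<open>1 - t\<^sup>2 \<ge> 1/2\<close>\<close>
    have K: "L\<^sup>2 * t\<^sup>2 + L\<^sup>2 * g\<^sup>2 \<le> (1 - t\<^sup>2) * \<rho>"
    proof -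
      have "L\<^sup>2 * g\<^sup>2 \<le> 4 * n * (1 / 4)" using L4 g4 n by (intro mult_mono) auto
      then have "L\<^sup>2 + L\<^sup>2 * g\<^sup>2 \<le> 5 * n" using L4 by simp
      also have "5 * n = 10 * n * (1 / 2)" by simp
      also have "\<dots> \<le> 10 * n * (1 - t\<^sup>2)" using n t(2) by (intro mult_left_mono) auto
      finally have "(L\<^sup>2 + L\<^sup>2 * g\<^sup>2) * t\<^sup>2 \<le> 10 * n * (1 - t\<^sup>2) * t\<^sup>2" by (rule mult_right_mono) simp
      then show ?thesis by (simp add: \<rho>_def algebra_simps)
    qed
    have "0 \<le> \<rho>" unfolding \<rho>_def using n by simp
    have "(norm f)\<^sup>2 \<le> ((1 - t\<^sup>2) * \<rho>) * (norm u * norm v)"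
      using ff mult_right_mono[OF K, of "norm u * norm v"] by simp
    also have "\<dots> \<le> \<rho> * (norm e * norm f)" using mult_left_mono[OF uv \<open>0 \<le> \<rho>\<close>] by (simp add: mult_ac)
    finally have "norm f * norm f \<le> (\<rho> * norm e) * norm f" by (simp add: power2_eq_square mult_ac)
    moreover have "0 \<le> \<rho> * norm e" using \<open>0 \<le> \<rho>\<close> by simp
    ultimately have f_le: "norm f \<le> \<rho> * norm e"
      by (cases "norm f = 0") (auto simp: mult_le_cancel_right)
    have e_nz: "e \<noteq> 0"
    proof
      assume "e = 0"
      then have "1 * norm u \<le> t * norm u" using t(3)[OF u(1)] by (simp add: e_def)
      then show False using u(2) t1 by (simp only: mult_le_cancel_right) auto
    qed
    have "\<exists>l\<in>\<Lambda>. cmod (l - lh) \<le> \<rho> \<and> (\<exists>x\<in>eigenspace D A l. x \<noteq> 0)"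
    proof (rule eigenvalue_near_residual[OF A_linear])
      show "cinner x y = 0" if "l \<noteq> k" "x \<in> eigenspace D A l" "y \<in> eigenspace D A k" for l k x y
        using that A_sym by (auto simp: eigenspace_def intro: hermitian_eigenvectors_orthogonal[where X = D and T = A])
      show "e \<in> cspan (\<Union>l\<in>\<Lambda>. eigenspace D A l)" using eE E_eq by simp
      show "norm (A e - lh *\<^sub>C e) \<le> \<rho> * norm e" using f_le by (simp add: f_def)
    qed (use e_nz eigenspace_subspace in \<open>auto simp: eigenspace_def\<close>)
    then show ?thesis by (auto simp: norm_minus_commute)
  qed
  have "spectrum X X ?T \<noteq> {}" using near1 nonempty by blast
  with nonempty have "hausdorff_dist \<Lambda> (spectrum X X ?T) \<le> \<rho>"
    using near1 near2 by (intro hausdorff_dist_le)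
  then show "hausdorff_dist \<Lambda> (spectrum X X ?T) \<le> (Lambda_max B X)\<^sup>2 * g\<^sup>2 + 10 * A_norm * t\<^sup>2"
    by (simp add: \<rho>_def L_def n_def)
qed

end

end

section \<open>Convergence of the computed eigenvalue cluster\<close>

lemma filter_op_clinear:
  assumes "\<And>k. k < N \<Longrightarrow> clinear (Q k)"
  shows "clinear (filter_op w N Q)"
  using assms
  by (auto simp: clinear_iff filter_op_def scaleC_add_right sum.distrib complex_vector.scale_sum_right
      scaleC_scaleC mult.commute)

lemma filter_op_bounded_linear:
  assumes "\<And>k. k < N \<Longrightarrow> bounded_linear (Q k)"
  shows "bounded_linear (filter_op w N Q)"
  unfolding filter_op_def using assms
  by (intro bounded_linear_add bounded_linear_sum bounded_linear_scaleC_right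
      bounded_linear_compose[OF bounded_linear_scaleC_right]) auto

text \<open>For \<open>|\<zeta>| > 2 \<parallel>S\<parallel>\<close>, \<open>\<zeta> - S\<close> is a small perturbation of \<open>\<zeta>\<close>.\<close>

lemma spectrum_bounded:
  fixes S :: "'v::chilbert_space \<Rightarrow> 'v"
  assumes S: "clinear S" "bounded_linear S"
  shows "\<exists>K. \<forall>\<zeta>\<in>spectrum UNIV UNIV S. cmod \<zeta> \<le> K"
proof -
  obtain K where K: "K > 0" "\<And>u. norm (S u) \<le> norm u * K" using bounded_linear.pos_bounded[OF S(2)] by blast
  have "\<zeta> \<in> res_set UNIV UNIV S" if \<zeta>: "cmod \<zeta> > 2 * K" for \<zeta>
  proof -
    have nz: "\<zeta> \<noteq> 0" "cmod \<zeta> > 0" using \<zeta> K(1) by auto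
    have bij: "bij (\<lambda>x. \<zeta> *\<^sub>C x - 0 :: 'v)"
    proof (rule bijI)
      show "inj (\<lambda>x. \<zeta> *\<^sub>C x - 0 :: 'v)" using nz by (auto intro: injI)
      have "y = \<zeta> *\<^sub>C ((1 / \<zeta>) *\<^sub>C y) - 0" for y :: 'v using nz by (simp add: scaleC_scaleC scaleC_one)
      then show "surj (\<lambda>x. \<zeta> *\<^sub>C x - 0 :: 'v)" by (rule surjI[OF sym])
    qed
    have "clinear (\<lambda>x::'v. 0 :: 'v)" by (simp add: clinear_iff)
    moreover have "norm (S u - 0) \<le> cmod \<zeta> / 2 * norm u" for u
      using K(2)[of u] mult_right_mono[of K "cmod \<zeta> / 2" "norm u"] \<zeta> by (simp add: mult.commute)
    ultimately have *: "bij (\<lambda>x. \<zeta> *\<^sub>C x - S x)" "\<And>u. cmod \<zeta> / 2 * norm u \<le> norm (\<zeta> *\<^sub>C u - S u)"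
      using perturbed_bijective[of "\<lambda>_. 0" S \<zeta> "cmod \<zeta>"] S(1) bij nz by (auto simp: norm_scaleC)
    have "norm u \<le> 2 / cmod \<zeta> * norm (\<zeta> *\<^sub>C u - S u)" for u
      using *(2)[of u] nz by (simp add: field_simps)
    then show ?thesis using *(1) unfolding res_set_def by blast
  qed
  then show ?thesis unfolding spectrum_def by (intro exI[of _ "2 * K"]) (metis ComplD not_le)
qed

lemma vimage_cspan:
  assumes f: "clinear f" "inj f" and S: "S \<subseteq> range f"
  shows "f -` cspan S = cspan (f -` S)"
proof
  show "cspan (f -` S) \<subseteq> f -` cspan S"
    by (intro complex_vector.span_minimal)
      (auto simp: csubspace_iff clinear_props[OF f(1)] complex_vector.span_zero complex_vector.span_add
        complex_vector.span_scale complex_vector.span_base)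
  have "\<exists>u\<in>cspan (f -` S). f u = x" if "x \<in> cspan S" for x
    using that
  proof (induction rule: complex_vector.span_induct)
    case base
    have "\<exists>u\<in>cspan (f -` S). f u = 0"
      using clinear_props(3)[OF f(1)] complex_vector.span_zero by blast
    moreover have "\<exists>u\<in>cspan (f -` S). f u = x + y"
      if "\<exists>u\<in>cspan (f -` S). f u = x" "\<exists>u\<in>cspan (f -` S). f u = y" for x y
      using that clinear_props(1)[OF f(1)] complex_vector.span_add by metis
    moreover have "\<exists>u\<in>cspan (f -` S). f u = c *\<^sub>C x" if "\<exists>u\<in>cspan (f -` S). f u = x" for x c
      using that clinear_props(2)[OF f(1)] complex_vector.span_scale by metis
    ultimately show ?case by (auto simp: csubspace_iff)
  next
    case (step x)
    then obtain u where "x = f u" using S by blast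
    then show ?case using step by (intro bexI[of _ u] complex_vector.span_base) auto
  qed
  then show "f -` cspan S \<subseteq> cspan (f -` S)" using injD[OF f(2)] by blast
qed

lemma near_identity_surjective:
  fixes P :: "'v::chilbert_space \<Rightarrow> 'v"
  assumes G: "orthonormal G" and P: "clinear P" and e: "e \<in> cspan G"
    and close: "\<And>u. u \<in> cspan G \<Longrightarrow> norm (P u - u) \<le> 1 / 2 * norm u"
  shows "\<exists>x. oproj G (P x) = e"
proof -
  let ?Q = "oproj G"
  \<comment> \<open>\<open>1 - T\<close> extends \<open>Q P\<close> by the identity on the complement, so that it can be inverted on the whole,
    complete space\<close>
  define T where "T u = ?Q (?Q u - P (?Q u))" for u
  have T: "clinear T"
    by (auto simp: clinear_iff T_def oproj_add oproj_diff oproj_scaleC clinear_props[OF P]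
        complex_vector.scale_right_diff_distrib)
  have Tn: "norm (T u - 0) \<le> 1 / 2 * norm u" for u
  proof -
    have "norm (T u) \<le> norm (?Q u - P (?Q u))" unfolding T_def by (rule norm_oproj_le(1)[OF G])
    also have "\<dots> \<le> 1 / 2 * norm (?Q u)"
      using close[OF oproj_in_span, of u] by (simp add: norm_minus_commute)
    also have "\<dots> \<le> 1 / 2 * norm u" using norm_oproj_le(1)[OF G, of u] by simp
    finally show ?thesis by simp
  qed
  have "bij (\<lambda>x::'v. 1 *\<^sub>C x - T x)"
  proof (rule perturbed_bijective(1)[of "\<lambda>_. 0", OF _ T _ zero_less_one _ Tn])
    show "clinear (\<lambda>x::'v. 0 :: 'v)" by (simp add: clinear_iff)
    have "(\<lambda>x::'v. 1 *\<^sub>C x - 0) = id" by (simp add: fun_eq_iff scaleC_one)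
    then show "bij (\<lambda>x::'v. 1 *\<^sub>C x - 0)" by (metis bij_id)
  qed (simp add: scaleC_one)
  then obtain x where "1 *\<^sub>C x - T x = e" unfolding bij_def surj_def by metis
  then have x: "x - T x = e" by (simp add: scaleC_one)
  have QT: "?Q (T u) = T u" for u unfolding T_def by (rule oproj_ident[OF G oproj_in_span])
  have "?Q x - T x = e" using arg_cong[OF x, of ?Q] oproj_ident[OF G e] by (simp add: oproj_diff QT)
  then have "?Q (P (?Q x)) = e" by (simp add: T_def oproj_diff oproj_ident[OF G oproj_in_span])
  then show ?thesis by blast
qed

theorem corollary5p7:
  fixes D DP DB E :: "'h::chilbert_space set"
    and A U P B :: "'h \<Rightarrow> 'h"
    and \<Lambda> M :: "complex set"
    and N m :: nat
    and w z :: "nat \<Rightarrow> complex"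
    and y \<delta> \<gamma> :: real
    and \<iota> :: "'v::chilbert_space \<Rightarrow> 'h"
    and Vh :: "real \<Rightarrow> 'v set"
    and R :: "complex \<Rightarrow> 'h \<Rightarrow> 'h"
    and Rh :: "real \<Rightarrow> complex \<Rightarrow> 'h \<Rightarrow> 'v"
    and SN :: "'v \<Rightarrow> 'v"
    and SNh :: "real \<Rightarrow> 'v \<Rightarrow> 'v"
    and \<Theta> :: "real \<Rightarrow> complex"
    and EV :: "'v set"
    and Eh :: "real \<Rightarrow> 'v set"
    and a :: "'h \<Rightarrow> 'h \<Rightarrow> complex"
    and \<Lambda>h :: "real \<Rightarrow> complex set"
  \<comment> \<open>operator and eigenvalue cluster\<close>
  assumes A: "linear_op D A" "closed_op D A" "selfadjoint_op D A"
    and R_eq: "R = resolvent D A"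
    and Lam: "finite \<Lambda>" "\<Lambda> \<subseteq> spectrum UNIV D A"
      "\<And>l. l \<in> \<Lambda> \<Longrightarrow> eigenspace D A l \<noteq> {0} \<and> fin_dim (eigenspace D A l)"
    and E_eq: "E = cspan (\<Union>l\<in>\<Lambda>. eigenspace D A l)"
    and m: "fin_dim E" "cdim E = m" "1 \<le> m"
  \<comment> \<open>Assumption 1\<close>
    and A1: "\<delta> > 0" "\<gamma> > 0"
      "\<Lambda> \<subseteq> complex_of_real ` I_set y \<gamma>"
      "spectrum UNIV D A - \<Lambda> \<subseteq> complex_of_real ` O_set y \<delta> \<gamma>"
      "\<And>k. k < N \<Longrightarrow> z k \<notin> closure (spectrum UNIV D A)"
      "filter_kappa w z N y \<delta> \<gamma> < 1"
  \<comment> \<open>Assumption 2: the Hilbert space \<open>V\<close>, with inclusion map \<open>\<iota>\<close> into \<open>H\<close>\<close>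
    and incl: "clinear \<iota>" "inj \<iota>"
    and A2: "E \<subseteq> range \<iota>"
      "\<exists>C>0. \<forall>u. norm (\<iota> u) \<le> C * norm u"
      "\<And>\<zeta>. \<zeta> \<in> res_set UNIV D A \<Longrightarrow> R \<zeta> ` range \<iota> \<subseteq> range \<iota>"
  \<comment> \<open>discretization and Assumption 3\<close>
    and Vh: "\<And>h. h > 0 \<Longrightarrow> csubspace (Vh h) \<and> fin_dim (Vh h)"
    and Rh: "\<And>h \<zeta>. h > 0 \<Longrightarrow> \<zeta> \<in> res_set UNIV D A \<Longrightarrow>
               clinear (Rh h \<zeta>) \<and> range (Rh h \<zeta>) \<subseteq> Vh h"
    and A3: "\<And>k. k < N \<Longrightarrow> bounded_linear (on_subspace \<iota> (R (z k)))"
      "\<And>k h. k < N \<Longrightarrow> h > 0 \<Longrightarrow> bounded_linear (\<lambda>u. Rh h (z k) (\<iota> u))"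
      "\<And>k. k < N \<Longrightarrow>
         ((\<lambda>h. onorm (\<lambda>u. Rh h (z k) (\<iota> u) - on_subspace \<iota> (R (z k)) u)) \<longlongrightarrow> 0) (at_right 0)"
  \<comment> \<open>filtered operators on \<open>V\<close>, the curve, and the computed subspace\<close>
    and SN_eq: "SN = filter_op w N (\<lambda>k. on_subspace \<iota> (R (z k)))"
    and SNh_eq: "\<And>h. SNh h = filter_op w N (\<lambda>k u. Rh h (z k) (\<iota> u))"
    and M_eq: "M = rat_filter w z N ` \<Lambda>"
    and Theta: "simple_path \<Theta>" "pathfinish \<Theta> = pathstart \<Theta>" "rectifiable_path \<Theta>"
      "M \<subseteq> inside (path_image \<Theta>)"
      "\<And>\<zeta>. \<zeta> \<in> path_image \<Theta> \<Longrightarrow> mu_star (spectrum UNIV UNIV SN) M < cmod \<zeta>"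
      "inside (path_image \<Theta>) \<inter> spectrum UNIV UNIV SN \<subseteq> M"
      "0 \<notin> inside (path_image \<Theta>)"
    and EV_eq: "EV = \<iota> -` E"
    and Eh_eq: "\<And>h. Eh h = range (riesz_projection \<Theta> (SNh h))"
  \<comment> \<open>form, Ritz values and Assumption 4\<close>
    and polar: "polar_decomposition D A U DP P"
    and sqrt: "positive_sqrt DP P DB B"
    and a_eq: "a = form_of U B"
    and Lamh_eq: "\<And>h. \<Lambda>h h = spectrum (\<iota> ` Eh h) (\<iota> ` Eh h) (ritz_op a (\<iota> ` Eh h))"
    and A4: "\<And>h. h > 0 \<Longrightarrow> \<iota> ` Vh h \<subseteq> DB"
  \<comment> \<open>the additional hypothesis\<close>
    and V_norm: "\<And>u. \<iota> u \<in> DB \<and> norm u = norm (B (\<iota> u))"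
  shows "\<exists>C0>0. \<exists>h0>0. \<forall>h. 0 < h \<and> h < h0 \<longrightarrow>
    gap EV (Eh h) < 1 \<and>
    hausdorff_dist \<Lambda> (\<Lambda>h h) \<le>
      (Lambda_max B (\<iota> ` Eh h))\<^sup>2 * (gap EV (Eh h))\<^sup>2 +
      C0 * subspace_onorm E (ritz_op a E) * (gap E (\<iota> ` Eh h))\<^sup>2 \<and>
    (Lambda_max B (\<iota> ` Eh h))\<^sup>2 \<le>
      (1 / (1 - gap EV (Eh h)))\<^sup>2 * subspace_onorm E (ritz_op a E)"
proof -
  note il = clinear_props[OF incl(1)]
  have zres: "z k \<in> res_set UNIV D A" if "k < N" for k
    using A1(5)[OF that] closure_subset[of "spectrum UNIV D A"] by (auto simp: spectrum_def)
  interpret S0: form_setting D A U DP P DB B using A(3) polar sqrt by unfold_locales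
  have real: "\<exists>r. r \<in> I_set y \<gamma> \<and> l = complex_of_real r" if "l \<in> \<Lambda>" for l using A1(3) that by blast
  \<comment> \<open>an eigenvector for \<open>0\<close> would have energy norm \<open>0\<close>\<close>
  have nonzero: "0 \<notin> \<Lambda>"
  proof
    assume 0: "0 \<in> \<Lambda>"
    then obtain x where x: "x \<in> eigenspace D A 0" "x \<noteq> 0"
      using Lam(3) complex_vector.subspace_0[OF S0.eigenspace_subspace] by blast
    then have "x \<in> E" unfolding E_eq using 0 by (intro complex_vector.span_base) blast
    then obtain u where u: "x = \<iota> u" using A2(1) by blast
    have "B x = 0" using x by (intro S0.kernel_facts) (auto simp: eigenspace_def)
    then have "u = 0" using V_norm[of u] u by simp
    then show False using u x(2) il(3) by simp
  qed
  have "\<Lambda> \<noteq> {}"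
  proof
    assume "\<Lambda> = {}"
    then have "E = cspan {}" using E_eq by simp
    then have "cdim E = 0" by (metis complex_vector.dim_span_eq_card_independent complex_vector.independent_empty card.empty)
    then show False using m by simp
  qed
  interpret C: cluster_setting D A U DP P DB B \<Lambda> E
  proof
    show "\<exists>r. l = complex_of_real r" if "l \<in> \<Lambda>" for l using real[OF that] by blast
    show "eigenspace D A l \<noteq> {0}" if "l \<in> \<Lambda>" for l using Lam(3)[OF that] by simp
  qed (fact nonzero \<open>\<Lambda> \<noteq> {}\<close> E_eq m(1))+
  have eig_E: "x \<in> E" if "l \<in> \<Lambda>" "x \<in> eigenspace D A l" for l x
    using that unfolding E_eq by (intro complex_vector.span_base) blast
  have cin: "cinner (B (\<iota> u)) (B (\<iota> v)) = cinner u v" for u v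
    by (rule linear_preserves_cinner_if_norm[where L = "\<lambda>u. B (\<iota> u)"])
      (use V_norm in \<open>auto simp: il S0.B_add S0.B_scale\<close>)
  obtain GE where GE: "orthonormal GE" "cspan GE = E" using m(1) by (rule fin_dim_orthonormal_basis)
  have "GE \<subseteq> range \<iota>" using GE(2) A2(1) complex_vector.span_superset by blast
  then have "EV = cspan (\<iota> -` GE)" using vimage_cspan[OF incl, of GE] GE(2) EV_eq by simp
  moreover have "finite (\<iota> -` GE)" using GE(1) incl(2) by (auto simp: orthonormal_def intro: finite_vimageI)
  ultimately have "fin_dim EV" unfolding fin_dim_def by blast
  then obtain GV where GV: "orthonormal GV" "cspan GV = EV" by (rule fin_dim_orthonormal_basis)
  define W where "W = \<iota> -` (\<Union>l\<in>\<Lambda>. eigenspace D A l)"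
  have "(\<Union>l\<in>\<Lambda>. eigenspace D A l) \<subseteq> range \<iota>" using eig_E A2(1) by blast
  then have EW: "cspan GV = cspan W" using vimage_cspan[OF incl, of "\<Union>l\<in>\<Lambda>. eigenspace D A l"] GV(2) EV_eq E_eq
    by (simp add: W_def)
  \<comment> \<open>\<open>E\<close> has the same orthogonal complement, and hence the same orthogonal projection, in \<open>V\<close> and \<open>H\<close>\<close>
  have orth_iff: "oproj GV u = 0 \<longleftrightarrow> (\<forall>e\<in>E. cinner (\<iota> u) e = 0)" for u
  proof -
    have "cinner u e = 0" if "oproj GV u = 0" "e \<in> EV" for e
      using oproj_residual_orth[OF GV(1), of e u] GV(2) that by simp
    then have "oproj GV u = 0 \<longleftrightarrow> (\<forall>e\<in>EV. cinner u e = 0)"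
      using oproj_eq_0[of GV u] GV(2) by blast
    also have "\<dots> \<longleftrightarrow> (\<forall>e\<in>EV. cinner (B (\<iota> e)) (B (\<iota> u)) = 0)"
      unfolding cin using cinner_eq_0_commute by blast
    also have "\<dots> \<longleftrightarrow> (\<forall>e\<in>E. cinner (B e) (B (\<iota> u)) = 0)" using A2(1) unfolding EV_eq by blast
    also have "\<dots> \<longleftrightarrow> (\<forall>e\<in>E. cinner e (\<iota> u) = 0)" using V_norm by (intro C.energy_orth) blast
    finally show ?thesis using cinner_eq_0_commute by blast
  qed
  have proj_eq: "oproj GE (\<iota> u) = \<iota> (oproj GV u)" for u
  proof (rule oproj_eqI[OF GE(1)])
    show "\<iota> (oproj GV u) \<in> cspan GE" using oproj_in_span[of GV u] GV(2) GE(2) EV_eq by simp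
    have "oproj GV (u - oproj GV u) = 0"
      using oproj_ident[OF GV(1) oproj_in_span, of u] by (simp add: oproj_diff)
    then show "cinner (\<iota> u - \<iota> (oproj GV u)) e = 0" if "e \<in> cspan GE" for e
      using orth_iff that GE(2) by (simp add: il)
  qed
  have Rcl: "clinear (R (z k))" if "k < N" for k
    unfolding R_eq by (rule resolvent_clinear[OF A(1) zres[OF that]])
  have on: "\<iota> (on_subspace \<iota> (R (z k)) u) = R (z k) (\<iota> u)" if "k < N" for k u
    unfolding on_subspace_def using A2(3)[OF zres[OF that]] by (intro f_inv_into_f) blast
  have on_cl: "clinear (on_subspace \<iota> (R (z k)))" if k: "k < N" for k
    unfolding clinear_iff using injD[OF incl(2)] by (auto simp: on[OF k] il clinear_props[OF Rcl[OF k]])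
  have SN_cl: "clinear SN" unfolding SN_eq using on_cl by (rule filter_op_clinear)
  have SN_bl: "bounded_linear SN" unfolding SN_eq using A3(1) by (rule filter_op_bounded_linear)
  have inj0: "\<iota> u = \<iota> v \<Longrightarrow> u = v" for u v using injD[OF incl(2)] .
  have i_sum: "\<iota> (\<Sum>k<N. f k) = (\<Sum>k<N. \<iota> (f k))" for f
    by (induction N) (auto simp: il)
  have i_SN: "\<iota> (SN u) = filter_op w N (\<lambda>k. resolvent D A (z k)) (\<iota> u)" for u
    unfolding SN_eq filter_op_def using on by (simp add: il i_sum R_eq)
  have eig: "\<exists>\<mu>\<in>inside (path_image \<Theta>). SN e = \<mu> *\<^sub>C e" if "e \<in> W" for e
  proof -
    obtain l where l: "l \<in> \<Lambda>" "\<iota> e \<in> eigenspace D A l" using \<open>e \<in> W\<close> by (auto simp: W_def)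
    have "\<iota> (SN e) = \<iota> (rat_filter w z N l *\<^sub>C e)"
    proof (cases "\<iota> e = 0")
      case True
      then have "e = 0" using inj0[of e 0] il(3) by simp
      then show ?thesis using clinear_props(3)[OF SN_cl] by simp
    next
      case False
      then show ?thesis unfolding i_SN il using l(2) zres
        by (intro filter_eigenvalue[OF A(1)]) (auto simp: eigenspace_def)
    qed
    then have "SN e = rat_filter w z N l *\<^sub>C e" by (rule inj0)
    moreover have "rat_filter w z N l \<in> inside (path_image \<Theta>)" using l(1) Theta(4) M_eq by blast
    ultimately show ?thesis by blast
  qed
  have Rorth: "\<forall>e\<in>E. cinner (resolvent D A (z k) x) e = 0" if k: "k < N" and x: "\<forall>e\<in>E. cinner x e = 0" for k x
  proof -
    have "cinner (resolvent D A (z k) x) e = 0" if e: "e \<in> (\<Union>l\<in>\<Lambda>. eigenspace D A l)" for e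
    proof -
      obtain l where l: "l \<in> \<Lambda>" "e \<in> eigenspace D A l" using e by blast
      obtain r where r: "e \<in> D" "A e = complex_of_real r *\<^sub>C e" using C.eigenspaceE[OF l] by metis
      show ?thesis
        using resolvent_orth_eigenvector[OF A(1) S0.A_sym zres[OF k] r] x eig_E[OF l] by blast
    qed
    then show ?thesis unfolding E_eq using cinner_span_eq_0 by blast
  qed
  have compl: "oproj GV (SN u) = 0" if "oproj GV u = 0" for u
  proof -
    have x: "\<forall>e\<in>E. cinner (\<iota> u) e = 0" using that orth_iff by blast
    show ?thesis unfolding orth_iff i_SN filter_op_def
      using x Rorth[OF _ x] by (simp add: cinner_add_left cinner_scaleC_left cinner_sum_left)
  qed
  have path: "path \<Theta>" using Theta(1) by (rule simple_path_imp_path)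
  \<comment> \<open>The supremum defining \<open>mu_star\<close> is an upper bound only because the spectrum is bounded.\<close>
  have res: "path_image \<Theta> \<subseteq> res_set UNIV UNIV SN"
  proof
    fix \<zeta> assume \<zeta>: "\<zeta> \<in> path_image \<Theta>"
    show "\<zeta> \<in> res_set UNIV UNIV SN"
    proof (rule ccontr)
      assume "\<zeta> \<notin> res_set UNIV UNIV SN"
      moreover have "\<zeta> \<notin> M" using \<zeta> Theta(4) inside_no_overlap[of "path_image \<Theta>"] by blast
      ultimately have mem: "cmod \<zeta> \<in> insert 0 (cmod ` (spectrum UNIV UNIV SN - M))" by (auto simp: spectrum_def)
      obtain K where K: "\<And>\<eta>. \<eta> \<in> spectrum UNIV UNIV SN \<Longrightarrow> cmod \<eta> \<le> K"
        using spectrum_bounded[OF SN_cl SN_bl] by blast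
      have "bdd_above (insert 0 (cmod ` (spectrum UNIV UNIV SN - M)))"
        using K by (intro bdd_above_insert[THEN iffD2] bdd_aboveI2[where M = K]) auto
      with mem have "cmod \<zeta> \<le> mu_star (spectrum UNIV UNIV SN) M"
        unfolding mu_star_def by (rule cSup_upper)
      then show False using Theta(5)[OF \<zeta>] by simp
    qed
  qed
  have conv: "\<exists>b>0. \<forall>h. 0 < h \<and> h < b \<longrightarrow> (\<forall>u. norm (SNh h u - SN u) \<le> d * norm u)" if d: "d > 0" for d :: real
  proof -
    define \<eta> where "\<eta> h = (\<Sum>k<N. cmod (w k) * onorm (\<lambda>u. Rh h (z k) (\<iota> u) - on_subspace \<iota> (R (z k)) u))" for h
    have "(\<eta> \<longlongrightarrow> (\<Sum>k<N. cmod (w k) * 0)) (at_right 0)"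
      unfolding \<eta>_def using A3(3) by (intro tendsto_sum tendsto_mult tendsto_const) auto
    then have "\<forall>\<^sub>F h in at_right 0. \<eta> h < d" using d by (intro order_tendstoD) auto
    then obtain b where b: "b > 0" "\<And>h. h > 0 \<Longrightarrow> h < b \<Longrightarrow> \<eta> h < d"
      unfolding eventually_at_right[OF zero_less_one] by auto
    have "norm (SNh h u - SN u) \<le> d * norm u" if h: "0 < h" "h < b" for h u
    proof -
      have "SNh h u - SN u = (\<Sum>k<N. w k *\<^sub>C (Rh h (z k) (\<iota> u) - on_subspace \<iota> (R (z k)) u))"
        by (simp add: SNh_eq SN_eq filter_op_def sum_subtractf complex_vector.scale_right_diff_distrib)
      also have "norm \<dots> \<le> (\<Sum>k<N. cmod (w k) * (onorm (\<lambda>u. Rh h (z k) (\<iota> u) - on_subspace \<iota> (R (z k)) u) * norm u))"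
        using A3(1,2) h(1)
        by (intro sum_norm_le) (auto simp: norm_scaleC intro!: mult_left_mono onorm bounded_linear_sub)
      also have "\<dots> = \<eta> h * norm u" by (simp add: \<eta>_def sum_distrib_right mult.assoc)
      also have "\<dots> \<le> d * norm u" using b(2)[OF h] by (intro mult_right_mono) auto
      finally show ?thesis .
    qed
    then show ?thesis using b(1) by blast
  qed
  have SNh_cl: "clinear (SNh h)" if h: "h > 0" for h
    unfolding SNh_eq
  proof (rule filter_op_clinear)
    fix k assume "k < N"
    then have "clinear (Rh h (z k))" using Rh[OF h zres] by blast
    then show "clinear (\<lambda>u. Rh h (z k) (\<iota> u))" by (auto simp: clinear_iff il)
  qed
  have SNh_fr: "SNh h u - w N *\<^sub>C u \<in> Vh h" if h: "h > 0" for h u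
  proof -
    have "SNh h u - w N *\<^sub>C u = (\<Sum>k<N. w k *\<^sub>C Rh h (z k) (\<iota> u))" by (simp add: SNh_eq filter_op_def)
    also have "\<dots> \<in> Vh h" using Vh[OF h] Rh[OF h zres]
      by (intro complex_vector.subspace_sum complex_vector.subspace_scale) auto
    finally show ?thesis .
  qed
  have sep: "cmod (w N) < cmod (rat_filter w z N l)"
      "\<And>\<xi>. \<xi> \<in> spectrum UNIV D A - \<Lambda> \<Longrightarrow> cmod (rat_filter w z N \<xi>) < cmod (rat_filter w z N l)"
    if l: "l \<in> \<Lambda>" for l
  proof -
    obtain r where r: "r \<in> I_set y \<gamma>" "l = complex_of_real r" using real[OF l] by blast
    have nopole: "\<xi> \<noteq> z k" if "\<xi> \<in> spectrum UNIV D A" "k < N" for \<xi> k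
      using that zres by (auto simp: spectrum_def)
    have lp: "complex_of_real r \<noteq> z k" if "k < N" for k using nopole that Lam(2) l r(2) by blast
    show "cmod (w N) < cmod (rat_filter w z N l)"
      unfolding r(2) by (rule filter_kappa_separates(2)[OF A1(6) r(1) lp])
    show "cmod (rat_filter w z N \<xi>) < cmod (rat_filter w z N l)" if \<xi>: "\<xi> \<in> spectrum UNIV D A - \<Lambda>" for \<xi>
    proof -
      obtain t where t: "t \<in> O_set y \<delta> \<gamma>" "\<xi> = complex_of_real t" using A1(4) \<xi> by blast
      have tp: "complex_of_real t \<noteq> z k" if "k < N" for k using nopole that \<xi> t(2) by blast
      show ?thesis unfolding r(2) t(2)
        by (rule filter_kappa_separates(1)[OF A1(6) r(1) _ t(1)]) (use lp tp in auto)
    qed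
  qed
  let ?F = "{u. oproj GV u = 0}"
  have low: "\<exists>c>0. \<forall>u\<in>?F. c * norm u \<le> norm (\<zeta> *\<^sub>C u - SN u)"
    if \<zeta>: "\<zeta> \<in> path_image \<Theta> \<union> inside (path_image \<Theta>)" for \<zeta>
  proof (cases "\<zeta> \<in> res_set UNIV UNIV SN")
    case True
    then show ?thesis using res_set_bounded_below by blast
  next
    case False
    \<comment> \<open>Then \<open>\<zeta>\<close> is a filtered eigenvalue of the cluster, and an eigenvector of the filter in the complement
      would produce an eigenvalue of \<open>A\<close> outside \<open>\<Lambda>\<close> with the same filter value.\<close>
    then have "\<zeta> \<in> M" using \<zeta> res Theta(6) by (auto simp: spectrum_def)
    then obtain l where l: "l \<in> \<Lambda>" "\<zeta> = rat_filter w z N l" using M_eq by blast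
    have neq: "\<zeta> \<noteq> w N" using sep(1)[OF l(1)] l(2) by auto
    then have "cmod (\<zeta> - w N) / 2 > 0" by simp
    from conv[OF this] obtain b where b: "b > 0"
      "\<forall>h. 0 < h \<and> h < b \<longrightarrow> (\<forall>u. norm (SNh h u - SN u) \<le> cmod (\<zeta> - w N) / 2 * norm u)" by blast
    define h where "h = b / 2"
    have h: "h > 0" "\<And>u. norm (SNh h u - SN u) \<le> cmod (\<zeta> - w N) / 2 * norm u"
      using b by (auto simp: h_def)
    show ?thesis
    proof (rule injective_imp_bounded_below[OF SN_cl SN_bl])
      show "clinear (\<lambda>u. SNh h u - w N *\<^sub>C u)"
        using clinear_props[OF SNh_cl[OF h(1)]]
        by (auto simp: clinear_iff scaleC_add_right complex_vector.scale_right_diff_distrib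
            complex_vector.scale_left_commute)
      show "fin_dim (Vh h)" "SNh h u - w N *\<^sub>C u \<in> Vh h" for u using Vh[OF h(1)] SNh_fr[OF h(1)] by auto
      show "norm (SN u - w N *\<^sub>C u - (SNh h u - w N *\<^sub>C u)) \<le> cmod (\<zeta> - w N) / 2 * norm u" for u
        using h(2)[of u] by (simp add: norm_minus_commute)
      show "csubspace ?F" by (auto simp: csubspace_iff oproj_add oproj_scaleC oproj_eq_0)
      have "?F = (\<Inter>e\<in>EV. {u. cinner u e = 0})"
        using oproj_residual_orth[OF GV(1)] oproj_eq_0[of GV] GV(2) by (auto, metis diff_zero)
      also have "closed \<dots>"
        by (intro closed_INT ballI closed_Collect_eq continuous_on_const
            linear_continuous_on[OF bounded_linear_cinner_left])
      finally show "closed ?F" .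
      fix u assume u: "u \<in> ?F" "SN u = \<zeta> *\<^sub>C u"
      show "u = 0"
      proof (rule ccontr)
        assume "u \<noteq> 0"
        then have nz: "\<iota> u \<noteq> 0" using inj0[of u 0] il(3) by auto
        have mem: "\<iota> u \<in> {x. \<forall>e\<in>E. cinner x e = 0}" using u(1) orth_iff by simp
        have "filter_op w N (\<lambda>k. resolvent D A (z k)) (\<iota> u) = \<zeta> *\<^sub>C \<iota> u"
          unfolding i_SN[symmetric] u(2) by (rule il(2))
        from filter_eigenvector_imp_eigenvector[OF A(1) zres csubspace_orth _ mem nz this neq] Rorth
        obtain \<xi> x where x: "\<forall>e\<in>E. cinner x e = 0" "x \<in> D" "x \<noteq> 0" "A x = \<xi> *\<^sub>C x" "rat_filter w z N \<xi> = \<zeta>"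
          by auto
        have "\<xi> \<in> spectrum UNIV D A"
          using eigenvalue_in_spectrum[where T = A, OF S0.D_subspace S0.A_zero x(2-4)] .
        moreover have "\<xi> \<notin> \<Lambda>"
        proof
          assume "\<xi> \<in> \<Lambda>"
          then have "x \<in> E" using x by (intro eig_E) (auto simp: eigenspace_def)
          then show False using x(1,3) by auto
        qed
        ultimately show False using sep(2)[OF l(1), of \<xi>] x(5) l(2) by simp
      qed
    qed (rule neq)
  qed
  obtain \<sigma> where \<sigma>: "\<sigma> = 1 \<or> \<sigma> = -1" and stable: "\<And>\<epsilon>. \<epsilon> > 0 \<Longrightarrow>
      \<exists>d>0. \<forall>S'. finite_rank_perturbation SN d S' \<longrightarrow> riesz_near \<Theta> S' \<sigma> (oproj GV) \<epsilon>"
    using riesz_projection_stable[OF Theta(1-3) SN_cl GV(1) EW eig compl res low] by blast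
  have \<sigma>2: "\<sigma> * \<sigma> = 1" "cmod \<sigma> = 1" using \<sigma> by auto
  obtain CV where CV: "CV > 0" "\<And>u. norm (\<iota> u) \<le> CV * norm u" using A2(2) by blast
  define n where "n = C.A_norm"
  have n: "n > 0" "root 2 n > 0" using C.A_norm_pos by (auto simp: n_def)
  have n_eq: "n = subspace_onorm E (ritz_op a E)" by (simp add: n_def C.A_norm_def a_eq)
  \<comment> \<open>small enough that residuals are at most \<open>1/2\<close> not only in \<open>V\<close> but, through the embedding constant,
    also in \<open>H\<close>\<close>
  define \<epsilon> where "\<epsilon> = min (1 / 2) (1 / (4 * CV * root 2 n))"
  have \<epsilon>: "\<epsilon> > 0" "\<epsilon> \<le> 1 / 2" using CV(1) n by (auto simp: \<epsilon>_def)
  have \<epsilon>C: "CV * \<epsilon> * (2 * root 2 n) \<le> 1 / 2"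
  proof -
    have "\<epsilon> * (4 * CV * root 2 n) \<le> 1" using CV(1) n by (simp add: \<epsilon>_def pos_le_divide_eq[symmetric])
    then show ?thesis by (simp add: mult_ac)
  qed
  from stable[OF \<epsilon>(1)] obtain d where d: "d > 0"
    and st: "\<And>S'. finite_rank_perturbation SN d S' \<Longrightarrow> riesz_near \<Theta> S' \<sigma> (oproj GV) \<epsilon>" by blast
  from conv[OF d] obtain h0 where h0: "h0 > 0"
    "\<And>h u. 0 < h \<Longrightarrow> h < h0 \<Longrightarrow> norm (SNh h u - SN u) \<le> d * norm u" by blast
  have main: "gap EV (Eh h) < 1 \<and>
    hausdorff_dist \<Lambda> (\<Lambda>h h) \<le>
      (Lambda_max B (\<iota> ` Eh h))\<^sup>2 * (gap EV (Eh h))\<^sup>2 +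
      10 * subspace_onorm E (ritz_op a E) * (gap E (\<iota> ` Eh h))\<^sup>2 \<and>
    (Lambda_max B (\<iota> ` Eh h))\<^sup>2 \<le>
      (1 / (1 - gap EV (Eh h)))\<^sup>2 * subspace_onorm E (ritz_op a E)"
    if h: "0 < h" "h < h0" for h
  proof -
    define Ph where "Ph = riesz_projection \<Theta> (SNh h)"
    have Ph: "clinear Ph" "\<And>u. Ph (Ph u) = \<sigma> *\<^sub>C Ph u" "\<And>u. norm (Ph u - \<sigma> *\<^sub>C oproj GV u) \<le> \<epsilon> * norm u"
    proof -
      have "finite_rank_perturbation SN d (SNh h)"
        unfolding finite_rank_perturbation_def
        using SNh_cl[OF h(1)] Vh[OF h(1)] SNh_fr[OF h(1)] h0(2)[OF h] by blast
      from st[OF this] show "clinear Ph" "\<And>u. Ph (Ph u) = \<sigma> *\<^sub>C Ph u"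
        "\<And>u. norm (Ph u - \<sigma> *\<^sub>C oproj GV u) \<le> \<epsilon> * norm u"
        by (auto simp: Ph_def riesz_near_def)
    qed
    note Pl = clinear_props[OF Ph(1)]
    have Eh: "Eh h = range Ph" by (simp add: Eh_eq Ph_def)
    have Eh_sub: "csubspace (Eh h)" unfolding Eh csubspace_iff
      by (auto simp: image_iff simp flip: Pl(1,2)) (metis Pl(3))
    have near: "norm (\<sigma> *\<^sub>C Ph u - oproj GV u) \<le> \<epsilon> * norm u" for u
    proof -
      have "\<sigma> *\<^sub>C Ph u - oproj GV u = \<sigma> *\<^sub>C (Ph u - \<sigma> *\<^sub>C oproj GV u)"
        by (simp add: complex_vector.scale_right_diff_distrib scaleC_scaleC \<sigma>2 scaleC_one)
      then show ?thesis using Ph(3)[of u] by (simp add: norm_scaleC \<sigma>2)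
    qed
    have nearE: "norm (Ph (\<sigma> *\<^sub>C u) - u) \<le> \<epsilon> * norm u" if "u \<in> cspan GV" for u
      using near[of u] oproj_ident[OF GV(1) that] by (simp add: Pl(2))
    have res_Eh: "norm (u - oproj GV u) \<le> \<epsilon> * norm u" if u: "u \<in> Eh h" for u
    proof -
      have "Ph u = \<sigma> *\<^sub>C u" using u Ph(2) unfolding Eh by auto
      then have "\<sigma> *\<^sub>C Ph u = u" by (simp add: scaleC_scaleC \<sigma>2 scaleC_one)
      then show ?thesis using near[of u] by simp
    qed
    obtain l x where lx: "l \<in> \<Lambda>" "x \<in> eigenspace D A l" "x \<noteq> 0"
      using \<open>\<Lambda> \<noteq> {}\<close> Lam(3) complex_vector.subspace_0[OF S0.eigenspace_subspace] by blast
    obtain e where e: "e \<in> EV" "e \<noteq> 0" using lx eig_E[OF lx(1,2)] A2(1) il(3) unfolding EV_eq by blast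
    have gap_eps: "gap (cspan GV) (Eh h) \<le> \<epsilon>"
    proof (rule gap_le[OF GV(1) Eh_sub _ e(2)])
      show "e \<in> cspan GV" using e GV(2) by simp
      show "\<epsilon> < 1" using \<epsilon>(2) by simp
      show "\<exists>v\<in>Eh h. norm (u - v) \<le> \<epsilon> * norm u" if "u \<in> cspan GV" for u
        using nearE[OF that] unfolding Eh by (intro bexI[of _ "Ph (\<sigma> *\<^sub>C u)"]) (auto simp: norm_minus_commute)
    qed (rule res_Eh)
    define g where "g = gap EV (Eh h)"
    have g_le: "g \<le> \<epsilon>" "g \<le> 1 / 2" using gap_eps \<epsilon>(2) GV(2) by (auto simp: g_def)
    have g_res: "norm (u - oproj GV u) \<le> g * norm u" if "u \<in> Eh h" for u
      using norm_residual_le_gap[OF GV(1) Eh_sub that] GV(2) by (simp add: g_def)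
    have surjV: "\<exists>u\<in>Eh h. oproj GV u = v" if v: "v \<in> EV" for v
    proof -
      have cl: "clinear (\<lambda>u. Ph (\<sigma> *\<^sub>C u))"
        using Pl by (auto simp: clinear_iff scaleC_add_right complex_vector.scale_left_commute)
      have "norm (Ph (\<sigma> *\<^sub>C u) - u) \<le> 1 / 2 * norm u" if "u \<in> cspan GV" for u
        using nearE[OF that] mult_right_mono[OF \<epsilon>(2), of "norm u"] by simp
      then obtain x where "oproj GV (Ph (\<sigma> *\<^sub>C x)) = v"
        using near_identity_surjective[OF GV(1) cl, of v] v GV(2) by blast
      then show ?thesis unfolding Eh by blast
    qed
    obtain u0 where u0: "u0 \<in> Eh h" "oproj GV u0 = e" using surjV[OF e(1)] by blast
    have u0_nz: "u0 \<noteq> 0" using u0(2) e(2) by (auto simp: oproj_def)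
    have nonneg: "0 \<le> r" if "x \<noteq> 0" "norm v \<le> r * norm x" for r and x v :: "'b::complex_inner"
      using order_trans[OF norm_ge_zero that(2)] that(1) by (simp add: zero_le_mult_iff)
    have g0: "0 \<le> g" using nonneg[OF u0_nz g_res[OF u0(1)]] .
    define X where "X = \<iota> ` Eh h"
    have X_sub: "csubspace X" unfolding X_def csubspace_iff using Eh_sub
      by (auto simp: csubspace_iff image_iff simp flip: il(1,2)) (metis il(3))
    have X_DB: "X \<subseteq> DB" using V_norm by (auto simp: X_def)
    have B_res: "norm (B (x - oproj GE x)) \<le> s * norm (B x)"
      if s: "\<And>u. u \<in> Eh h \<Longrightarrow> norm (u - oproj GV u) \<le> s * norm u" and x: "x \<in> X" for s x
    proof -
      obtain u where u: "u \<in> Eh h" "x = \<iota> u" using x by (auto simp: X_def)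
      have "x - oproj GE x = \<iota> (u - oproj GV u)" by (simp add: u(2) proj_eq il)
      then show ?thesis using s[OF u(1)] V_norm u(2) by metis
    qed
    \<comment> \<open>the residual in \<open>H\<close> is bounded both by the gap and, whatever the gap, by \<open>1/2\<close>\<close>
    define t where "t = min (gap E X) (1 / 2)"
    have t_res: "norm (x - oproj GE x) \<le> t * norm x" if x: "x \<in> X" for x
    proof -
      obtain u where u: "u \<in> Eh h" "x = \<iota> u" using x by (auto simp: X_def)
      have "x - oproj GE x = \<iota> (u - oproj GV u)" by (simp add: u(2) proj_eq il)
      then have "norm (x - oproj GE x) \<le> CV * norm (u - oproj GV u)" using CV(2) by metis
      also have "\<dots> \<le> CV * (\<epsilon> * norm u)" using res_Eh[OF u(1)] CV(1) by simp
      also have "norm u = norm (B x)" using V_norm u(2) by simp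
      also have "CV * (\<epsilon> * norm (B x)) \<le> CV * (\<epsilon> * (2 * root 2 n * norm x))"
      proof -
        have "norm (B x) \<le> 1 / (1 - \<epsilon>) * root 2 n * norm x"
          unfolding n_def using \<epsilon> B_res[OF res_Eh x]
          by (intro C.norm_B_le[OF GE X_sub X_DB _ _ x]) auto
        also have "\<dots> \<le> 2 * root 2 n * norm x"
          using \<epsilon> n by (intro mult_right_mono) (auto simp: field_simps)
        finally show ?thesis using CV(1) \<epsilon>(1) by simp
      qed
      also have "\<dots> = (CV * \<epsilon> * (2 * root 2 n)) * norm x" by simp
      also have "\<dots> \<le> 1 / 2 * norm x" using \<epsilon>C by (rule mult_right_mono) simp
      finally have "norm (x - oproj GE x) \<le> 1 / 2 * norm x" .
      moreover have "norm (x - oproj GE x) \<le> gap E X * norm x"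
        using norm_residual_le_gap[OF GE(1) X_sub x] GE(2) by simp
      ultimately show ?thesis unfolding t_def min_def by simp
    qed
    have x0: "\<iota> u0 \<in> X" "\<iota> u0 \<noteq> 0" using u0(1) u0_nz inj0[of u0 0] il(3) by (auto simp: X_def)
    have t0: "0 \<le> t" using nonneg[OF x0(2) t_res[OF x0(1)]] .
    have "t\<^sup>2 \<le> (1 / 2)\<^sup>2" using t0 by (intro power_mono) (auto simp: t_def)
    then have t2: "t\<^sup>2 \<le> 1 / 2" by (simp add: power_divide)
    have surj: "\<exists>x\<in>X. oproj GE x = v" if v: "v \<in> E" for v
    proof -
      obtain v' where v': "v = \<iota> v'" "v' \<in> EV" using v A2(1) unfolding EV_eq by blast
      then show ?thesis using surjV[OF v'(2)] proj_eq unfolding X_def by auto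
    qed
    note est = C.ritz_estimate[OF GE X_sub X_DB g0 g_le(2) B_res[OF g_res] t0 t2 t_res surj]
    have "t\<^sup>2 \<le> (gap E X)\<^sup>2" using t0 by (intro power_mono) (auto simp: t_def)
    then have "10 * n * t\<^sup>2 \<le> 10 * n * (gap E X)\<^sup>2" using n(1) by (intro mult_left_mono) auto
    then have "hausdorff_dist \<Lambda> (\<Lambda>h h) \<le> (Lambda_max B X)\<^sup>2 * g\<^sup>2 + 10 * n * (gap E X)\<^sup>2"
      using est(2) by (simp add: Lamh_eq X_def[symmetric] a_eq n_def)
    moreover have "(Lambda_max B X)\<^sup>2 \<le> (1 / (1 - g))\<^sup>2 * n" using est(1) by (simp add: n_def)
    moreover have "g < 1" using g_le(2) by simp
    ultimately show ?thesis unfolding n_eq X_def g_def by blast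
  qed
  have "\<forall>h. 0 < h \<and> h < h0 \<longrightarrow>
    gap EV (Eh h) < 1 \<and>
    hausdorff_dist \<Lambda> (\<Lambda>h h) \<le>
      (Lambda_max B (\<iota> ` Eh h))\<^sup>2 * (gap EV (Eh h))\<^sup>2 +
      10 * subspace_onorm E (ritz_op a E) * (gap E (\<iota> ` Eh h))\<^sup>2 \<and>
    (Lambda_max B (\<iota> ` Eh h))\<^sup>2 \<le>
      (1 / (1 - gap EV (Eh h)))\<^sup>2 * subspace_onorm E (ritz_op a E)"
    using main by simp
  moreover have "(0::real) < 10" by simp
  ultimately show ?thesis using h0(1) by blast
qed

end
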